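(* Let $k$ be a field and let $D$ be a cocommutative pointed Hopf algebra over $k$ whose irreducible component $D^{1}$ containing $1$ is a Birkhoff-Witt bialgebra. Let $(L/K,A,H)$ be a Picard-Vessiot extension of artinian simple (AS) $D$-module algebras such that $L^{D}=K^{D}=k$, and assume that $L/K$ is finitely generated. Let $F$ be an intermediate AS $D$-module algebra of $L/K$, corresponding to the Hopf ideal $I\subset H$. If $$\bigcap_{g\in\mathrm{Alg}_{k}(H/I,k)}\mathrm{Ker}\, g=0,$$ then $L^{\mathbf{G}(L/F)(k)}=F$.
   Context: **Birkhoff-Witt bialgebra.** Let $B(k)=\bigoplus_{n\ge 0}k d_n$ be the coalgebra with $\Delta d_n=\sum_{i+j=n}d_i\otimes d_j$, $\varepsilon(d_n)=\delta_{n,0}$. An irreducible cocommutative bialgebra is a Birkhoff-Witt bialgebra if, as a coalgebra, it is isomorphic to the cofree pointed irreducible cocommutative coalgebra $B(U)$ on its space $U$ of primitive elements, i.e. to the directed union (along $d_0=1$) of finite tensor products of copies of $B(k)$ indexed by a basis of $U$. **AS $D$-module algebras.** All $D$-module algebras are commutative. For a $D$-module $M$, $M^{D}=\{m\in M : dm=\varepsilon(d)m\ \ \forall d\in D\}$. A $D$-module algebra is artinian simple (AS) if it is (nonzero and) artinian as a ring and has no nontrivial $D$-stable ideal. An extension $L/K$ of AS $D$-module algebras is an inclusion $K\subset L$ of a $D$-module subalgebra; an intermediate AS $D$-module algebra is a $D$-module subalgebra $K\subset F\subset L$ that is AS. **Picard-Vessiot extension.** An extension $L/K$ of AS $D$-module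 algebras is Picard-Vessiot if $K^{D}=L^{D}$ and there is a (necessarily unique) $D$-module subalgebra $K\subset A\subset L$ such that the total quotient ring of $A$ equals $L$ and $H=(A\otimes_{K}A)^{D}$ generates the left $A$-module $A\otimes_{K}A$ (with diagonal $D$-action). Then $H$ is a commutative Hopf algebra over $K^{D}$: its coproduct, counit and antipode are induced by $a\otimes b\mapsto (a\otimes 1)\otimes_A(1\otimes b)$, $a\otimes b\mapsto ab$ and $a\otimes b\mapsto b\otimes a$ on $A\otimes_K A$. One writes "$(L/K,A,H)$ is a Picard-Vessiot extension" to indicate these data. **Finite generation.** $L/K$ is finitely generated if there are finitely many $x_1,\dots,x_n\in L$ such that $L$ is the smallest AS $D$-module subalgebra of $L$ containing $K$ and $x_1,\dots,x_n$. **Galois correspondence.** (Known.) Intermediate AS $D$-module algebras $F$ of $L/K$ correspond bijectively to Hopf ideals $I$ of $H$ via $F\mapsto I=H\cap\mathrm{Ker}(L\otimes_K L\twoheadrightarrow L\otimes_F L)$, with inverse $I\mapsto F=\{a\in L : 1\otimes a-a\otimes 1\in I\cdot(L\otimes_K L)\}$. If $F$ corresponds to $I$, then $(L/F,AF,H/I)$ is a Picard-Vessiot extension, where $AF$ is the subalgebra of $L$ generated by $A$ and $F$. **Group scheme and fixed algebra.** $\mathbf{G}(L/K)=\mathrm{Spec}\,H$; similarly $\mathbf{G}(L/F)=\mathrm{Spec}(H/I)$, so $\mathbf{G}(L/F)(k)=\mathrm{Alg}_k(H/I,k)$, the group of $k$-algebra maps $H/I\to k$. There is an isomorphism $\mu:A\otimes_k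 H\to A\otimes_K A$, $a\otimes h\mapsto (a\otimes 1)h$. The element $g\in\mathrm{Alg}_k(H,k)$ acts on $A$ by $a\mapsto(\mathrm{id}_A\otimes g)(\mu^{-1}(1\otimes a))$, and this extends uniquely to $L$, identifying $\mathbf{G}(L/K)(k)$ with the group $\mathrm{Aut}_D(L/K)$ of $D$-linear $K$-algebra automorphisms of $L$; likewise $\mathbf{G}(L/F)(k)=\mathrm{Aut}_D(L/F)$. $L^{\mathbf{G}(L/F)(k)}$ denotes the set of $x\in L$ fixed by all elements of $\mathbf{G}(L/F)(k)$. *)

theory Defs
  imports "HOL-Library.Poly_Mapping" "HOL-Library.Multiset" "HOL-Algebra.Module"
    "HOL-Algebra.Subrings" "HOL-Algebra.QuotRing"
begin

section \<open>Subsets of types as rings and modules\<close>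

text \<open>
  The field \<open>k\<close>, the Hopf algebra \<open>D\<close> and the algebra \<open>L\<close> are types of the appropriate
  algebraic class; subobjects of them are subsets. Tensor products, their subrings and the quotients
  of these are records of HOL-Algebra.
\<close>

definition ring_on :: "'a::ring_1 set \<Rightarrow> 'a ring" where
  "ring_on S = \<lparr>carrier = S, monoid.mult = (*), one = 1, zero = 0, add = (+)\<rparr>"

definition mod_on :: "('r \<Rightarrow> 'a \<Rightarrow> 'a) \<Rightarrow> 'a::ring_1 set \<Rightarrow> ('r, 'a) module" where
  "mod_on s S = \<lparr>carrier = S, monoid.mult = (*), one = 1, zero = 0, add = (+), smult = s\<rparr>"

abbreviation base_field :: "'k::field ring" where
  "base_field \<equiv> ring_on UNIV"


section \<open>Tensor products\<close>

text \<open>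
  The tensor product of \<open>M\<close> and \<open>N\<close> over the commutative ring \<open>R\<close> is the quotient of the free abelian
  group on \<open>carrier M \<times> carrier N\<close> by the subgroup \<open>tensor_null R M N\<close> generated by the usual
  relators; its elements are cosets of that subgroup.
\<close>

type_synonym ('a, 'b) tens = "(('a \<times> 'b) \<Rightarrow>\<^sub>0 int) set"

inductive_set tensor_null ::
  "('r, 'p) ring_scheme \<Rightarrow> ('r, 'a, 'm) module_scheme \<Rightarrow> ('r, 'b, 'n) module_scheme \<Rightarrow> ('a, 'b) tens"
  for R and M and N
where
  zero: "0 \<in> tensor_null R M N"
| diff: "x \<in> tensor_null R M N \<Longrightarrow> y \<in> tensor_null R M N \<Longrightarrow> x - y \<in> tensor_null R M N"
| add_left: "a \<in> carrier M \<Longrightarrow> a' \<in> carrier M \<Longrightarrow> b \<in> carrier N \<Longrightarrow>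
    frag_of (a \<oplus>\<^bsub>M\<^esub> a', b) - frag_of (a, b) - frag_of (a', b) \<in> tensor_null R M N"
| add_right: "a \<in> carrier M \<Longrightarrow> b \<in> carrier N \<Longrightarrow> b' \<in> carrier N \<Longrightarrow>
    frag_of (a, b \<oplus>\<^bsub>N\<^esub> b') - frag_of (a, b) - frag_of (a, b') \<in> tensor_null R M N"
| balance: "r \<in> carrier R \<Longrightarrow> a \<in> carrier M \<Longrightarrow> b \<in> carrier N \<Longrightarrow>
    frag_of (r \<odot>\<^bsub>M\<^esub> a, b) - frag_of (a, r \<odot>\<^bsub>N\<^esub> b) \<in> tensor_null R M N"

definition tensor_class ::
  "('r, 'p) ring_scheme \<Rightarrow> ('r, 'a, 'm) module_scheme \<Rightarrow> ('r, 'b, 'n) module_scheme \<Rightarrow>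
    (('a \<times> 'b) \<Rightarrow>\<^sub>0 int) \<Rightarrow> ('a, 'b) tens" where
  "tensor_class R M N x = {y. y - x \<in> tensor_null R M N}"

text \<open>The multiplication of \<open>tensor R M N\<close> is meaningful only when \<open>M\<close> and \<open>N\<close> are \<open>R\<close>-algebras.\<close>

definition tensor ::
  "('r, 'p) ring_scheme \<Rightarrow> ('r, 'a, 'm) module_scheme \<Rightarrow> ('r, 'b, 'n) module_scheme \<Rightarrow>
    ('r, ('a, 'b) tens) module" where
  "tensor R M N =
    \<lparr>carrier = tensor_class R M N ` {x. Poly_Mapping.keys x \<subseteq> carrier M \<times> carrier N},
     monoid.mult = (\<lambda>X Y. \<Union>x\<in>X. \<Union>y\<in>Y. tensor_class R M N
       (frag_extend (\<lambda>(a, b). frag_extend (\<lambda>(a', b'). frag_of (a \<otimes>\<^bsub>M\<^esub> a', b \<otimes>\<^bsub>N\<^esub> b')) y) x)),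
     one = tensor_class R M N (frag_of (\<one>\<^bsub>M\<^esub>, \<one>\<^bsub>N\<^esub>)),
     zero = tensor_class R M N 0,
     add = (\<lambda>X Y. \<Union>x\<in>X. \<Union>y\<in>Y. tensor_class R M N (x + y)),
     smult = (\<lambda>r X. \<Union>x\<in>X. tensor_class R M N (frag_extend (\<lambda>(a, b). frag_of (r \<odot>\<^bsub>M\<^esub> a, b)) x))\<rparr>"

definition pure_tensor ::
  "('r, 'p) ring_scheme \<Rightarrow> ('r, 'a, 'm) module_scheme \<Rightarrow> ('r, 'b, 'n) module_scheme \<Rightarrow>
    'a \<Rightarrow> 'b \<Rightarrow> ('a, 'b) tens" where
  "pure_tensor R M N a b = tensor_class R M N (frag_of (a, b))"

text \<open>
  The additive map out of a tensor product, with values in \<open>T\<close>, induced by the map \<open>\<beta>\<close>.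
  It is always applied to biadditive balanced \<open>\<beta>\<close>, so that the chosen representative is irrelevant.
\<close>

definition tensor_lift ::
  "('c, 't) ring_scheme \<Rightarrow> ('a \<Rightarrow> 'b \<Rightarrow> 'c) \<Rightarrow> ('a, 'b) tens \<Rightarrow> 'c" where
  "tensor_lift T \<beta> X =
    (let x = (SOME x. x \<in> X)
     in \<Oplus>\<^bsub>T\<^esub>p\<in>Poly_Mapping.keys x. [Poly_Mapping.lookup x p] \<cdot>\<^bsub>T\<^esub> \<beta> (fst p) (snd p))"


section \<open>Coalgebras, bialgebras and Hopf algebras over a field\<close>

abbreviation ctensor :: "('k::field, 'c) module \<Rightarrow> ('k, ('c, 'c) tens) module" where
  "ctensor C \<equiv> tensor base_field C C"

abbreviation cpure :: "('k::field, 'c) module \<Rightarrow> 'c \<Rightarrow> 'c \<Rightarrow> ('c, 'c) tens" where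
  "cpure C \<equiv> pure_tensor base_field C C"

definition tensor_square_map ::
  "('k::field, 'c) module \<Rightarrow> ('b \<Rightarrow> 'c) \<Rightarrow> ('b, 'b) tens \<Rightarrow> ('c, 'c) tens" where
  "tensor_square_map C f = tensor_lift (ctensor C) (\<lambda>a b. cpure C (f a) (f b))"

text \<open>In \<open>coassoc\<close> the source \<open>(C \<otimes> C) \<otimes> C\<close> is rebracketed, so both sides lie in \<open>C \<otimes> (C \<otimes> C)\<close>.\<close>

locale coalgebra =
  fixes C :: "('k::field, 'c) module"
    and \<Delta> :: "'c \<Rightarrow> ('c, 'c) tens"
    and \<epsilon> :: "'c \<Rightarrow> 'k"
  assumes module: "module base_field C"
    and comult_closed: "x \<in> carrier C \<Longrightarrow> \<Delta> x \<in> carrier (ctensor C)"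
    and comult_add: "x \<in> carrier C \<Longrightarrow> y \<in> carrier C \<Longrightarrow>
          \<Delta> (x \<oplus>\<^bsub>C\<^esub> y) = \<Delta> x \<oplus>\<^bsub>ctensor C\<^esub> \<Delta> y"
    and comult_smult: "x \<in> carrier C \<Longrightarrow> \<Delta> (c \<odot>\<^bsub>C\<^esub> x) = c \<odot>\<^bsub>ctensor C\<^esub> \<Delta> x"
    and counit_add: "x \<in> carrier C \<Longrightarrow> y \<in> carrier C \<Longrightarrow> \<epsilon> (x \<oplus>\<^bsub>C\<^esub> y) = \<epsilon> x + \<epsilon> y"
    and counit_smult: "x \<in> carrier C \<Longrightarrow> \<epsilon> (c \<odot>\<^bsub>C\<^esub> x) = c * \<epsilon> x"
    and counit_left: "x \<in> carrier C \<Longrightarrow> tensor_lift C (\<lambda>a b. \<epsilon> a \<odot>\<^bsub>C\<^esub> b) (\<Delta> x) = x"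
    and counit_right: "x \<in> carrier C \<Longrightarrow> tensor_lift C (\<lambda>a b. \<epsilon> b \<odot>\<^bsub>C\<^esub> a) (\<Delta> x) = x"
    and coassoc: "x \<in> carrier C \<Longrightarrow>
          (let T = tensor base_field C (ctensor C); p = pure_tensor base_field C (ctensor C)
           in tensor_lift T (\<lambda>a b. p a (\<Delta> b)) (\<Delta> x)
            = tensor_lift T (\<lambda>a b. tensor_lift T (\<lambda>a1 a2. p a1 (cpure C a2 b)) (\<Delta> a)) (\<Delta> x))"

definition cocommutative :: "('k::field, 'c) module \<Rightarrow> ('c \<Rightarrow> ('c, 'c) tens) \<Rightarrow> bool" where
  "cocommutative C \<Delta> \<longleftrightarrow>
    (\<forall>x\<in>carrier C. tensor_lift (ctensor C) (\<lambda>a b. cpure C b a) (\<Delta> x) = \<Delta> x)"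

locale bialgebra = coalgebra C \<Delta> \<epsilon>
  for C :: "('k::field, 'c) module" and \<Delta> and \<epsilon> +
  assumes ring: "ring C"
    and smult_mult_left: "x \<in> carrier C \<Longrightarrow> y \<in> carrier C \<Longrightarrow>
          (c \<odot>\<^bsub>C\<^esub> x) \<otimes>\<^bsub>C\<^esub> y = c \<odot>\<^bsub>C\<^esub> (x \<otimes>\<^bsub>C\<^esub> y)"
    and smult_mult_right: "x \<in> carrier C \<Longrightarrow> y \<in> carrier C \<Longrightarrow>
          x \<otimes>\<^bsub>C\<^esub> (c \<odot>\<^bsub>C\<^esub> y) = c \<odot>\<^bsub>C\<^esub> (x \<otimes>\<^bsub>C\<^esub> y)"
    and comult_mult: "x \<in> carrier C \<Longrightarrow> y \<in> carrier C \<Longrightarrow>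
          \<Delta> (x \<otimes>\<^bsub>C\<^esub> y) = \<Delta> x \<otimes>\<^bsub>ctensor C\<^esub> \<Delta> y"
    and comult_one: "\<Delta> \<one>\<^bsub>C\<^esub> = \<one>\<^bsub>ctensor C\<^esub>"
    and counit_mult: "x \<in> carrier C \<Longrightarrow> y \<in> carrier C \<Longrightarrow> \<epsilon> (x \<otimes>\<^bsub>C\<^esub> y) = \<epsilon> x * \<epsilon> y"
    and counit_one: "\<epsilon> \<one>\<^bsub>C\<^esub> = 1"

definition is_antipode ::
  "('k::field, 'c) module \<Rightarrow> ('c \<Rightarrow> ('c, 'c) tens) \<Rightarrow> ('c \<Rightarrow> 'k) \<Rightarrow> ('c \<Rightarrow> 'c) \<Rightarrow> bool" where
  "is_antipode C \<Delta> \<epsilon> S \<longleftrightarrow>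
    S \<in> carrier C \<rightarrow> carrier C \<and>
    (\<forall>x\<in>carrier C. \<forall>y\<in>carrier C. S (x \<oplus>\<^bsub>C\<^esub> y) = S x \<oplus>\<^bsub>C\<^esub> S y) \<and>
    (\<forall>c. \<forall>x\<in>carrier C. S (c \<odot>\<^bsub>C\<^esub> x) = c \<odot>\<^bsub>C\<^esub> S x) \<and>
    (\<forall>x\<in>carrier C. tensor_lift C (\<lambda>a b. S a \<otimes>\<^bsub>C\<^esub> b) (\<Delta> x) = \<epsilon> x \<odot>\<^bsub>C\<^esub> \<one>\<^bsub>C\<^esub> \<and>
                   tensor_lift C (\<lambda>a b. a \<otimes>\<^bsub>C\<^esub> S b) (\<Delta> x) = \<epsilon> x \<odot>\<^bsub>C\<^esub> \<one>\<^bsub>C\<^esub>)"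

locale hopf_algebra = bialgebra C \<Delta> \<epsilon>
  for C :: "('k::field, 'c) module" and \<Delta> and \<epsilon> +
  assumes antipode: "\<exists>S. is_antipode C \<Delta> \<epsilon> S"


subsection \<open>Subcoalgebras\<close>

definition subcoalgebra ::
  "('k::field, 'c) module \<Rightarrow> ('c \<Rightarrow> ('c, 'c) tens) \<Rightarrow> 'c set \<Rightarrow> bool" where
  "subcoalgebra C \<Delta> S \<longleftrightarrow>
    submodule S base_field C \<and>
    (\<forall>x\<in>S. \<Delta> x \<in> tensor_square_map C id ` carrier (ctensor (C\<lparr>carrier := S\<rparr>)))"

text \<open>
  The comultiplication that a subcoalgebra \<open>S\<close> inherits: \<open>S \<otimes> S\<close> and \<open>C \<otimes> C\<close> consist of different
  cosets, and the preimage chosen here is unique because \<open>S \<otimes> S \<rightarrow> C \<otimes> C\<close> is injective over a field.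
\<close>

definition sub_comult ::
  "('k::field, 'c) module \<Rightarrow> ('c \<Rightarrow> ('c, 'c) tens) \<Rightarrow> 'c set \<Rightarrow> 'c \<Rightarrow> ('c, 'c) tens" where
  "sub_comult C \<Delta> S x =
    (SOME t. t \<in> carrier (ctensor (C\<lparr>carrier := S\<rparr>)) \<and> tensor_square_map C id t = \<Delta> x)"

definition simple_subcoalgebra ::
  "('k::field, 'c) module \<Rightarrow> ('c \<Rightarrow> ('c, 'c) tens) \<Rightarrow> 'c set \<Rightarrow> bool" where
  "simple_subcoalgebra C \<Delta> S \<longleftrightarrow>
    subcoalgebra C \<Delta> S \<and> S \<noteq> {\<zero>\<^bsub>C\<^esub>} \<and>
    (\<forall>T. subcoalgebra C \<Delta> T \<and> T \<subseteq> S \<longrightarrow> T = {\<zero>\<^bsub>C\<^esub>} \<or> T = S)"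

definition pointed :: "('k::field, 'c) module \<Rightarrow> ('c \<Rightarrow> ('c, 'c) tens) \<Rightarrow> bool" where
  "pointed C \<Delta> \<longleftrightarrow>
    (\<forall>S. simple_subcoalgebra C \<Delta> S \<longrightarrow>
      (\<exists>x\<in>carrier C. x \<noteq> \<zero>\<^bsub>C\<^esub> \<and> S = range (\<lambda>c. c \<odot>\<^bsub>C\<^esub> x)))"

text \<open>Sweedler's definition: any two nonzero subcoalgebras meet nontrivially.\<close>

definition irreducible_subcoalgebra ::
  "('k::field, 'c) module \<Rightarrow> ('c \<Rightarrow> ('c, 'c) tens) \<Rightarrow> 'c set \<Rightarrow> bool" where
  "irreducible_subcoalgebra C \<Delta> S \<longleftrightarrow>
    subcoalgebra C \<Delta> S \<and>
    (\<forall>T T'. subcoalgebra C \<Delta> T \<and> T \<subseteq> S \<and> T \<noteq> {\<zero>\<^bsub>C\<^esub>} \<and>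
            subcoalgebra C \<Delta> T' \<and> T' \<subseteq> S \<and> T' \<noteq> {\<zero>\<^bsub>C\<^esub>} \<longrightarrow> T \<inter> T' \<noteq> {\<zero>\<^bsub>C\<^esub>})"

definition irreducible_component ::
  "('k::field, 'c) module \<Rightarrow> ('c \<Rightarrow> ('c, 'c) tens) \<Rightarrow> 'c set \<Rightarrow> bool" where
  "irreducible_component C \<Delta> S \<longleftrightarrow>
    irreducible_subcoalgebra C \<Delta> S \<and>
    (\<forall>T. irreducible_subcoalgebra C \<Delta> T \<and> S \<subseteq> T \<longrightarrow> T = S)"


subsection \<open>Birkhoff-Witt bialgebras\<close>

definition coalgebra_iso ::
  "('k::field, 'b) module \<Rightarrow> ('b \<Rightarrow> ('b, 'b) tens) \<Rightarrow> ('b \<Rightarrow> 'k) \<Rightarrow>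
   ('k, 'c) module \<Rightarrow> ('c \<Rightarrow> ('c, 'c) tens) \<Rightarrow> ('c \<Rightarrow> 'k) \<Rightarrow> ('b \<Rightarrow> 'c) \<Rightarrow> bool" where
  "coalgebra_iso B \<Delta>\<^sub>B \<epsilon>\<^sub>B C \<Delta>\<^sub>C \<epsilon>\<^sub>C f \<longleftrightarrow>
    bij_betw f (carrier B) (carrier C) \<and>
    (\<forall>x\<in>carrier B. \<forall>y\<in>carrier B. f (x \<oplus>\<^bsub>B\<^esub> y) = f x \<oplus>\<^bsub>C\<^esub> f y) \<and>
    (\<forall>c. \<forall>x\<in>carrier B. f (c \<odot>\<^bsub>B\<^esub> x) = c \<odot>\<^bsub>C\<^esub> f x) \<and>
    (\<forall>x\<in>carrier B. tensor_square_map C f (\<Delta>\<^sub>B x) = \<Delta>\<^sub>C (f x)) \<and>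
    (\<forall>x\<in>carrier B. \<epsilon>\<^sub>C (f x) = \<epsilon>\<^sub>B x)"

text \<open>
  \<open>B(U)\<close> for a space \<open>U\<close> with basis \<open>X\<close>. The tensor product of the copies of \<open>B(k)\<close> indexed by a finite
  subset of \<open>X\<close> has the basis of products of the \<open>d\<^sub>n\<close>, one for each family of exponents; passing to the
  union along \<open>d\<^sub>0 = 1\<close> pads such families by zeros. So \<open>B(U)\<close> has a basis \<open>d\<^sub>m\<close> indexed by the
  multisets \<open>m\<close> over \<open>X\<close> (\<open>count m x\<close> is the exponent at \<open>x\<close>), and multiplying the formulas for the
  factors gives \<open>\<Delta> d\<^sub>m = (\<Sum> i + j = m. d\<^sub>i \<otimes> d\<^sub>j)\<close> and \<open>\<epsilon> (d\<^sub>m) = \<delta>(m,0)\<close>. Only the module structure of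
  the record is used; the product of \<open>'x multiset \<Rightarrow>\<^sub>0 'k\<close> plays no role.
\<close>

definition BU :: "'x set \<Rightarrow> ('k::field, 'x multiset \<Rightarrow>\<^sub>0 'k) module" where
  "BU X = mod_on (\<lambda>c. Poly_Mapping.map ((*) c))
            {p. \<forall>m\<in>Poly_Mapping.keys p. set_mset m \<subseteq> X}"

definition BU_comult ::
  "'x set \<Rightarrow> ('x multiset \<Rightarrow>\<^sub>0 'k::field) \<Rightarrow> ('x multiset \<Rightarrow>\<^sub>0 'k, 'x multiset \<Rightarrow>\<^sub>0 'k) tens" where
  "BU_comult X p =
    (\<Oplus>\<^bsub>ctensor (BU X)\<^esub>m\<in>Poly_Mapping.keys p. Poly_Mapping.lookup p m \<odot>\<^bsub>ctensor (BU X)\<^esub>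
      (\<Oplus>\<^bsub>ctensor (BU X)\<^esub>q\<in>{(i, j). i + j = m}.
        cpure (BU X) (Poly_Mapping.single (fst q) 1) (Poly_Mapping.single (snd q) 1)))"

definition BU_counit :: "('x multiset \<Rightarrow>\<^sub>0 'k::field) \<Rightarrow> 'k" where
  "BU_counit p = Poly_Mapping.lookup p {#}"

definition primitive_elements ::
  "('k::field, 'c) module \<Rightarrow> ('c \<Rightarrow> ('c, 'c) tens) \<Rightarrow> 'c set" where
  "primitive_elements C \<Delta> =
    {x \<in> carrier C. \<Delta> x = cpure C x \<one>\<^bsub>C\<^esub> \<oplus>\<^bsub>ctensor C\<^esub> cpure C \<one>\<^bsub>C\<^esub> x}"

definition birkhoff_witt_bialgebra ::
  "('k::field \<Rightarrow> 'c::ring_1 \<Rightarrow> 'c) \<Rightarrow> 'c set \<Rightarrow> ('c \<Rightarrow> ('c, 'c) tens) \<Rightarrow> ('c \<Rightarrow> 'k) \<Rightarrow> bool" where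
  "birkhoff_witt_bialgebra s S \<Delta> \<epsilon> \<longleftrightarrow>
    bialgebra (mod_on s S) \<Delta> \<epsilon> \<and>
    cocommutative (mod_on s S) \<Delta> \<and>
    irreducible_subcoalgebra (mod_on s S) \<Delta> S \<and>
    (\<exists>X f. \<not> module.dependent s X \<and>
           module.span s X = primitive_elements (mod_on s S) \<Delta> \<and>
           coalgebra_iso (BU X) (BU_comult X) BU_counit (mod_on s S) \<Delta> \<epsilon> f)"


section \<open>Artinian simple module algebras\<close>

locale module_algebra = hopf_algebra "mod_on scD UNIV" \<Delta> \<epsilon>
  for scD :: "'k::field \<Rightarrow> 'd::ring_1 \<Rightarrow> 'd" and \<Delta> and \<epsilon> +
  fixes scL :: "'k \<Rightarrow> 'l::comm_ring_1 \<Rightarrow> 'l"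
    and act :: "'d \<Rightarrow> 'l \<Rightarrow> 'l"
  assumes algebra: "algebra base_field (mod_on scL UNIV)"
    and act_add_left: "act (d + e) x = act d x + act e x"
    and act_add_right: "act d (x + y) = act d x + act d y"
    and act_scale_left: "act (scD c d) x = scL c (act d x)"
    and act_scale_right: "act d (scL c x) = scL c (act d x)"
    and act_one: "act 1 x = x"
    and act_mult: "act (d * e) x = act d (act e x)"
    and act_prod: "act d (x * y) = tensor_lift (ring_on UNIV) (\<lambda>d1 d2. act d1 x * act d2 y) (\<Delta> d)"
    and act_unit: "act d 1 = scL (\<epsilon> d) 1"

definition D_subalgebra ::
  "('k \<Rightarrow> 'l::comm_ring_1 \<Rightarrow> 'l) \<Rightarrow> ('d \<Rightarrow> 'l \<Rightarrow> 'l) \<Rightarrow> 'l set \<Rightarrow> bool" where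
  "D_subalgebra scL act B \<longleftrightarrow>
    subring B (ring_on UNIV) \<and> (\<forall>c. \<forall>x\<in>B. scL c x \<in> B) \<and> (\<forall>d. \<forall>x\<in>B. act d x \<in> B)"

definition constants ::
  "('d \<Rightarrow> 'k) \<Rightarrow> ('k \<Rightarrow> 'l \<Rightarrow> 'l) \<Rightarrow> ('d \<Rightarrow> 'l \<Rightarrow> 'l) \<Rightarrow> 'l set \<Rightarrow> 'l set" where
  "constants \<epsilon> scL act B = {x \<in> B. \<forall>d. act d x = scL (\<epsilon> d) x}"

definition artinian_ring :: "('a, 'm) ring_scheme \<Rightarrow> bool" where
  "artinian_ring R \<longleftrightarrow>
    (\<forall>J :: nat \<Rightarrow> 'a set. (\<forall>n. ideal (J n) R \<and> J (Suc n) \<subseteq> J n) \<longrightarrow> (\<exists>N. \<forall>n\<ge>N. J n = J N))"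

definition AS_subalgebra ::
  "('k \<Rightarrow> 'l::comm_ring_1 \<Rightarrow> 'l) \<Rightarrow> ('d \<Rightarrow> 'l \<Rightarrow> 'l) \<Rightarrow> 'l set \<Rightarrow> bool" where
  "AS_subalgebra scL act B \<longleftrightarrow>
    D_subalgebra scL act B \<and> B \<noteq> {0} \<and> artinian_ring (ring_on B) \<and>
    (\<forall>J. ideal J (ring_on B) \<and> (\<forall>d. \<forall>x\<in>J. act d x \<in> J) \<longrightarrow> J = {0} \<or> J = B)"

definition finitely_generated_over ::
  "('k \<Rightarrow> 'l::comm_ring_1 \<Rightarrow> 'l) \<Rightarrow> ('d \<Rightarrow> 'l \<Rightarrow> 'l) \<Rightarrow> 'l set \<Rightarrow> bool" where
  "finitely_generated_over scL act K \<longleftrightarrow>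
    (\<exists>X. finite X \<and> (\<forall>B. AS_subalgebra scL act B \<and> K \<subseteq> B \<and> X \<subseteq> B \<longrightarrow> B = UNIV))"


section \<open>Picard-Vessiot extensions\<close>

text \<open>\<open>self_tensor K A\<close> is the ring \<open>A \<otimes>\<^sub>K A\<close> for subrings \<open>K \<subseteq> A\<close> of \<open>L\<close>.\<close>

abbreviation self_tensor :: "'l::comm_ring_1 set \<Rightarrow> 'l set \<Rightarrow> ('l, ('l, 'l) tens) module" where
  "self_tensor K A \<equiv> tensor (ring_on K) (mod_on (*) A) (mod_on (*) A)"

abbreviation self_pure :: "'l::comm_ring_1 set \<Rightarrow> 'l set \<Rightarrow> 'l \<Rightarrow> 'l \<Rightarrow> ('l, 'l) tens" where
  "self_pure K A \<equiv> pure_tensor (ring_on K) (mod_on (*) A) (mod_on (*) A)"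

text \<open>The canonical map from \<open>A \<otimes>\<^sub>K A\<close> to \<open>A' \<otimes>\<^sub>K' A'\<close> when \<open>K \<subseteq> K'\<close> and \<open>A \<subseteq> A'\<close>.\<close>

definition canonical_map :: "'l::comm_ring_1 set \<Rightarrow> 'l set \<Rightarrow> ('l, 'l) tens \<Rightarrow> ('l, 'l) tens" where
  "canonical_map K' A' = tensor_lift (self_tensor K' A') (self_pure K' A')"

text \<open>
  In the diagonal action the sum over \<open>\<Delta> d\<close> has to be the inner one: only the full sum
  \<open>\<Sum> d\<^sub>1 a \<otimes> d\<^sub>2 b\<close> is \<open>K\<close>-balanced in \<open>(a, b)\<close>.
\<close>

definition diagonal_act ::
  "('d \<Rightarrow> ('d, 'd) tens) \<Rightarrow> ('d \<Rightarrow> 'l \<Rightarrow> 'l) \<Rightarrow> 'l::comm_ring_1 set \<Rightarrow> 'l set \<Rightarrow>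
    'd \<Rightarrow> ('l, 'l) tens \<Rightarrow> ('l, 'l) tens" where
  "diagonal_act \<Delta> act K A d =
    tensor_lift (self_tensor K A)
      (\<lambda>a b. tensor_lift (self_tensor K A) (\<lambda>d1 d2. self_pure K A (act d1 a) (act d2 b)) (\<Delta> d))"

text \<open>The \<open>k\<close>-algebra \<open>H = (A \<otimes>\<^sub>K A)\<^sup>D\<close>; a scalar \<open>c\<close> of \<open>k\<close> acts through the element \<open>c \<sqdot> 1\<close> of \<open>K\<close>.\<close>

definition PV_hopf ::
  "('d \<Rightarrow> ('d, 'd) tens) \<Rightarrow> ('d \<Rightarrow> 'k) \<Rightarrow> ('k \<Rightarrow> 'l \<Rightarrow> 'l) \<Rightarrow> ('d \<Rightarrow> 'l \<Rightarrow> 'l) \<Rightarrow>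
    'l::comm_ring_1 set \<Rightarrow> 'l set \<Rightarrow> ('k, ('l, 'l) tens) module" where
  "PV_hopf \<Delta> \<epsilon> scL act K A =
    (let T = self_tensor K A in
      \<lparr>carrier = {X \<in> carrier T. \<forall>d. diagonal_act \<Delta> act K A d X = scL (\<epsilon> d) 1 \<odot>\<^bsub>T\<^esub> X},
       monoid.mult = monoid.mult T, one = one T, zero = zero T, add = add T,
       smult = (\<lambda>c X. scL c 1 \<odot>\<^bsub>T\<^esub> X)\<rparr>)"

definition total_quotient_ring_is_UNIV :: "'l::comm_ring_1 set \<Rightarrow> bool" where
  "total_quotient_ring_is_UNIV A \<longleftrightarrow>
    (let S = {s \<in> A. \<forall>b\<in>A. s * b = 0 \<longrightarrow> b = 0}
     in (\<forall>s\<in>S. \<exists>t. s * t = 1) \<and> (\<forall>x. \<exists>a\<in>A. \<exists>s\<in>S. x * s = a))"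

definition PV_extension ::
  "('d \<Rightarrow> ('d, 'd) tens) \<Rightarrow> ('d \<Rightarrow> 'k) \<Rightarrow> ('k \<Rightarrow> 'l \<Rightarrow> 'l) \<Rightarrow> ('d \<Rightarrow> 'l \<Rightarrow> 'l) \<Rightarrow>
    'l::comm_ring_1 set \<Rightarrow> 'l set \<Rightarrow> bool" where
  "PV_extension \<Delta> \<epsilon> scL act K A \<longleftrightarrow>
    AS_subalgebra scL act UNIV \<and> AS_subalgebra scL act K \<and>
    constants \<epsilon> scL act K = constants \<epsilon> scL act UNIV \<and>
    D_subalgebra scL act A \<and> K \<subseteq> A \<and>
    total_quotient_ring_is_UNIV A \<and>
    (let T = (self_tensor K A)\<lparr>smult := (\<lambda>a X. self_pure K A a 1 \<otimes>\<^bsub>self_tensor K A\<^esub> X)\<rparr>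
     in \<forall>N. submodule N (ring_on A) T \<and> carrier (PV_hopf \<Delta> \<epsilon> scL act K A) \<subseteq> N \<longrightarrow>
            N = carrier T)"


section \<open>The Galois correspondence and fixed algebras\<close>

text \<open>
  The Hopf ideal corresponding to \<open>F\<close>, namely the intersection of \<open>H\<close> with the kernel of
  \<open>L \<otimes>\<^sub>K L \<rightarrow> L \<otimes>\<^sub>F L\<close>, where \<open>H\<close> is viewed inside \<open>L \<otimes>\<^sub>K L\<close> by means of \<open>canonical_map K UNIV\<close>.
\<close>

definition galois_ideal ::
  "('d \<Rightarrow> ('d, 'd) tens) \<Rightarrow> ('d \<Rightarrow> 'k) \<Rightarrow> ('k \<Rightarrow> 'l \<Rightarrow> 'l) \<Rightarrow> ('d \<Rightarrow> 'l \<Rightarrow> 'l) \<Rightarrow>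
    'l::comm_ring_1 set \<Rightarrow> 'l set \<Rightarrow> 'l set \<Rightarrow> ('l, 'l) tens set" where
  "galois_ideal \<Delta> \<epsilon> scL act K A F =
    {h \<in> carrier (PV_hopf \<Delta> \<epsilon> scL act K A).
      canonical_map K UNIV h \<in>
        a_kernel (self_tensor K UNIV) (self_tensor F UNIV) (canonical_map F UNIV)}"

definition quot_algebra :: "('k, 'h) module \<Rightarrow> 'h set \<Rightarrow> ('k, 'h set) module" where
  "quot_algebra H I =
    ring.extend (H Quot I) (module.fields (\<lambda>c Z. \<Union>h\<in>Z. I +>\<^bsub>H\<^esub> (c \<odot>\<^bsub>H\<^esub> h)))"

definition characters :: "('k::field, 'h) module \<Rightarrow> ('h \<Rightarrow> 'k) set" where
  "characters H =
    {g \<in> ring_hom H base_field. \<forall>c. \<forall>h\<in>carrier H. g (c \<odot>\<^bsub>H\<^esub> h) = c * g h}"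

definition PV_mu ::
  "'l::comm_ring_1 set \<Rightarrow> 'l set \<Rightarrow> ('l, ('l, 'l) tens) tens \<Rightarrow> ('l, 'l) tens" where
  "PV_mu K A =
    tensor_lift (self_tensor K A) (\<lambda>a h. self_pure K A a 1 \<otimes>\<^bsub>self_tensor K A\<^esub> h)"

text \<open>The action of a character \<open>g\<close> of \<open>H\<close> on \<open>A\<close>, and its extension to \<open>L\<close>.\<close>

definition character_act_A ::
  "('d \<Rightarrow> ('d, 'd) tens) \<Rightarrow> ('d \<Rightarrow> 'k) \<Rightarrow> ('k::field \<Rightarrow> 'l \<Rightarrow> 'l) \<Rightarrow> ('d \<Rightarrow> 'l \<Rightarrow> 'l) \<Rightarrow>
    'l::comm_ring_1 set \<Rightarrow> 'l set \<Rightarrow> (('l, 'l) tens \<Rightarrow> 'k) \<Rightarrow> 'l \<Rightarrow> 'l" where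
  "character_act_A \<Delta> \<epsilon> scL act K A g a =
    tensor_lift (ring_on UNIV) (\<lambda>b h. scL (g h) b)
      (inv_into (carrier (tensor base_field (mod_on scL A) (PV_hopf \<Delta> \<epsilon> scL act K A)))
        (PV_mu K A) (self_pure K A 1 a))"

definition character_act ::
  "('d \<Rightarrow> ('d, 'd) tens) \<Rightarrow> ('d \<Rightarrow> 'k) \<Rightarrow> ('k::field \<Rightarrow> 'l \<Rightarrow> 'l) \<Rightarrow> ('d \<Rightarrow> 'l \<Rightarrow> 'l) \<Rightarrow>
    'l::comm_ring_1 set \<Rightarrow> 'l set \<Rightarrow> (('l, 'l) tens \<Rightarrow> 'k) \<Rightarrow> 'l \<Rightarrow> 'l" where
  "character_act \<Delta> \<epsilon> scL act K A g =
    (THE \<sigma>. \<sigma> \<in> ring_hom (ring_on UNIV) (ring_on UNIV) \<and>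
            (\<forall>a\<in>A. \<sigma> a = character_act_A \<Delta> \<epsilon> scL act K A g a))"

text \<open>
  The elements of \<open>L\<close> fixed by the characters of \<open>H/I\<close>, which act through the projection \<open>H \<rightarrow> H/I\<close>,
  that is, as a subgroup of the group of characters of \<open>H\<close>.
\<close>

definition fixed_algebra ::
  "('d \<Rightarrow> ('d, 'd) tens) \<Rightarrow> ('d \<Rightarrow> 'k) \<Rightarrow> ('k::field \<Rightarrow> 'l \<Rightarrow> 'l) \<Rightarrow> ('d \<Rightarrow> 'l \<Rightarrow> 'l) \<Rightarrow>
    'l::comm_ring_1 set \<Rightarrow> 'l set \<Rightarrow> ('l, 'l) tens set \<Rightarrow> 'l set" where
  "fixed_algebra \<Delta> \<epsilon> scL act K A I =
    (let H = PV_hopf \<Delta> \<epsilon> scL act K A in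
      {x. \<forall>g\<in>characters (quot_algebra H I).
            character_act \<Delta> \<epsilon> scL act K A (\<lambda>h. g (I +>\<^bsub>H\<^esub> h)) x = x})"

end

theory Submission
  imports Defs
begin

text \<open>
  Write \<open>x \<in> L\<close> as \<open>a / s\<close> with \<open>a, s \<in> A\<close>. For a character \<open>g\<close> of \<open>H / I\<close> the rule \<open>b h \<mapsto> g(h) b\<close> is a
  well-defined \<open>A\<close>-linear ring homomorphism \<open>A \<otimes>\<^sub>K A \<rightarrow> A\<close> that sends \<open>1 \<otimes> b\<close> to the image of \<open>b\<close> under \<open>g\<close>, so
  \<open>x\<close> is fixed if and only if all these maps kill \<open>z = s \<otimes> a - a \<otimes> s\<close>. As \<open>L\<close> is \<open>D\<close>-simple with constants
  \<open>k\<close>, constants of \<open>L \<otimes>\<^sub>F L\<close> that are linearly independent over \<open>k\<close> are so over \<open>L\<close>. Since the characters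
  separate the elements of \<open>H / I\<close>, it follows that \<open>x\<close> is fixed if and only if \<open>z\<close> vanishes in \<open>L \<otimes>\<^sub>F L\<close>,
  that is, \<open>1 \<otimes> x = x \<otimes> 1\<close> there.

  The set \<open>F'\<close> of all such \<open>x\<close> is \<open>D\<close>-stable and contains \<open>F\<close>. If \<open>a\<close> generates a minimal ideal of the
  artinian ring \<open>F\<close>, linear algebra over the residue field of the annihilator of \<open>a\<close> gives \<open>a F' \<subseteq> F\<close>. Hence
  \<open>{b \<in> F. b F' \<subseteq> F}\<close>, which is a \<open>D\<close>-stable ideal by the antipode identity
  \<open>(d b) x = \<Sum> d\<^sub>1 (b (S(d\<^sub>2) x))\<close>, is not zero; as \<open>F\<close> is \<open>D\<close>-simple it contains \<open>1\<close>, and \<open>F' = F\<close>.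
\<close>

section \<open>Additive maps out of free abelian groups and tensor products\<close>

text \<open>Tensors are cosets of a subgroup that varies with the base ring and with the factors, so
  elements of \<open>A \<otimes>\<^sub>K A\<close> and of \<open>L \<otimes>\<^sub>F L\<close> have
  no common home. All computations therefore take place in one free abelian group on pairs, modulo
  the relations of whichever tensor product is meant. A canonical map is then an inclusion of
  relation groups, and a congruence proved over \<open>K\<close> and \<open>A\<close> can be read
  over \<open>F\<close> and \<open>L\<close>. The rule \<open>b h \<mapsto> g(h) b\<close> is well
  defined because of the same independence of constants: a relation between elements of
  \<open>H\<close> over \<open>L\<close> comes from relations over \<open>k\<close>, which
  \<open>g\<close> respects. It yields an endomorphism of \<open>A\<close> only; to pass to
  fractions, this endomorphism has to preserve nonzerodivisors, and so an inverse is produced from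
  the antipode, that is, from the exchange of the tensor factors. The last step cannot compare
  \<open>F\<close> and \<open>F'\<close> by dimension, as \<open>F\<close> is merely artinian: a
  separating functional is available only over a residue field, hence only after multiplication by
  \<open>a\<close>.\<close>

definition zmul :: "int \<Rightarrow> 'g::ab_group_add \<Rightarrow> 'g" where
  "zmul n x = (if 0 \<le> n then (\<Sum>i<nat n. x) else - (\<Sum>i<nat (- n). x))"

lemma zmul_0 [simp]: "zmul 0 x = 0" and zmul_1 [simp]: "zmul 1 x = x"
  by (simp_all add: zmul_def)

lemma zmul_plus1: "zmul (n + 1) x = zmul n x + x"
proof (cases "0 \<le> n")
  case True
  then have "nat (n + 1) = Suc (nat n)" by simp
  then show ?thesis using True by (simp add: zmul_def del: sum_constant)
next
  case False
  then have "nat (- n) = Suc (nat (- (n + 1)))" by simp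
  then show ?thesis using False by (auto simp: zmul_def simp del: sum_constant)
qed

lemma zmul_minus1: "zmul (n - 1) x = zmul n x - x"
  using zmul_plus1[of "n - 1" x] by simp

lemma zmul_add: "zmul (m + n) x = zmul m x + zmul n x"
proof (induction n rule: int_induct[where k = 0])
  case base
  show ?case by simp
next
  case (step1 i)
  then show ?case by (simp add: zmul_plus1 flip: add.assoc)
next
  case (step2 i)
  have "m + (i - 1) = (m + i) - 1" by simp
  then show ?case using step2 by (metis zmul_minus1 add_diff_eq)
qed

definition ext :: "('p \<Rightarrow> 'g) \<Rightarrow> ('p \<Rightarrow>\<^sub>0 int) \<Rightarrow> 'g::ab_group_add" where
  "ext f x = (\<Sum>p\<in>Poly_Mapping.keys x. zmul (Poly_Mapping.lookup x p) (f p))"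

lemma ext_superset:
  assumes "finite P" "Poly_Mapping.keys x \<subseteq> P"
  shows "ext f x = (\<Sum>p\<in>P. zmul (Poly_Mapping.lookup x p) (f p))"
  unfolding ext_def using assms
  by (intro sum.mono_neutral_left) (auto simp: in_keys_iff)

lemma ext_0 [simp]: "ext f 0 = 0"
  by (simp add: ext_def)

lemma ext_add [simp]: "ext f (x + y) = ext f x + ext f y"
proof -
  let ?P = "Poly_Mapping.keys x \<union> Poly_Mapping.keys y"
  have "ext f z = (\<Sum>p\<in>?P. zmul (Poly_Mapping.lookup z p) (f p))" if "z \<in> {x, y, x + y}" for z
    using that Poly_Mapping.keys_add[of x y] by (intro ext_superset) auto
  then show ?thesis by (simp add: lookup_add zmul_add sum.distrib)
qed

lemma ext_diff [simp]: "ext f (x - y) = ext f x - ext f y"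
  using ext_add[of f "x - y" y] by (simp add: algebra_simps)

lemma ext_frag_of [simp]: "ext f (frag_of p) = f p"
  by (simp add: ext_def)

lemma ext_sum_list: "ext f (sum_list xs) = sum_list (map (ext f) xs)"
  by (induction xs) auto

lemma additive_zmul:
  fixes \<phi> :: "'g::ab_group_add \<Rightarrow> 'h::ab_group_add"
  assumes "\<And>x y. \<phi> (x + y) = \<phi> x + \<phi> y"
  shows "\<phi> (zmul n x) = zmul n (\<phi> x)"
proof -
  have 0: "\<phi> 0 = 0" using assms[of 0 0] by simp
  have "\<phi> (x - y) = \<phi> x - \<phi> y" for x y
    using assms[of "x - y" y] by (simp add: algebra_simps)
  then show ?thesis
    by (induction n rule: int_induct[where k = 0]) (simp_all add: 0 assms zmul_plus1 zmul_minus1)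
qed

lemma additive_ext:
  fixes \<phi> :: "'g::ab_group_add \<Rightarrow> 'h::ab_group_add" and f :: "'p \<Rightarrow> 'g"
  assumes "\<And>x y. \<phi> (x + y) = \<phi> x + \<phi> y"
  shows "\<phi> (ext f x) = ext (\<lambda>p. \<phi> (f p)) x"
proof -
  have "\<phi> (\<Sum>p\<in>P. g p) = (\<Sum>p\<in>P. \<phi> (g p))" if "finite P" for P and g :: "'p \<Rightarrow> 'g"
    using that assms assms[of 0 0] by (induction rule: finite_induct) auto
  then show ?thesis by (simp add: ext_def additive_zmul[of \<phi>, OF assms])
qed

lemma frag_extend_eq_ext: "frag_extend f x = ext f x"
proof -
  have "x = ext frag_of x"
  proof -
    have "Poly_Mapping.keys x \<subseteq> UNIV" by simp
    then show ?thesis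
      by (induction x rule: frag_induction) auto
  qed
  then have "frag_extend f x = frag_extend f (ext frag_of x)" by simp
  also have "\<dots> = ext f x"
    by (simp add: additive_ext[of "frag_extend f"] frag_extend_add)
  finally show ?thesis .
qed

text \<open>Sums of generators without coefficients. Modulo the tensor relations every fragment has
  this form, so that a tensor becomes a list of pure tensors and induction over lists
  applies.\<close>

definition fr :: "'p list \<Rightarrow> ('p \<Rightarrow>\<^sub>0 int)" where
  "fr xs = sum_list (map frag_of xs)"

lemma fr_Nil [simp]: "fr [] = 0" and fr_Cons [simp]: "fr (p # xs) = frag_of p + fr xs"
  and fr_append [simp]: "fr (xs @ ys) = fr xs + fr ys"
  by (simp_all add: fr_def)

lemma ext_fr [simp]: "ext f (fr xs) = sum_list (map f xs)"
  by (induction xs) auto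

lemma keys_fr: "Poly_Mapping.keys (fr xs) \<subseteq> set xs"
proof (induction xs)
  case (Cons p xs)
  then show ?case using Poly_Mapping.keys_add[of "frag_of p" "fr xs"] by fastforce
qed simp


subsection \<open>Congruence modulo a subgroup\<close>

definition subgrp :: "'g::ab_group_add set \<Rightarrow> bool" where
  "subgrp S \<longleftrightarrow> 0 \<in> S \<and> (\<forall>x\<in>S. \<forall>y\<in>S. x - y \<in> S)"

definition cg :: "'g::ab_group_add set \<Rightarrow> 'g \<Rightarrow> 'g \<Rightarrow> bool" where
  "cg S x y \<longleftrightarrow> x - y \<in> S"

lemma subgrp_0: "subgrp S \<Longrightarrow> 0 \<in> S" and subgrp_diff: "subgrp S \<Longrightarrow> x \<in> S \<Longrightarrow> y \<in> S \<Longrightarrow> x - y \<in> S"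
  by (auto simp: subgrp_def)

lemma subgrp_uminus: "subgrp S \<Longrightarrow> x \<in> S \<Longrightarrow> - x \<in> S"
  using subgrp_diff[of S 0 x] subgrp_0[of S] by simp

lemma subgrp_add: "subgrp S \<Longrightarrow> x \<in> S \<Longrightarrow> y \<in> S \<Longrightarrow> x + y \<in> S"
  using subgrp_diff[of S x "- y"] subgrp_uminus[of S y] by simp

lemma subgrp_sum_list: "subgrp S \<Longrightarrow> (\<And>x. x \<in> set xs \<Longrightarrow> f x \<in> S) \<Longrightarrow> sum_list (map f xs) \<in> S"
  by (induction xs) (auto intro: subgrp_0 subgrp_add)

lemma subgrp_sum: "subgrp S \<Longrightarrow> (\<And>x. x \<in> P \<Longrightarrow> f x \<in> S) \<Longrightarrow> sum f P \<in> S"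
  by (induction P rule: infinite_finite_induct) (auto intro: subgrp_0 subgrp_add)

lemma subgrp_zero [simp]: "subgrp {0}"
  by (simp add: subgrp_def)

lemma cg_zero [simp]: "cg {0} x y \<longleftrightarrow> x = y"
  by (simp add: cg_def)

lemma cg_refl: "subgrp S \<Longrightarrow> cg S x x"
  by (simp add: cg_def subgrp_0)

lemma cg_sym: "subgrp S \<Longrightarrow> cg S x y \<Longrightarrow> cg S y x"
  using subgrp_uminus[of S "x - y"] by (simp add: cg_def)

lemma cg_trans: "subgrp S \<Longrightarrow> cg S x y \<Longrightarrow> cg S y z \<Longrightarrow> cg S x z"
  using subgrp_add[of S "x - y" "y - z"] by (simp add: cg_def)

lemma cg_add: "subgrp S \<Longrightarrow> cg S x y \<Longrightarrow> cg S x' y' \<Longrightarrow> cg S (x + x') (y + y')"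
  using subgrp_add[of S "x - y" "x' - y'"] by (simp add: cg_def algebra_simps)

lemma cg_diff: "subgrp S \<Longrightarrow> cg S x y \<Longrightarrow> cg S x' y' \<Longrightarrow> cg S (x - x') (y - y')"
  using subgrp_diff[of S "x - y" "x' - y'"] by (simp add: cg_def algebra_simps)

lemma cg_sum_list:
  assumes "subgrp S" "\<And>x. x \<in> set xs \<Longrightarrow> cg S (f x) (g x)"
  shows "cg S (sum_list (map f xs)) (sum_list (map g xs))"
  using assms(2) by (induction xs) (auto intro: cg_add cg_refl assms(1))

lemma cg_sum:
  assumes "subgrp S" "\<And>i. i \<in> P \<Longrightarrow> cg S (f i) (g i)"
  shows "cg S (sum f P) (sum g P)"
  using assms(2) by (induction P rule: infinite_finite_induct) (auto intro: cg_add cg_refl assms(1))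

lemma cg_mem_iff: "subgrp S \<Longrightarrow> cg S x y \<Longrightarrow> x \<in> S \<longleftrightarrow> y \<in> S"
  using subgrp_diff[of S x "x - y"] subgrp_add[of S y "x - y"] by (auto simp: cg_def)


subsection \<open>Representatives\<close>

text \<open>The laws are required only modulo \<open>S\<close>, because values in another tensor
  product are again represented by fragments, and for these the laws hold only up to
  relations.\<close>

definition balanced ::
  "('r, 'p) ring_scheme \<Rightarrow> ('r, 'a, 'm) module_scheme \<Rightarrow> ('r, 'b, 'n) module_scheme \<Rightarrow>
    'g::ab_group_add set \<Rightarrow> ('a \<Rightarrow> 'b \<Rightarrow> 'g) \<Rightarrow> bool" where
  "balanced R M N S \<beta> \<longleftrightarrow>
    (\<forall>a\<in>carrier M. \<forall>a'\<in>carrier M. \<forall>b\<in>carrier N. cg S (\<beta> (a \<oplus>\<^bsub>M\<^esub> a') b) (\<beta> a b + \<beta> a' b)) \<and>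
    (\<forall>a\<in>carrier M. \<forall>b\<in>carrier N. \<forall>b'\<in>carrier N. cg S (\<beta> a (b \<oplus>\<^bsub>N\<^esub> b')) (\<beta> a b + \<beta> a b')) \<and>
    (\<forall>r\<in>carrier R. \<forall>a\<in>carrier M. \<forall>b\<in>carrier N. cg S (\<beta> (r \<odot>\<^bsub>M\<^esub> a) b) (\<beta> a (r \<odot>\<^bsub>N\<^esub> b)))"

lemma subgrp_tensor_null: "subgrp (tensor_null R M N)"
  by (auto simp: subgrp_def intro: tensor_null.intros)

text \<open>Each generating relator is sent into \<open>S\<close> by one clause of
  \<open>balanced\<close>. This is the universal property of the tensor product on the level of
  representatives, and all later proofs of well-definedness rest on it.\<close>

lemma ext_tensor_null:
  assumes S: "subgrp S" and \<beta>: "balanced R M N S \<beta>" and x: "x \<in> tensor_null R M N"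
  shows "ext (\<lambda>(a, b). \<beta> a b) x \<in> S"
  using x
proof induction
  case (diff x y)
  then show ?case using subgrp_diff[OF S] by simp
qed (use \<beta> in \<open>auto simp: balanced_def cg_def subgrp_0[OF S] diff_diff_eq\<close>)

lemma tensor_class_eq_iff: "tensor_class R M N x = tensor_class R M N y \<longleftrightarrow> cg (tensor_null R M N) x y"
proof -
  note A = subgrp_tensor_null[of R M N]
  show ?thesis
  proof
    assume "tensor_class R M N x = tensor_class R M N y"
    then show "cg (tensor_null R M N) x y"
      using subgrp_0[OF A] by (auto simp: tensor_class_def cg_def)
  next
    assume "cg (tensor_null R M N) x y"
    then show "tensor_class R M N x = tensor_class R M N y"
      using cg_trans[OF A] cg_sym[OF A] unfolding tensor_class_def cg_def by blast
  qed
qed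

lemma mem_tensor_class: "y \<in> tensor_class R M N x \<longleftrightarrow> cg (tensor_null R M N) y x"
  by (simp add: tensor_class_def cg_def)

lemma tensor_class_self: "x \<in> tensor_class R M N x"
  by (simp add: mem_tensor_class cg_refl subgrp_tensor_null)

lemma some_tensor_class: "cg (tensor_null R M N) (SOME y. y \<in> tensor_class R M N x) x"
  using someI[of "\<lambda>y. y \<in> tensor_class R M N x", OF tensor_class_self] by (simp add: mem_tensor_class)

text \<open>The operations of \<open>tensor\<close> are unions over all representatives;
  independence of the representative collapses such a union to a single class.\<close>

lemma UN_tensor_class:
  assumes "\<And>y. y \<in> tensor_class R M N x \<Longrightarrow> f y = f x"
  shows "(\<Union>y\<in>tensor_class R M N x. f y) = f x"
  using assms tensor_class_self[of x R M N] by blast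

lemma tensor_carrier:
  "carrier (tensor R M N) = tensor_class R M N ` {x. Poly_Mapping.keys x \<subseteq> carrier M \<times> carrier N}"
  by (simp add: tensor_def)

lemma tensor_zero: "\<zero>\<^bsub>tensor R M N\<^esub> = tensor_class R M N 0"
  by (simp add: tensor_def)

lemma tensor_one: "\<one>\<^bsub>tensor R M N\<^esub> = tensor_class R M N (frag_of (\<one>\<^bsub>M\<^esub>, \<one>\<^bsub>N\<^esub>))"
  by (simp add: tensor_def)

lemma tensor_add:
  "tensor_class R M N x \<oplus>\<^bsub>tensor R M N\<^esub> tensor_class R M N y = tensor_class R M N (x + y)"
proof -
  have "(\<Union>x'\<in>tensor_class R M N x. \<Union>y'\<in>tensor_class R M N y. tensor_class R M N (x' + y'))
    = (\<Union>x'\<in>tensor_class R M N x. tensor_class R M N (x' + y))"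
    by (intro SUP_cong refl UN_tensor_class)
       (auto simp: tensor_class_eq_iff mem_tensor_class intro!: cg_add cg_refl subgrp_tensor_null)
  also have "\<dots> = tensor_class R M N (x + y)"
    by (intro UN_tensor_class)
       (auto simp: tensor_class_eq_iff mem_tensor_class intro!: cg_add cg_refl subgrp_tensor_null)
  finally show ?thesis by (simp add: tensor_def)
qed

lemma keys_add_subset:
  "Poly_Mapping.keys x \<subseteq> P \<Longrightarrow> Poly_Mapping.keys y \<subseteq> P \<Longrightarrow> Poly_Mapping.keys (x + y) \<subseteq> P"
  using Poly_Mapping.keys_add[of x y] by blast

lemma keys_sum_subset:
  "(\<And>i. i \<in> Q \<Longrightarrow> Poly_Mapping.keys (f i) \<subseteq> P) \<Longrightarrow> Poly_Mapping.keys (sum f Q) \<subseteq> P"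
  by (induction Q rule: infinite_finite_induct) (simp_all add: keys_add_subset)

lemma keys_sum_list_subset:
  "(\<And>i. i \<in> set xs \<Longrightarrow> Poly_Mapping.keys (f i) \<subseteq> P) \<Longrightarrow> Poly_Mapping.keys (sum_list (map f xs)) \<subseteq> P"
  by (induction xs) (simp_all add: keys_add_subset)

lemma keys_diff_subset:
  fixes x y :: "'p \<Rightarrow>\<^sub>0 int"
  shows "Poly_Mapping.keys x \<subseteq> P \<Longrightarrow> Poly_Mapping.keys y \<subseteq> P \<Longrightarrow> Poly_Mapping.keys (x - y) \<subseteq> P"
  using Poly_Mapping.keys_diff[of x y] by blast

lemma keys_zmul_subset: "Poly_Mapping.keys x \<subseteq> P \<Longrightarrow> Poly_Mapping.keys (zmul n (x :: 'p \<Rightarrow>\<^sub>0 int)) \<subseteq> P"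
  by (auto simp: zmul_def keys_minus simp del: sum_constant dest!: keys_sum_subset[THEN subsetD, rotated])

lemma abelian_group_tensor: "abelian_group (tensor R M N)"
proof (rule abelian_groupI)
  fix X assume "X \<in> carrier (tensor R M N)"
  then obtain x where x: "Poly_Mapping.keys x \<subseteq> carrier M \<times> carrier N" "X = tensor_class R M N x"
    by (auto simp: tensor_carrier)
  show "\<exists>Y\<in>carrier (tensor R M N). Y \<oplus>\<^bsub>tensor R M N\<^esub> X = \<zero>\<^bsub>tensor R M N\<^esub>"
    using x by (intro bexI[of _ "tensor_class R M N (- x)"])
      (auto simp: tensor_carrier tensor_add tensor_zero intro!: imageI)
qed (auto simp: tensor_carrier tensor_add tensor_zero ac_simps keys_add_subset intro!: imageI)

lemma finsum_tensor:
  assumes "\<And>p. p \<in> P \<Longrightarrow> Poly_Mapping.keys (f p) \<subseteq> carrier M \<times> carrier N"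
  shows "(\<Oplus>\<^bsub>tensor R M N\<^esub>p\<in>P. tensor_class R M N (f p)) = tensor_class R M N (sum f P)"
proof -
  interpret abelian_group "tensor R M N" by (rule abelian_group_tensor)
  show ?thesis
    using assms
  proof (induction P rule: infinite_finite_induct)
    case (insert p P)
    then have "(\<lambda>p. tensor_class R M N (f p)) \<in> insert p P \<rightarrow> carrier (tensor R M N)"
      by (auto simp: tensor_carrier)
    with insert show ?case by (subst finsum_insert) (auto simp: Pi_iff tensor_add)
  qed (simp_all add: tensor_zero)
qed

lemma add_pow_tensor:
  assumes "Poly_Mapping.keys x \<subseteq> carrier M \<times> carrier N"
  shows "[(n::int)] \<cdot>\<^bsub>tensor R M N\<^esub> tensor_class R M N x = tensor_class R M N (zmul n x)"
proof -
  interpret abelian_group "tensor R M N" by (rule abelian_group_tensor)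
  have nat: "[(m::nat)] \<cdot>\<^bsub>tensor R M N\<^esub> tensor_class R M N x = tensor_class R M N (\<Sum>i<m. x)" for m
    by (induction m) (simp_all add: add_pow_def tensor_add tensor_zero del: sum_constant)
  show ?thesis
  proof (cases "0 \<le> n")
    case True
    then show ?thesis by (simp add: add_pow_int_ge nat zmul_def)
  next
    case False
    have k: "Poly_Mapping.keys (\<Sum>i<nat (-n). x) \<subseteq> carrier M \<times> carrier N"
      by (intro keys_sum_subset assms)
    then have "\<ominus>\<^bsub>tensor R M N\<^esub> tensor_class R M N (\<Sum>i<nat (-n). x)
        = tensor_class R M N (- (\<Sum>i<nat (-n). x))"
      by (intro minus_equality) (auto simp: tensor_add tensor_zero tensor_carrier simp del: sum_constant intro!: imageI)
    then show ?thesis using False by (simp add: add_pow_int_lt nat zmul_def)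
  qed
qed

text \<open>Just enough of the module axioms for every relator to be supported on the carriers. Then
  all members of a coset are supported there, including the one that \<open>SOME\<close> picks in
  \<open>tensor_lift\<close>.\<close>

definition add_closed_module :: "('r, 'p) ring_scheme \<Rightarrow> ('r, 'a, 'm) module_scheme \<Rightarrow> bool" where
  "add_closed_module R M \<longleftrightarrow> abelian_group M \<and> (\<forall>r\<in>carrier R. \<forall>a\<in>carrier M. r \<odot>\<^bsub>M\<^esub> a \<in> carrier M)"

lemma keys_tensor_null:
  assumes "add_closed_module R M" "add_closed_module R N" "x \<in> tensor_null R M N"
  shows "Poly_Mapping.keys x \<subseteq> carrier M \<times> carrier N"
proof -
  interpret M: abelian_group M using assms(1) by (simp add: add_closed_module_def)
  interpret N: abelian_group N using assms(2) by (simp add: add_closed_module_def)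
  show ?thesis
    using assms(3)
    by induction (use assms(1,2) in \<open>simp_all add: keys_diff_subset keys_frag_of add_closed_module_def\<close>)
qed

text \<open>Signs are absorbed into the first factor.\<close>

lemma tensor_list_rep:
  assumes M: "abelian_group M" and N: "abelian_group N"
    and x: "Poly_Mapping.keys x \<subseteq> carrier M \<times> carrier N"
  obtains xs where "set xs \<subseteq> carrier M \<times> carrier N" "cg (tensor_null R M N) x (fr xs)"
proof -
  interpret M: abelian_group M by fact
  let ?c = "cg (tensor_null R M N)"
  note A = subgrp_tensor_null[of R M N]
  have zero: "?c (frag_of (\<zero>\<^bsub>M\<^esub>, b)) 0" if "b \<in> carrier N" for b
  proof -
    have "frag_of (\<zero>\<^bsub>M\<^esub> \<oplus>\<^bsub>M\<^esub> \<zero>\<^bsub>M\<^esub>, b) - frag_of (\<zero>\<^bsub>M\<^esub>, b) - frag_of (\<zero>\<^bsub>M\<^esub>, b) \<in> tensor_null R M N"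
      by (rule tensor_null.add_left) (use that in auto)
    from subgrp_uminus[OF A this] show ?thesis by (simp add: cg_def)
  qed
  have neg: "?c (- frag_of (a, b)) (frag_of (\<ominus>\<^bsub>M\<^esub> a, b))" if "a \<in> carrier M" "b \<in> carrier N" for a b
  proof -
    have "frag_of (a \<oplus>\<^bsub>M\<^esub> \<ominus>\<^bsub>M\<^esub> a, b) - frag_of (a, b) - frag_of (\<ominus>\<^bsub>M\<^esub> a, b) \<in> tensor_null R M N"
      by (rule tensor_null.add_left) (use that in auto)
    then have "?c (frag_of (\<zero>\<^bsub>M\<^esub>, b)) (frag_of (a, b) + frag_of (\<ominus>\<^bsub>M\<^esub> a, b))"
      using that by (simp add: cg_def M.r_neg diff_diff_eq)
    then have "?c 0 (frag_of (a, b) + frag_of (\<ominus>\<^bsub>M\<^esub> a, b))"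
      using cg_trans[OF A cg_sym[OF A zero]] that by blast
    then show ?thesis by (simp add: cg_def diff_diff_eq)
  qed
  have "\<exists>xs. set xs \<subseteq> carrier M \<times> carrier N \<and> ?c x (fr xs)"
    using x
  proof (induction x rule: frag_induction)
    case zero
    show ?case by (intro exI[of _ "[]"]) (simp add: cg_refl[OF A])
  next
    case (one p)
    show ?case using one by (intro exI[of _ "[p]"]) (auto simp: cg_refl[OF A])
  next
    case (diff x y)
    then obtain xs ys where xs: "set xs \<subseteq> carrier M \<times> carrier N" "?c x (fr xs)"
      and ys: "set ys \<subseteq> carrier M \<times> carrier N" "?c y (fr ys)" by blast
    let ?ys = "map (\<lambda>(a, b). (\<ominus>\<^bsub>M\<^esub> a, b)) ys"
    have "?c (- fr ys) (fr ?ys)"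
      using ys(1)
    proof (induction ys)
      case (Cons p ys)
      then show ?case
        using cg_add[OF A neg[of "fst p" "snd p"], of "- fr ys"] by (auto simp: split: prod.splits)
    qed (simp add: cg_refl[OF A])
    then have "?c (x - y) (fr xs + fr ?ys)"
      using cg_trans[OF A cg_diff[OF A xs(2) ys(2)]] cg_add[OF A cg_refl[OF A, of "fr xs"]] by fastforce
    with xs ys show ?case by (intro exI[of _ "xs @ ?ys"]) auto
  qed
  then show thesis using that by blast
qed

lemma tensor_carrier_list:
  assumes "abelian_group M" "abelian_group N" "X \<in> carrier (tensor R M N)"
  obtains xs where "set xs \<subseteq> carrier M \<times> carrier N" "X = tensor_class R M N (fr xs)"
proof -
  obtain x where x: "Poly_Mapping.keys x \<subseteq> carrier M \<times> carrier N" "X = tensor_class R M N x"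
    using assms(3) by (auto simp: tensor_carrier)
  obtain xs where "set xs \<subseteq> carrier M \<times> carrier N" "cg (tensor_null R M N) x (fr xs)"
    using tensor_list_rep[OF assms(1,2) x(1)] by blast
  with x show thesis using that by (simp add: tensor_class_eq_iff)
qed


subsection \<open>Evaluating induced maps\<close>

text \<open>The representative chosen by \<open>SOME\<close> differs from \<open>x\<close> by a
  relation, which the balanced map \<open>\<gamma>\<close> sends to a relation of the target, so the
  choice drops out. Here \<open>\<gamma>\<close> lifts \<open>\<beta>\<close> from cosets to
  fragments.\<close>

lemma tensor_lift_tensor:
  fixes R' :: "('r', 'p') ring_scheme" and M' :: "('r', 'a', 'm') module_scheme"
    and N' :: "('r', 'b', 'n') module_scheme"
  assumes mod: "add_closed_module R M" "add_closed_module R N"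
    and x: "Poly_Mapping.keys x \<subseteq> carrier M \<times> carrier N"
    and \<gamma>: "\<And>a b. a \<in> carrier M \<Longrightarrow> b \<in> carrier N \<Longrightarrow> Poly_Mapping.keys (\<gamma> a b) \<subseteq> carrier M' \<times> carrier N'"
    and \<beta>: "\<And>a b. a \<in> carrier M \<Longrightarrow> b \<in> carrier N \<Longrightarrow> \<beta> a b = tensor_class R' M' N' (\<gamma> a b)"
    and bal: "balanced R M N (tensor_null R' M' N') \<gamma>"
  shows "tensor_lift (tensor R' M' N') \<beta> (tensor_class R M N x)
    = tensor_class R' M' N' (ext (\<lambda>(a, b). \<gamma> a b) x)"
proof -
  define y where "y = (SOME y. y \<in> tensor_class R M N x)"
  have c: "cg (tensor_null R M N) y x" unfolding y_def by (rule some_tensor_class)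
  have y: "Poly_Mapping.keys y \<subseteq> carrier M \<times> carrier N"
    using keys_add_subset[OF keys_tensor_null[OF mod c[unfolded cg_def]] x] by simp
  have k: "Poly_Mapping.keys (\<gamma> (fst p) (snd p)) \<subseteq> carrier M' \<times> carrier N'"
    if "p \<in> Poly_Mapping.keys y" for p
    using that y by (intro \<gamma>) auto
  have e: "[Poly_Mapping.lookup y p] \<cdot>\<^bsub>tensor R' M' N'\<^esub> \<beta> (fst p) (snd p)
      = tensor_class R' M' N' (zmul (Poly_Mapping.lookup y p) (\<gamma> (fst p) (snd p)))"
    if "p \<in> Poly_Mapping.keys y" for p
  proof -
    have "\<beta> (fst p) (snd p) = tensor_class R' M' N' (\<gamma> (fst p) (snd p))"
      using that y by (intro \<beta>) auto
    then show ?thesis by (simp add: add_pow_tensor k[OF that])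
  qed
  have "tensor_lift (tensor R' M' N') \<beta> (tensor_class R M N x) =
    (\<Oplus>\<^bsub>tensor R' M' N'\<^esub>p\<in>Poly_Mapping.keys y.
       [Poly_Mapping.lookup y p] \<cdot>\<^bsub>tensor R' M' N'\<^esub> \<beta> (fst p) (snd p))"
    by (simp add: tensor_lift_def y_def Let_def)
  also have "\<dots> = (\<Oplus>\<^bsub>tensor R' M' N'\<^esub>p\<in>Poly_Mapping.keys y.
       tensor_class R' M' N' (zmul (Poly_Mapping.lookup y p) (\<gamma> (fst p) (snd p))))"
    by (intro abelian_monoid.finsum_cong' abelian_group.axioms(1)[OF abelian_group_tensor] refl e)
      (simp add: Pi_iff tensor_carrier keys_zmul_subset k)
  also have "\<dots> = tensor_class R' M' N' (ext (\<lambda>(a, b). \<gamma> a b) y)"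
    by (simp add: finsum_tensor ext_def case_prod_unfold keys_zmul_subset k)
  also have "\<dots> = tensor_class R' M' N' (ext (\<lambda>(a, b). \<gamma> a b) x)"
    using ext_tensor_null[OF subgrp_tensor_null bal c[unfolded cg_def]]
    by (simp add: tensor_class_eq_iff cg_def)
  finally show ?thesis .
qed

lemma abelian_group_type:
  fixes T :: "('g::ab_group_add, 't) ring_scheme"
  assumes T: "carrier T = UNIV" "zero T = 0" "add T = (+)"
  shows "abelian_group T"
  by (rule abelian_groupI) (auto simp: T ac_simps intro: exI[of _ "- _"] left_minus)

lemma finsum_type:
  fixes T :: "('g::ab_group_add, 't) ring_scheme"
  assumes T: "carrier T = UNIV" "zero T = 0" "add T = (+)"
  shows "finsum T f P = sum f P"
proof -
  interpret abelian_group T by (rule abelian_group_type[OF T])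
  show ?thesis
    by (induction P rule: infinite_finite_induct) (simp_all add: T)
qed

lemma add_pow_type:
  fixes T :: "('g::ab_group_add, 't) ring_scheme"
  assumes T: "carrier T = UNIV" "zero T = 0" "add T = (+)"
  shows "[(n::int)] \<cdot>\<^bsub>T\<^esub> x = zmul n x"
proof -
  interpret abelian_group T by (rule abelian_group_type[OF T])
  have nat: "[(m::nat)] \<cdot>\<^bsub>T\<^esub> x = (\<Sum>i<m. x)" for m
    by (induction m) (simp_all add: add_pow_def T del: sum_constant)
  have "\<ominus>\<^bsub>T\<^esub> y = - y" for y
    by (intro minus_equality) (auto simp: T)
  then show ?thesis by (simp add: zmul_def nat add_pow_int_ge add_pow_int_lt del: sum_constant)
qed

text \<open>The counterpart for values in a type: \<open>T\<close> enters only through its addition,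
  so that \<open>ring_on UNIV\<close> and the module \<open>D\<close> of the next section are both
  covered.\<close>

lemma tensor_lift_type:
  fixes T :: "('g::ab_group_add, 't) ring_scheme"
  assumes T: "carrier T = UNIV" "zero T = 0" "add T = (+)"
    and bal: "balanced R M N {0} \<beta>"
  shows "tensor_lift T \<beta> (tensor_class R M N x) = ext (\<lambda>(a, b). \<beta> a b) x"
proof -
  define y where "y = (SOME y. y \<in> tensor_class R M N x)"
  have c: "cg (tensor_null R M N) y x" unfolding y_def by (rule some_tensor_class)
  have "tensor_lift T \<beta> (tensor_class R M N x) = ext (\<lambda>(a, b). \<beta> a b) y"
    by (simp add: tensor_lift_def Let_def finsum_type[OF T] add_pow_type[OF T] ext_def case_prod_unfold
        flip: y_def)
  also have "\<dots> = ext (\<lambda>(a, b). \<beta> a b) x"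
    using ext_tensor_null[OF subgrp_zero bal c[unfolded cg_def]] by simp
  finally show ?thesis .
qed

lemma mod_on_simps [simp]:
  "carrier (mod_on s S) = S" "monoid.mult (mod_on s S) = (*)" "one (mod_on s S) = 1"
  "zero (mod_on s S) = 0" "add (mod_on s S) = (+)" "smult (mod_on s S) = s"
  by (simp_all add: mod_on_def)

lemma ring_on_simps [simp]:
  "carrier (ring_on S) = S" "monoid.mult (ring_on S) = (*)" "one (ring_on S) = 1"
  "zero (ring_on S) = 0" "add (ring_on S) = (+)"
  by (simp_all add: ring_on_def)

lemma tensor_smult:
  assumes "balanced R M N (tensor_null R M N) (\<lambda>a b. frag_of (r \<odot>\<^bsub>M\<^esub> a, b))"
  shows "r \<odot>\<^bsub>tensor R M N\<^esub> tensor_class R M N x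
    = tensor_class R M N (ext (\<lambda>(a, b). frag_of (r \<odot>\<^bsub>M\<^esub> a, b)) x)"
proof -
  have "tensor_class R M N (frag_extend (\<lambda>(a, b). frag_of (r \<odot>\<^bsub>M\<^esub> a, b)) y)
      = tensor_class R M N (ext (\<lambda>(a, b). frag_of (r \<odot>\<^bsub>M\<^esub> a, b)) x)"
    if "y \<in> tensor_class R M N x" for y
    using ext_tensor_null[OF subgrp_tensor_null assms, of "y - x"] that
    by (simp add: frag_extend_eq_ext tensor_class_eq_iff mem_tensor_class cg_def)
  then show ?thesis
    using UN_tensor_class[of R M N x "\<lambda>y. tensor_class R M N (frag_extend (\<lambda>(a, b). frag_of (r \<odot>\<^bsub>M\<^esub> a, b)) y)"]
      tensor_class_self[of x R M N]
    by (simp add: tensor_def)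
qed


section \<open>Sweedler sums\<close>

locale cocommutative_module_algebra = module_algebra scD \<Delta> \<epsilon> scL act
  for scD :: "'k::field \<Rightarrow> 'd::ring_1 \<Rightarrow> 'd" and \<Delta> and \<epsilon>
    and scL :: "'k \<Rightarrow> 'l::comm_ring_1 \<Rightarrow> 'l" and act :: "'d \<Rightarrow> 'l \<Rightarrow> 'l" +
  assumes cocomm: "cocommutative (mod_on scD UNIV) \<Delta>"
begin

abbreviation D :: "('k, 'd) module" where "D \<equiv> mod_on scD UNIV"

abbreviation DD :: "('d \<times> 'd \<Rightarrow>\<^sub>0 int) \<Rightarrow> ('d, 'd) tens" where
  "DD \<equiv> tensor_class base_field D D"

lemma scD_simps:
  "scD (c * c') d = scD c (scD c' d)" "scD c (d + e) = scD c d + scD c e"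
  "scD (c + c') d = scD c d + scD c' d" "scD 1 d = d"
  using module.smult_assoc1[OF module] module.smult_r_distr[OF module]
    module.smult_l_distr[OF module] module.smult_one[OF module] by simp_all

lemma scD_commute: "scD c (scD c' d) = scD c' (scD c d)"
  by (metis scD_simps(1) mult.commute)

lemma add_closed_D: "add_closed_module base_field D"
  using module.axioms(2)[OF module] by (simp add: add_closed_module_def)

lemma abelian_group_D: "abelian_group D"
  using add_closed_D by (simp add: add_closed_module_def)

text \<open>One fixed expression of \<open>\<Delta> d\<close> as a sum of pure tensors, which turns
  Sweedler notation into summation over a list. For bilinear summands the choice is immaterial by
  \<open>SW_rep\<close>.\<close>

definition sw :: "'d \<Rightarrow> ('d \<times> 'd) list" where
  "sw d = (SOME xs. \<Delta> d = DD (fr xs))"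

lemma sw: "\<Delta> d = DD (fr (sw d))"
proof -
  obtain xs where "\<Delta> d = DD (fr xs)"
    using tensor_carrier_list[OF abelian_group_D abelian_group_D comult_closed[of d]] by auto
  then show ?thesis unfolding sw_def by (rule someI)
qed

definition SW :: "'d \<Rightarrow> ('d \<Rightarrow> 'd \<Rightarrow> 'g) \<Rightarrow> 'g::ab_group_add" where
  "SW d \<beta> = sum_list (map (case_prod \<beta>) (sw d))"

text \<open>
  Sweedler sums take values in a group \<open>'g\<close> on which the scalars act by \<open>\<mu>\<close>, and are computed
  modulo a subgroup \<open>S\<close>; this covers values in tensor products.
\<close>

definition kscal :: "'g::ab_group_add set \<Rightarrow> ('k \<Rightarrow> 'g \<Rightarrow> 'g) \<Rightarrow> bool" where
  "kscal S \<mu> \<longleftrightarrow> subgrp S \<and> (\<forall>c x y. \<mu> c (x + y) = \<mu> c x + \<mu> c y) \<and> (\<forall>c. \<forall>x\<in>S. \<mu> c x \<in> S)"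

definition klin :: "'g::ab_group_add set \<Rightarrow> ('k \<Rightarrow> 'g \<Rightarrow> 'g) \<Rightarrow> ('d \<Rightarrow> 'g) \<Rightarrow> bool" where
  "klin S \<mu> \<phi> \<longleftrightarrow>
    (\<forall>d e. cg S (\<phi> (d + e)) (\<phi> d + \<phi> e)) \<and> (\<forall>c d. cg S (\<phi> (scD c d)) (\<mu> c (\<phi> d)))"

definition bilin :: "'g::ab_group_add set \<Rightarrow> ('k \<Rightarrow> 'g \<Rightarrow> 'g) \<Rightarrow> ('d \<Rightarrow> 'd \<Rightarrow> 'g) \<Rightarrow> bool" where
  "bilin S \<mu> \<beta> \<longleftrightarrow> (\<forall>b. klin S \<mu> (\<lambda>a. \<beta> a b)) \<and> (\<forall>a. klin S \<mu> (\<beta> a))"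

definition trilin :: "'g::ab_group_add set \<Rightarrow> ('k \<Rightarrow> 'g \<Rightarrow> 'g) \<Rightarrow> ('d \<Rightarrow> 'd \<Rightarrow> 'd \<Rightarrow> 'g) \<Rightarrow> bool" where
  "trilin S \<mu> t \<longleftrightarrow> (\<forall>b c. klin S \<mu> (\<lambda>a. t a b c)) \<and> (\<forall>a. bilin S \<mu> (t a))"

lemma kscal_subgrp: "kscal S \<mu> \<Longrightarrow> subgrp S"
  by (simp add: kscal_def)

lemma kscal_add: "kscal S \<mu> \<Longrightarrow> \<mu> c (x + y) = \<mu> c x + \<mu> c y"
  by (simp add: kscal_def)

lemma kscal_cg:
  assumes \<mu>: "kscal S \<mu>" and "cg S x y"
  shows "cg S (\<mu> c x) (\<mu> c y)"
proof -
  have "\<mu> c x = \<mu> c (x - y) + \<mu> c y" using kscal_add[OF \<mu>, of c "x - y" y] by simp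
  then show ?thesis using assms by (simp add: cg_def kscal_def)
qed

lemma kscal_sum_list: "kscal S \<mu> \<Longrightarrow> \<mu> c (sum_list (map f xs)) = sum_list (map (\<lambda>x. \<mu> c (f x)) xs)"
  using kscal_add[of S \<mu> c 0 0] by (induction xs) (simp_all add: kscal_add)

lemma kscal_SW: "kscal S \<mu> \<Longrightarrow> \<mu> c (SW d \<beta>) = SW d (\<lambda>a b. \<mu> c (\<beta> a b))"
  by (simp add: SW_def kscal_sum_list case_prod_unfold)

lemma klinD:
  assumes "klin S \<mu> \<phi>"
  shows "cg S (\<phi> (d + e)) (\<phi> d + \<phi> e)" "cg S (\<phi> (scD c d)) (\<mu> c (\<phi> d))"
  using assms by (auto simp: klin_def)

lemma SW_cong: "subgrp S \<Longrightarrow> (\<And>a b. cg S (f a b) (g a b)) \<Longrightarrow> cg S (SW d f) (SW d g)"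
  unfolding SW_def by (intro cg_sum_list) auto

lemma SW_add: "SW d (\<lambda>a b. f a b + g a b) = SW d f + SW d g"
  by (simp add: SW_def case_prod_unfold sum_list_addf)

lemma SW_additive: "(\<And>x y. \<phi> (x + y) = \<phi> x + \<phi> y) \<Longrightarrow> \<phi> (SW d f) = SW d (\<lambda>a b. \<phi> (f a b))"
proof -
  assume a: "\<And>x y. \<phi> (x + y) = \<phi> x + \<phi> y"
  have 0: "\<phi> 0 = 0" using a[of 0 0] by simp
  have "\<phi> (sum_list (map (case_prod f) xs)) = sum_list (map (\<lambda>(u, v). \<phi> (f u v)) xs)" for xs
    by (induction xs) (auto simp: a 0)
  then show ?thesis by (simp add: SW_def)
qed

lemma SW_mem: "subgrp S \<Longrightarrow> (\<And>a b. f a b \<in> S) \<Longrightarrow> SW d f \<in> S"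
  unfolding SW_def by (intro subgrp_sum_list) auto

lemma SW_swap_sums: "SW d (\<lambda>a b. SW e (\<lambda>u v. f a b u v)) = SW e (\<lambda>u v. SW d (\<lambda>a b. f a b u v))"
proof -
  have "(\<Sum>x\<leftarrow>xs. \<Sum>y\<leftarrow>ys. g x y) = (\<Sum>y\<leftarrow>ys. \<Sum>x\<leftarrow>xs. g x y)" for xs ys :: "('d \<times> 'd) list" and g
    :: "'d \<times> 'd \<Rightarrow> 'd \<times> 'd \<Rightarrow> 'a"
    by (induction xs) (simp_all add: sum_list_addf)
  then show ?thesis by (simp add: SW_def case_prod_unfold)
qed

lemma bilin_balanced:
  assumes \<mu>: "kscal S \<mu>" and \<beta>: "bilin S \<mu> \<beta>"
  shows "balanced base_field D D S \<beta>"
proof -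
  note A = kscal_subgrp[OF \<mu>]
  have "cg S (\<beta> (scD c a) b) (\<beta> a (scD c b))" for c a b
    using \<beta> cg_trans[OF A _ cg_sym[OF A]] unfolding bilin_def klin_def by blast
  with \<beta> show ?thesis by (simp add: balanced_def bilin_def klin_def)
qed

text \<open>Two representatives of \<open>\<Delta> d\<close> differ by a relation, which a bilinear
  summand sends into \<open>S\<close>. So the list chosen by \<open>sw\<close> can be traded for
  whatever representative the coalgebra axioms supply.\<close>

lemma SW_rep:
  assumes \<mu>: "kscal S \<mu>" and \<beta>: "bilin S \<mu> \<beta>" and x: "\<Delta> d = DD x"
  shows "cg S (SW d \<beta>) (ext (case_prod \<beta>) x)"
proof -
  have "cg (tensor_null base_field D D) (fr (sw d)) x"
    using x sw[of d] by (simp add: tensor_class_eq_iff)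
  from ext_tensor_null[OF kscal_subgrp[OF \<mu>] bilin_balanced[OF \<mu> \<beta>] this[unfolded cg_def]]
  show ?thesis by (simp add: SW_def cg_def)
qed

lemma comult_add': "\<Delta> (d + e) = DD (fr (sw d) + fr (sw e))"
  using comult_add[of d e] by (simp add: sw tensor_add)

lemma balanced_scale:
  "balanced base_field D N (tensor_null base_field D N) (\<lambda>a b. frag_of (scD c a, b))"
proof -
  have "frag_of (scD c (scD r a), b) - frag_of (scD c a, r \<odot>\<^bsub>N\<^esub> b) \<in> tensor_null base_field D N"
    if "b \<in> carrier N" for r a b
    using tensor_null.balance[of r base_field "scD c a" D b N] that by (simp add: scD_commute[of r])
  then show ?thesis
    using tensor_null.add_left[of "scD c _" D "scD c _" _ N base_field]
      tensor_null.add_right[of "scD c _" D _ N _ base_field]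
    by (simp add: balanced_def cg_def scD_simps diff_diff_eq)
qed

lemma smult_DD:
  "c \<odot>\<^bsub>ctensor D\<^esub> DD x = DD (ext (\<lambda>(a, b). frag_of (scD c a, b)) x)"
  using tensor_smult[where M = D and r = c and R = base_field and N = D] balanced_scale[of D c] by simp

lemma comult_smult': "\<Delta> (scD c d) = DD (fr (map (\<lambda>(a, b). (scD c a, b)) (sw d)))"
proof -
  have e: "ext (\<lambda>(a, b). frag_of (scD c a, b)) (fr xs) = fr (map (\<lambda>(a, b). (scD c a, b)) xs)" for xs
    by (induction xs) (auto split: prod.splits)
  have "\<Delta> (scD c d) = c \<odot>\<^bsub>ctensor D\<^esub> DD (fr (sw d))"
    using comult_smult[of d c] by (simp flip: sw)
  then show ?thesis unfolding smult_DD e .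
qed

text \<open>Joining \<open>sw d\<close> and \<open>sw e\<close>, or scaling the first entries of
  \<open>sw d\<close>, gives representatives of \<open>\<Delta> (d + e)\<close> and
  \<open>\<Delta> (scD c d)\<close> to which \<open>SW_rep\<close> applies. Nested Sweedler sums are
  thereby multilinear again, as \<open>SW_assoc\<close> and \<open>SW_middle\<close> demand.\<close>

lemma klin_SW:
  assumes \<mu>: "kscal S \<mu>" and \<beta>: "bilin S \<mu> \<beta>"
  shows "klin S \<mu> (\<lambda>d. SW d \<beta>)"
proof -
  note A = kscal_subgrp[OF \<mu>]
  have "cg S (SW (d + e) \<beta>) (SW d \<beta> + SW e \<beta>)" for d e
    using SW_rep[OF \<mu> \<beta> comult_add'[of d e]] by (simp add: SW_def)
  moreover have "cg S (SW (scD c d) \<beta>) (\<mu> c (SW d \<beta>))" for c d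
  proof -
    have "cg S (SW (scD c d) \<beta>) (SW d (\<lambda>a b. \<beta> (scD c a) b))"
      using SW_rep[OF \<mu> \<beta> comult_smult'[of c d]] by (simp add: SW_def case_prod_unfold comp_def)
    moreover have "cg S (SW d (\<lambda>a b. \<beta> (scD c a) b)) (\<mu> c (SW d \<beta>))"
      unfolding kscal_SW[OF \<mu>] using \<beta> by (intro SW_cong A) (auto simp: bilin_def klin_def)
    ultimately show ?thesis by (rule cg_trans[OF A])
  qed
  ultimately show ?thesis by (simp add: klin_def)
qed

lemma klin_cong_SW:
  assumes \<mu>: "kscal S \<mu>" and "\<And>u v. klin S \<mu> (\<lambda>a. f a u v)"
  shows "klin S \<mu> (\<lambda>a. SW d (f a))"
proof -
  note A = kscal_subgrp[OF \<mu>]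
  show ?thesis
    unfolding klin_def kscal_SW[OF \<mu>] SW_add[symmetric]
    using assms(2) by (auto simp: klin_def intro!: SW_cong A)
qed

lemma klin_add_list:
  assumes \<mu>: "kscal S \<mu>" and \<phi>: "klin S \<mu> \<phi>"
  shows "cg S (\<phi> (sum_list (map f xs))) (sum_list (map (\<lambda>x. \<phi> (f x)) xs))"
proof -
  note A = kscal_subgrp[OF \<mu>]
  have 0: "cg S (\<phi> 0) 0"
    using cg_sym[OF A klinD(1)[OF \<phi>, of 0 0]] by (simp add: cg_def)
  show ?thesis
    by (induction xs)
      (auto simp: 0 intro: cg_trans[OF A klinD(1)[OF \<phi>]] cg_add[OF A] cg_refl[OF A])
qed

lemma SW_counit_left:
  assumes \<mu>: "kscal S \<mu>" and \<phi>: "klin S \<mu> \<phi>"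
  shows "cg S (SW d (\<lambda>a b. \<mu> (\<epsilon> a) (\<phi> b))) (\<phi> d)"
proof -
  note A = kscal_subgrp[OF \<mu>]
  have "balanced base_field D D {0} (\<lambda>a b. scD (\<epsilon> a) b)"
    using counit_add counit_smult by (simp add: balanced_def scD_simps scD_commute)
  then have "d = ext (\<lambda>(a, b). scD (\<epsilon> a) b) (fr (sw d))"
    using counit_left[of d, unfolded sw[of d]] by (simp add: tensor_lift_type)
  then have "\<phi> d = \<phi> (SW d (\<lambda>a b. scD (\<epsilon> a) b))" by (simp add: SW_def)
  moreover have "cg S (\<phi> (SW d (\<lambda>a b. scD (\<epsilon> a) b))) (SW d (\<lambda>a b. \<phi> (scD (\<epsilon> a) b)))"
    unfolding SW_def using klin_add_list[OF \<mu> \<phi>] by (simp add: case_prod_unfold)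
  moreover have "cg S (SW d (\<lambda>a b. \<phi> (scD (\<epsilon> a) b))) (SW d (\<lambda>a b. \<mu> (\<epsilon> a) (\<phi> b)))"
    by (intro SW_cong A klinD(2) \<phi>)
  ultimately show ?thesis using cg_trans[OF A] cg_sym[OF A] by metis
qed

lemma SW_counit_right:
  assumes \<mu>: "kscal S \<mu>" and \<phi>: "klin S \<mu> \<phi>"
  shows "cg S (SW d (\<lambda>a b. \<mu> (\<epsilon> b) (\<phi> a))) (\<phi> d)"
proof -
  note A = kscal_subgrp[OF \<mu>]
  have "balanced base_field D D {0} (\<lambda>a b. scD (\<epsilon> b) a)"
    using counit_add counit_smult by (simp add: balanced_def scD_simps scD_commute)
  then have "d = ext (\<lambda>(a, b). scD (\<epsilon> b) a) (fr (sw d))"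
    using counit_right[of d, unfolded sw[of d]] by (simp add: tensor_lift_type)
  then have "\<phi> d = \<phi> (SW d (\<lambda>a b. scD (\<epsilon> b) a))" by (simp add: SW_def)
  moreover have "cg S (\<phi> (SW d (\<lambda>a b. scD (\<epsilon> b) a))) (SW d (\<lambda>a b. \<phi> (scD (\<epsilon> b) a)))"
    unfolding SW_def using klin_add_list[OF \<mu> \<phi>] by (simp add: case_prod_unfold)
  moreover have "cg S (SW d (\<lambda>a b. \<phi> (scD (\<epsilon> b) a))) (SW d (\<lambda>a b. \<mu> (\<epsilon> b) (\<phi> a)))"
    by (intro SW_cong A klinD(2) \<phi>)
  ultimately show ?thesis using cg_trans[OF A] cg_sym[OF A] by metis
qed

lemma SW_comm:
  assumes \<mu>: "kscal S \<mu>" and \<beta>: "bilin S \<mu> \<beta>"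
  shows "cg S (SW d \<beta>) (SW d (\<lambda>a b. \<beta> b a))"
proof -
  have "balanced base_field D D (tensor_null base_field D D) (\<lambda>a b. frag_of (b, a))"
    using tensor_null.intros(3-5)[where R = base_field and M = D and N = D]
      subgrp_uminus[OF subgrp_tensor_null tensor_null.intros(5)[where R = base_field and M = D and N = D]]
    by (fastforce simp: balanced_def cg_def diff_diff_eq)
  then have "tensor_lift (ctensor D) (\<lambda>a b. cpure D b a) (DD (fr (sw d)))
      = DD (ext (\<lambda>(a, b). frag_of (b, a)) (fr (sw d)))"
    by (intro tensor_lift_tensor add_closed_D) (simp_all add: pure_tensor_def)
  then have "\<Delta> d = DD (ext (\<lambda>(a, b). frag_of (b, a)) (fr (sw d)))"
    using cocomm by (simp add: cocommutative_def flip: sw)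
  from SW_rep[OF \<mu> \<beta> this] show ?thesis
    by (simp add: SW_def ext_sum_list comp_def case_prod_unfold)
qed

text \<open>Coassociativity is an equation in \<open>D \<otimes> (D \<otimes> D)\<close>, where
  second entries are themselves cosets. Both of its sides are rewritten as classes of fragments, and
  the additive map induced by \<open>V\<close>, the extension of \<open>t\<close> to such entries,
  carries the resulting congruence to the claim.\<close>

lemma SW_assoc:
  fixes S :: "'g::ab_group_add set"
  assumes \<mu>: "kscal S \<mu>" and t: "trilin S \<mu> t"
  shows "cg S (SW d (\<lambda>a b. SW b (t a))) (SW d (\<lambda>a b. SW a (\<lambda>u v. t u v b)))"
proof -
  note A = kscal_subgrp[OF \<mu>]
  define TN where "TN = tensor_null base_field D (ctensor D)"
  define TC where "TC = tensor_class base_field D (ctensor D)"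
  define T where "T = tensor base_field D (ctensor D)"
  have AT: "subgrp TN" unfolding TN_def by (rule subgrp_tensor_null)
  have DD_mem: "DD x \<in> carrier (ctensor D)" for x by (simp add: tensor_carrier)
  have Delta_mem: "\<Delta> d \<in> carrier (ctensor D)" for d by (simp add: sw DD_mem)
  have mem_DD: "\<exists>xs. Y = DD (fr xs)" if "Y \<in> carrier (ctensor D)" for Y
    using tensor_carrier_list[OF abelian_group_D abelian_group_D that] by blast
  define \<nu> where "\<nu> c = ext (\<lambda>(a, Y :: ('d, 'd) tens). frag_of (scD c a, Y))" for c
  have \<nu>: "kscal TN \<nu>"
    using AT ext_tensor_null[OF subgrp_tensor_null balanced_scale]
    by (auto simp: kscal_def \<nu>_def TN_def)
  have cp_add1: "cpure D (a + a') b = cpure D a b \<oplus>\<^bsub>ctensor D\<^esub> cpure D a' b" for a a' b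
    using tensor_null.add_left[of a D a' b D base_field]
    by (simp add: pure_tensor_def tensor_add tensor_class_eq_iff cg_def diff_diff_eq)
  have cp_add2: "cpure D a (b + b') = cpure D a b \<oplus>\<^bsub>ctensor D\<^esub> cpure D a b'" for a b b'
    using tensor_null.add_right[of a D b D b' base_field]
    by (simp add: pure_tensor_def tensor_add tensor_class_eq_iff cg_def diff_diff_eq)
  have cp_s1: "cpure D (scD c a) b = c \<odot>\<^bsub>ctensor D\<^esub> cpure D a b" for c a b
    by (simp add: pure_tensor_def smult_DD)
  have cp_s2: "cpure D a (scD c b) = c \<odot>\<^bsub>ctensor D\<^esub> cpure D a b" for c a b
    using tensor_null.balance[of c base_field a D b D]
    unfolding cp_s1[symmetric] by (simp add: pure_tensor_def tensor_class_eq_iff cg_def)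
       (use subgrp_uminus[OF subgrp_tensor_null] in fastforce)
  have cp_mem: "cpure D a b \<in> carrier (ctensor D)" for a b
    by (simp add: pure_tensor_def DD_mem)
  have k1: "klin TN \<nu> (\<lambda>a. frag_of (a, Y))" if "Y \<in> carrier (ctensor D)" for Y
    using tensor_null.add_left[of _ D _ Y "ctensor D" base_field] that cg_refl[OF AT]
    by (simp add: klin_def \<nu>_def) (simp add: TN_def cg_def diff_diff_eq)
  have k2: "klin TN \<nu> (\<lambda>b. frag_of (a, f b))"
    if "\<And>b b'. f (b + b') = f b \<oplus>\<^bsub>ctensor D\<^esub> f b'" "\<And>c b. f (scD c b) = c \<odot>\<^bsub>ctensor D\<^esub> f b"
      "\<And>b. f b \<in> carrier (ctensor D)" for f a
    using tensor_null.add_right[of a D _ "ctensor D" _ base_field]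
      cg_sym[OF AT, of "frag_of (scD _ a, _)"] tensor_null.balance[of _ base_field a D _ "ctensor D"] that
    by (simp add: klin_def \<nu>_def) (simp add: TN_def cg_def diff_diff_eq)
  have b1: "bilin TN \<nu> (\<lambda>a b. frag_of (a, \<Delta> b))"
    using comult_add comult_smult by (auto simp: bilin_def intro!: k1 k2 Delta_mem)
  have b2: "bilin TN \<nu> (\<lambda>u v. frag_of (u, cpure D v b))" for b
    by (auto simp: bilin_def intro!: k1 k2 cp_mem cp_add1 cp_s1)
  have b3: "bilin TN \<nu> (\<lambda>a b. SW a (\<lambda>u v. frag_of (u, cpure D v b)))"
    unfolding bilin_def
    by (intro conjI allI klin_SW[OF \<nu> b2] klin_cong_SW[OF \<nu>] k2 cp_mem cp_add2 cp_s2)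
  have T1: "tensor_lift T (\<lambda>a b. pure_tensor base_field D (ctensor D) a (\<Delta> b)) (\<Delta> d)
      = TC (SW d (\<lambda>a b. frag_of (a, \<Delta> b)))"
    unfolding sw[of d] T_def TC_def SW_def ext_fr[symmetric]
    by (intro tensor_lift_tensor add_closed_D bilin_balanced[OF \<nu> b1, unfolded TN_def])
       (auto simp: pure_tensor_def Delta_mem)
  have T2: "tensor_lift T (\<lambda>u v. pure_tensor base_field D (ctensor D) u (cpure D v b)) (\<Delta> a)
      = TC (SW a (\<lambda>u v. frag_of (u, cpure D v b)))" for a b
    unfolding sw[of a] T_def TC_def SW_def ext_fr[symmetric]
    by (intro tensor_lift_tensor add_closed_D bilin_balanced[OF \<nu> b2, unfolded TN_def])
       (auto simp: pure_tensor_def cp_mem[unfolded pure_tensor_def])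
  have T3: "tensor_lift T (\<lambda>a b. TC (SW a (\<lambda>u v. frag_of (u, cpure D v b)))) (\<Delta> d)
      = TC (SW d (\<lambda>a b. SW a (\<lambda>u v. frag_of (u, cpure D v b))))"
    unfolding sw[of d] T_def TC_def SW_def[of d] ext_fr[symmetric]
    by (intro tensor_lift_tensor add_closed_D bilin_balanced[OF \<nu> b3, unfolded TN_def])
       (auto simp: SW_def case_prod_unfold cp_mem intro!: keys_sum_list_subset)
  have TN_cg: "cg TN (SW d (\<lambda>a b. frag_of (a, \<Delta> b))) (SW d (\<lambda>a b. SW a (\<lambda>u v. frag_of (u, cpure D v b))))"
    using coassoc[of d, unfolded Let_def, folded T_def] T1 T3 unfolding T2
    by (simp add: TC_def TN_def flip: tensor_class_eq_iff)
  \<comment> \<open>A coset has no preferred expression as a sum of pure tensors, so one is chosen.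
    Modulo \<open>S\<close> the value \<open>V a Y\<close> does not depend on this choice, because
    \<open>t a\<close> is bilinear.\<close>
  define rep where "rep Y = (SOME xs. Y = DD (fr xs))" for Y
  have rep: "Y = DD (fr (rep Y))" if "Y \<in> carrier (ctensor D)" for Y
    unfolding rep_def by (rule someI_ex[OF mem_DD[OF that]])
  define V where "V a Y = sum_list (map (case_prod (t a)) (rep Y))" for a Y
  have tb: "bilin S \<mu> (t a)" for a using t by (simp add: trilin_def)
  have V: "cg S (V a (DD y)) (ext (case_prod (t a)) y)" for a y
  proof -
    have "cg (tensor_null base_field D D) (fr (rep (DD y))) y"
      using rep[OF DD_mem[of y]] by (simp add: tensor_class_eq_iff[symmetric])
    from ext_tensor_null[OF A bilin_balanced[OF \<mu> tb] this[unfolded cg_def]]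
    show ?thesis by (simp add: V_def cg_def)
  qed
  have V1: "klin S \<mu> (\<lambda>a. V a Y)" for Y
    unfolding klin_def V_def kscal_sum_list[OF \<mu>] sum_list_addf[symmetric]
    using t by (auto simp: trilin_def klin_def intro!: cg_sum_list A)
  have V_bal: "balanced base_field D (ctensor D) S V"
    unfolding balanced_def
  proof (intro conjI ballI)
    fix a a' Y
    show "cg S (V (a \<oplus>\<^bsub>D\<^esub> a') Y) (V a Y + V a' Y)" using klinD(1)[OF V1] by simp
  next
    fix a Y Y' assume "Y \<in> carrier (ctensor D)" "Y' \<in> carrier (ctensor D)"
    then obtain xs ys where Y: "Y = DD (fr xs)" "Y' = DD (fr ys)" using mem_DD by metis
    have "cg S (V a (Y \<oplus>\<^bsub>ctensor D\<^esub> Y')) (ext (case_prod (t a)) (fr xs) + ext (case_prod (t a)) (fr ys))"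
      using V[of a "fr xs + fr ys"] by (simp add: Y tensor_add)
    then show "cg S (V a (Y \<oplus>\<^bsub>ctensor D\<^esub> Y')) (V a Y + V a Y')"
      using cg_trans[OF A _ cg_sym[OF A cg_add[OF A V V]]] unfolding Y by blast
  next
    fix c a Y assume "Y \<in> carrier (ctensor D)"
    then have Y: "Y = DD (fr (rep Y))" by (rule rep)
    have e: "ext (case_prod (t a)) (ext (\<lambda>(a, b). frag_of (scD c a, b)) (fr xs))
        = sum_list (map (\<lambda>(u, v). t a (scD c u) v) xs)" for xs
      by (induction xs) (auto split: prod.splits)
    have "c \<odot>\<^bsub>ctensor D\<^esub> Y = DD (ext (\<lambda>(a, b). frag_of (scD c a, b)) (fr (rep Y)))"
      by (subst Y) (rule smult_DD)
    then have "cg S (V a (c \<odot>\<^bsub>ctensor D\<^esub> Y)) (sum_list (map (\<lambda>(u, v). t a (scD c u) v) (rep Y)))"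
      using V[of a "ext (\<lambda>(a, b). frag_of (scD c a, b)) (fr (rep Y))"] unfolding e by simp
    moreover have "cg S (sum_list (map (\<lambda>(u, v). t a (scD c u) v) (rep Y))) (\<mu> c (V a Y))"
      unfolding V_def kscal_sum_list[OF \<mu>]
      using tb by (auto simp: bilin_def klin_def intro!: cg_sum_list A)
    ultimately show "cg S (V (c \<odot>\<^bsub>D\<^esub> a) Y) (V a (c \<odot>\<^bsub>ctensor D\<^esub> Y))"
      using klinD(2)[OF V1, of c a Y] cg_trans[OF A] cg_sym[OF A] by (metis mod_on_simps(6))
  qed
  have "cg S (ext (case_prod V) (SW d (\<lambda>a b. frag_of (a, \<Delta> b))))
      (ext (case_prod V) (SW d (\<lambda>a b. SW a (\<lambda>u v. frag_of (u, cpure D v b)))))"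
    using ext_tensor_null[OF A V_bal TN_cg[unfolded cg_def TN_def]] by (simp add: cg_def)
  then have 1: "cg S (SW d (\<lambda>a b. V a (\<Delta> b))) (SW d (\<lambda>a b. SW a (\<lambda>u v. V u (cpure D v b))))"
    by (simp add: SW_additive)
  have 2: "cg S (SW d (\<lambda>a b. V a (\<Delta> b))) (SW d (\<lambda>a b. SW b (t a)))"
    using V by (intro SW_cong A) (simp add: sw SW_def flip: ext_fr)
  have 3: "cg S (SW d (\<lambda>a b. SW a (\<lambda>u v. V u (cpure D v b)))) (SW d (\<lambda>a b. SW a (\<lambda>u v. t u v b)))"
    using V[of _ "frag_of (_, _)"] by (intro SW_cong A) (simp add: pure_tensor_def)
  show ?thesis
    by (rule cg_trans[OF A cg_sym[OF A 2] cg_trans[OF A 1 3]])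
qed

text \<open>Reassociation makes the two middle entries the parts of a single element;
  cocommutativity interchanges them there, and reassociation in the other direction restores the
  shape.\<close>

lemma SW_middle:
  fixes S :: "'g::ab_group_add set"
  assumes \<mu>: "kscal S \<mu>"
    and t1: "\<And>b u v. klin S \<mu> (\<lambda>a. t a b u v)" and t2: "\<And>a u v. klin S \<mu> (\<lambda>b. t a b u v)"
    and t3: "\<And>a b v. klin S \<mu> (\<lambda>u. t a b u v)" and t4: "\<And>a b u. klin S \<mu> (\<lambda>v. t a b u v)"
  shows "cg S (SW d (\<lambda>a b. SW a (\<lambda>a1 a2. SW b (\<lambda>b1 b2. t a1 a2 b1 b2))))
    (SW d (\<lambda>a b. SW a (\<lambda>a1 a2. SW b (\<lambda>b1 b2. t a1 b1 a2 b2))))"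
proof -
  note A = kscal_subgrp[OF \<mu>]
  have reassoc: "cg S (SW d (\<lambda>a b. SW a (\<lambda>a1 a2. SW b (\<lambda>b1 b2. s a1 a2 b1 b2))))
      (SW d (\<lambda>a b. SW b (\<lambda>u v. SW u (\<lambda>u1 u2. s a u1 u2 v))))"
    if s: "\<And>b u v. klin S \<mu> (\<lambda>a. s a b u v)" "\<And>a u v. klin S \<mu> (\<lambda>b. s a b u v)"
      "\<And>a b v. klin S \<mu> (\<lambda>u. s a b u v)" "\<And>a b u. klin S \<mu> (\<lambda>v. s a b u v)" for s
  proof -
    have "trilin S \<mu> (\<lambda>a u b. SW b (\<lambda>b1 b2. s a u b1 b2))"
      unfolding trilin_def bilin_def
      by (intro conjI allI klin_SW[OF \<mu>] klin_cong_SW[OF \<mu>] s) (simp add: bilin_def s)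
    note 1 = cg_sym[OF A SW_assoc[OF \<mu> this, of d]]
    have "trilin S \<mu> (s a)" for a
      by (simp add: trilin_def bilin_def s)
    note 2 = SW_assoc[OF \<mu> this]
    show ?thesis by (rule cg_trans[OF A 1]) (intro SW_cong[OF A] 2)
  qed
  have comm: "cg S (SW d (\<lambda>a b. SW b (\<lambda>u v. SW u (\<lambda>u1 u2. t a u1 u2 v))))
      (SW d (\<lambda>a b. SW b (\<lambda>u v. SW u (\<lambda>u1 u2. t a u2 u1 v))))"
    by (intro SW_cong[OF A] SW_comm[OF \<mu>]) (simp add: bilin_def t2 t3)
  show ?thesis
    using reassoc[of t, OF t1 t2 t3 t4] comm reassoc[of "\<lambda>a b c e. t a c b e", OF t1 t3 t2 t4]
      cg_trans[OF A] cg_sym[OF A] by meson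
qed

end

section \<open>Tensor squares of subalgebras\<close>

lemma additive_frag_eqI:
  fixes \<phi> \<psi> :: "('p \<Rightarrow>\<^sub>0 int) \<Rightarrow> 'g::ab_group_add"
  assumes "\<And>x y. \<phi> (x + y) = \<phi> x + \<phi> y" "\<And>x y. \<psi> (x + y) = \<psi> x + \<psi> y"
    and "\<And>p. \<phi> (frag_of p) = \<psi> (frag_of p)"
  shows "\<phi> x = \<psi> x"
proof -
  have d: "\<phi> (x - y) = \<phi> x - \<phi> y" "\<psi> (x - y) = \<psi> x - \<psi> y" for x y
    using assms(1)[of "x - y" y] assms(2)[of "x - y" y] by simp_all
  have "Poly_Mapping.keys x \<subseteq> UNIV" by simp
  then show ?thesis
    by (induction x rule: frag_induction) (use d[of 0 0] assms(3) in \<open>simp_all add: d\<close>)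
qed

text \<open>The product of the integral monoid ring of the multiplicative monoid of pairs. It is
  commutative, associative and unital before any tensor relation is imposed, so one operation serves
  all tensor squares of subalgebras of \<open>L\<close>.\<close>

definition mul :: "('l \<times> 'l \<Rightarrow>\<^sub>0 int) \<Rightarrow> ('l \<times> 'l \<Rightarrow>\<^sub>0 int) \<Rightarrow> ('l::comm_ring_1 \<times> 'l \<Rightarrow>\<^sub>0 int)" where
  "mul x y = ext (\<lambda>(a, b). ext (\<lambda>(a', b'). frag_of (a * a', b * b')) y) x"

lemma ext_plus_fun: "ext (\<lambda>p. f p + g p) x = ext f x + ext g x"
  by (rule additive_frag_eqI[of "ext (\<lambda>p. f p + g p)" "\<lambda>x. ext f x + ext g x"])
    (simp_all add: algebra_simps)

lemma mul_frag_of [simp]: "mul (frag_of (a, b)) (frag_of (a', b')) = frag_of (a * a', b * b')"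
  by (simp add: mul_def)

lemma mul_add_left: "mul (x + x') y = mul x y + mul x' y"
  by (simp add: mul_def)

lemma mul_add_right: "mul x (y + y') = mul x y + mul x y'"
  by (simp add: mul_def case_prod_unfold ext_plus_fun)

lemma mul_zero [simp]: "mul 0 x = 0" "mul x 0 = 0"
  using mul_add_right[of x 0 0] by (simp_all add: mul_def)

lemma mul_diff_left: "mul (x - x') y = mul x y - mul x' y"
  using mul_add_left[of "x - x'" x' y] by simp

lemma mul_diff_right: "mul x (y - y') = mul x y - mul x y'"
  using mul_add_right[of x "y - y'" y'] by simp

lemma mul_commute: "mul x y = mul y x"
proof -
  have 1: "mul (frag_of p) (frag_of q) = mul (frag_of q) (frag_of p)" for p q :: "'a \<times> 'a"
    by (cases p; cases q) (simp add: mult.commute)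
  have 2: "mul (frag_of p) y = mul y (frag_of p)" for p
    by (rule additive_frag_eqI[of "mul (frag_of p)" "\<lambda>y. mul y (frag_of p)"])
      (simp_all add: mul_add_left mul_add_right 1)
  show ?thesis
    by (rule additive_frag_eqI[of "\<lambda>x. mul x y" "mul y"]) (simp_all add: mul_add_left mul_add_right 2)
qed

lemma mul_assoc: "mul (mul x y) z = mul x (mul y z)"
proof -
  have 1: "mul (mul (frag_of p) (frag_of q)) (frag_of r) = mul (frag_of p) (mul (frag_of q) (frag_of r))"
    for p q r :: "'a \<times> 'a"
    by (cases p; cases q; cases r) (simp add: mult.assoc)
  have 2: "mul (mul (frag_of p) (frag_of q)) z = mul (frag_of p) (mul (frag_of q) z)" for p q
    by (rule additive_frag_eqI[of "\<lambda>z. mul (mul (frag_of p) (frag_of q)) z"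
          "\<lambda>z. mul (frag_of p) (mul (frag_of q) z)"]) (simp_all add: mul_add_right 1)
  have 3: "mul (mul (frag_of p) y) z = mul (frag_of p) (mul y z)" for p
    by (rule additive_frag_eqI[of "\<lambda>y. mul (mul (frag_of p) y) z" "\<lambda>y. mul (frag_of p) (mul y z)"])
      (simp_all add: mul_add_right mul_add_left 2)
  show ?thesis
    by (rule additive_frag_eqI[of "\<lambda>x. mul (mul x y) z" "\<lambda>x. mul x (mul y z)"])
      (simp_all add: mul_add_left 3)
qed

lemma mul_one [simp]: "mul (frag_of (1, 1)) x = x" "mul x (frag_of (1, 1)) = x"
proof -
  show "mul (frag_of (1, 1)) x = x"
    by (rule additive_frag_eqI[of "mul (frag_of (1, 1))" "\<lambda>x. x"]) (auto simp: mul_add_right)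
  then show "mul x (frag_of (1, 1)) = x" by (simp add: mul_commute)
qed

lemma mul_sum_right: "mul x (sum f P) = (\<Sum>i\<in>P. mul x (f i))"
  by (induction P rule: infinite_finite_induct) (simp_all add: mul_add_right)

lemma mul_sum_left: "mul (sum f P) x = (\<Sum>i\<in>P. mul (f i) x)"
  by (induction P rule: infinite_finite_induct) (simp_all add: mul_add_left)

definition swapF :: "('l \<times> 'l \<Rightarrow>\<^sub>0 int) \<Rightarrow> ('l \<times> 'l \<Rightarrow>\<^sub>0 int)" where
  "swapF = ext (\<lambda>(a, b). frag_of (b, a))"

lemma swapF_frag_of [simp]: "swapF (frag_of (a, b)) = frag_of (b, a)"
  and swapF_0 [simp]: "swapF 0 = 0"
  and swapF_add: "swapF (x + y) = swapF x + swapF y"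
  and swapF_diff: "swapF (x - y) = swapF x - swapF y"
  by (simp_all add: swapF_def)

lemma swapF_swapF [simp]: "swapF (swapF x) = x"
  by (rule additive_frag_eqI[of "\<lambda>x. swapF (swapF x)" "\<lambda>x. x"]) (auto simp: swapF_add)

lemma swapF_mul: "swapF (mul x y) = mul (swapF x) (swapF y)"
proof -
  have 1: "swapF (mul (frag_of p) (frag_of q)) = mul (swapF (frag_of p)) (swapF (frag_of q))"
    for p q :: "'a \<times> 'a"
    by (cases p; cases q) simp
  have 2: "swapF (mul (frag_of p) y) = mul (swapF (frag_of p)) (swapF y)" for p
    by (rule additive_frag_eqI[of "\<lambda>y. swapF (mul (frag_of p) y)" "\<lambda>y. mul (swapF (frag_of p)) (swapF y)"])
      (simp_all add: mul_add_right swapF_add 1)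
  show ?thesis
    by (rule additive_frag_eqI[of "\<lambda>x. swapF (mul x y)" "\<lambda>x. mul (swapF x) (swapF y)"])
      (simp_all add: mul_add_left swapF_add 2)
qed

section \<open>Relations of the tensor square of a subalgebra\<close>

definition free_on :: "'l set \<Rightarrow> ('l \<times> 'l \<Rightarrow>\<^sub>0 int) set" where
  "free_on A = {x. Poly_Mapping.keys x \<subseteq> A \<times> A}"

lemma free_on_UNIV [simp]: "free_on UNIV = UNIV"
  by (simp add: free_on_def)

lemma free_on_frag_of [simp]: "frag_of (a, b) \<in> free_on A \<longleftrightarrow> a \<in> A \<and> b \<in> A"
  by (simp add: free_on_def keys_frag_of)

lemma subgrp_free_on: "subgrp (free_on A)"
  by (simp add: subgrp_def free_on_def keys_diff_subset)

lemma free_on_induct [consumes 1, case_names zero one diff]: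
  assumes "x \<in> free_on A" "P 0" "\<And>a b. a \<in> A \<Longrightarrow> b \<in> A \<Longrightarrow> P (frag_of (a, b))"
    and "\<And>x y. x \<in> free_on A \<Longrightarrow> y \<in> free_on A \<Longrightarrow> P x \<Longrightarrow> P y \<Longrightarrow> P (x - y)"
  shows "P x"
proof -
  have "x \<in> free_on A \<and> P x"
    using assms(1)[unfolded free_on_def mem_Collect_eq]
    by (induction x rule: frag_induction)
      (use assms in \<open>auto simp: subgrp_diff[OF subgrp_free_on] subgrp_0[OF subgrp_free_on]\<close>)
  then show ?thesis ..
qed

abbreviation SN :: "'l::comm_ring_1 set \<Rightarrow> 'l set \<Rightarrow> ('l \<times> 'l \<Rightarrow>\<^sub>0 int) set" where
  "SN B A \<equiv> tensor_null (ring_on B) (mod_on (*) A) (mod_on (*) A)"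

abbreviation SC :: "'l::comm_ring_1 set \<Rightarrow> 'l set \<Rightarrow> ('l \<times> 'l \<Rightarrow>\<^sub>0 int) \<Rightarrow> ('l, 'l) tens" where
  "SC B A \<equiv> tensor_class (ring_on B) (mod_on (*) A) (mod_on (*) A)"

lemma subgrp_SN: "subgrp (SN B A)"
  by (rule subgrp_tensor_null)

lemmas SN_trans [trans] = cg_trans[OF subgrp_SN] and SN_sym = cg_sym[OF subgrp_SN]
  and SN_refl = cg_refl[OF subgrp_SN] and SN_add = cg_add[OF subgrp_SN] and SN_diff = cg_diff[OF subgrp_SN]

lemma SN_frag_add:
  "a \<in> A \<Longrightarrow> a' \<in> A \<Longrightarrow> b \<in> A \<Longrightarrow> cg (SN B A) (frag_of (a + a', b)) (frag_of (a, b) + frag_of (a', b))"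
  "a \<in> A \<Longrightarrow> a' \<in> A \<Longrightarrow> b \<in> A \<Longrightarrow> cg (SN B A) (frag_of (b, a + a')) (frag_of (b, a) + frag_of (b, a'))"
  using tensor_null.add_left[of a "mod_on (*) A" a' b "mod_on (*) A" "ring_on B"]
    tensor_null.add_right[of b "mod_on (*) A" a "mod_on (*) A" a' "ring_on B"]
  by (simp_all add: cg_def diff_diff_eq)

lemma SN_frag_balance:
  "r \<in> B \<Longrightarrow> a \<in> A \<Longrightarrow> b \<in> A \<Longrightarrow> cg (SN B A) (frag_of (r * a, b)) (frag_of (a, r * b))"
  using tensor_null.balance[of r "ring_on B" a "mod_on (*) A" b "mod_on (*) A"] by (simp add: cg_def)

text \<open>On representatives the canonical map between tensor squares is the identity, so its
  existence amounts to this inclusion. It will carry congruences from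
  \<open>A \<otimes>\<^sub>K A\<close> to \<open>L \<otimes>\<^sub>F L\<close>.\<close>

lemma SN_mono:
  assumes "B \<subseteq> B'" "A \<subseteq> A'"
  shows "SN B A \<subseteq> SN B' A'"
proof
  fix x assume "x \<in> SN B A"
  then show "x \<in> SN B' A'"
    by induction (use SN_frag_add[of _ A' _ _ B'] SN_frag_balance[of _ B' _ A'] in
      \<open>simp_all add: cg_def diff_diff_eq tensor_null.zero tensor_null.diff
        subsetD[OF assms(1)] subsetD[OF assms(2)]\<close>)
qed

lemma frag_sum_list_left:
  assumes A: "0 \<in> A" "\<And>x y. x \<in> A \<Longrightarrow> y \<in> A \<Longrightarrow> x + y \<in> A" and "z \<in> A" "\<And>i. i \<in> set xs \<Longrightarrow> f i \<in> A"
  shows "cg (SN B A) (frag_of (sum_list (map f xs), z)) (sum_list (map (\<lambda>i. frag_of (f i, z)) xs))"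
  using assms(4)
proof (induction xs)
  case Nil
  have "cg (SN B A) (frag_of (0 + 0, z)) (frag_of (0, z) + frag_of (0, z))"
    by (intro SN_frag_add A assms(3))
  from SN_sym[OF this] show ?case by (simp add: cg_def)
next
  case (Cons i xs)
  have m: "sum_list (map f xs) \<in> A"
    using Cons.prems by (induction xs) (auto intro: A)
  show ?case
    using SN_trans[OF SN_frag_add(1)[of "f i" A "sum_list (map f xs)" z B] SN_add[OF SN_refl Cons.IH]]
      Cons.prems m assms(3) by simp
qed

lemma frag_sum_list_right:
  assumes A: "0 \<in> A" "\<And>x y. x \<in> A \<Longrightarrow> y \<in> A \<Longrightarrow> x + y \<in> A" and "z \<in> A" "\<And>i. i \<in> set xs \<Longrightarrow> f i \<in> A"
  shows "cg (SN B A) (frag_of (z, sum_list (map f xs))) (sum_list (map (\<lambda>i. frag_of (z, f i)) xs))"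
  using assms(4)
proof (induction xs)
  case Nil
  have "cg (SN B A) (frag_of (z, 0 + 0)) (frag_of (z, 0) + frag_of (z, 0))"
    by (intro SN_frag_add A assms(3))
  from SN_sym[OF this] show ?case by (simp add: cg_def)
next
  case (Cons i xs)
  have m: "sum_list (map f xs) \<in> A"
    using Cons.prems by (induction xs) (auto intro: A)
  show ?case
    using SN_trans[OF SN_frag_add(2)[of "f i" A "sum_list (map f xs)" z B] SN_add[OF SN_refl Cons.IH]]
      Cons.prems m assms(3) by simp
qed

text \<open>
  Elements of \<open>A \<otimes>\<^sub>B A\<close> are handled through representatives in the free abelian group on \<open>A \<times> A\<close>:
  \<open>SN B A\<close> consists of the representatives of \<open>0\<close>, \<open>SC B A x\<close> is the class of \<open>x\<close>, and \<open>mul\<close>, \<open>scF\<close>, \<open>DA\<close>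
  and (in the locale below) \<open>HF\<close> represent the product, the scalars of \<open>k\<close>, the diagonal action and the
  constants.
\<close>

context cocommutative_module_algebra
begin

lemma scL_simps:
  "scL c (x + y) = scL c x + scL c y" "scL (c + c') x = scL c x + scL c' x"
  "scL (c * c') x = scL c (scL c' x)" "scL 1 x = x" "scL c x * y = scL c (x * y)"
proof -
  interpret algebra base_field "mod_on scL UNIV" by (rule algebra)
  show "scL c (x + y) = scL c x + scL c y" "scL (c + c') x = scL c x + scL c' x"
    "scL (c * c') x = scL c (scL c' x)" "scL 1 x = x" "scL c x * y = scL c (x * y)"
    using smult_r_distr smult_l_distr smult_assoc1 smult_one smult_assoc2 by simp_all
qed

lemma scL_one_mult: "scL c 1 * x = scL c x"
  using scL_simps(5)[of c 1 x] by simp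

lemma mult_scL: "x * scL c y = scL c (x * y)"
  using scL_simps(5)[of c y x] by (simp add: mult.commute)

lemma scL_0 [simp]: "scL 0 x = 0" "scL c 0 = 0"
  using scL_simps(2)[of 0 0 x] scL_simps(1)[of c 0 0] by simp_all

lemma scL_minus: "scL (- c) x = - scL c x"
  using scL_simps(2)[of c "- c" x] by (simp add: eq_neg_iff_add_eq_0 add.commute)

lemma act_0 [simp]: "act d 0 = 0"
  using act_add_right[of d 0 0] by simp

lemma kscal_scL: "kscal {0} scL"
  by (simp add: kscal_def scL_simps)

lemma act_prod_SW: "act d (x * y) = SW d (\<lambda>a b. act a x * act b y)"
proof -
  have "bilin {0} scL (\<lambda>a b. act a x * act b y)"
    by (simp add: bilin_def klin_def act_add_left act_scale_left scL_simps mult_scL distrib_left distrib_right)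
  from bilin_balanced[OF kscal_scL this]
  show ?thesis
    using act_prod[of d x y] tensor_lift_type[of "ring_on UNIV" base_field D D "\<lambda>a b. act a x * act b y" "fr (sw d)"]
    by (simp add: sw SW_def)
qed

lemma D_subalgebraD:
  assumes "D_subalgebra scL act B"
  shows "0 \<in> B" "1 \<in> B" "x \<in> B \<Longrightarrow> y \<in> B \<Longrightarrow> x + y \<in> B" "x \<in> B \<Longrightarrow> y \<in> B \<Longrightarrow> x * y \<in> B"
    "x \<in> B \<Longrightarrow> - x \<in> B" "x \<in> B \<Longrightarrow> y \<in> B \<Longrightarrow> x - y \<in> B" "x \<in> B \<Longrightarrow> scL c x \<in> B" "x \<in> B \<Longrightarrow> act d x \<in> B"
proof -
  have B: "subring B (ring_on UNIV)" using assms by (simp add: D_subalgebra_def)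
  interpret R: abelian_group "ring_on (UNIV :: 'l set)" by (rule abelian_group_type) simp_all
  have "\<ominus>\<^bsub>ring_on UNIV\<^esub> x = - x" for x :: 'l by (rule R.minus_equality) auto
  then have neg: "- x \<in> B" if "x \<in> B" for x
    using subringE(5)[OF B that] by simp
  show add: "x + y \<in> B" if "x \<in> B" "y \<in> B" for x y using subringE(7)[OF B that] by simp
  show "x - y \<in> B" if "x \<in> B" "y \<in> B" using add[OF that(1) neg[OF that(2)]] by simp
  show "x \<in> B \<Longrightarrow> - x \<in> B" by (rule neg)
  show "0 \<in> B" "1 \<in> B" "x \<in> B \<Longrightarrow> y \<in> B \<Longrightarrow> x * y \<in> B"
    using subringE(2,3,6)[OF B] by simp_all
  show "x \<in> B \<Longrightarrow> scL c x \<in> B" "x \<in> B \<Longrightarrow> act d x \<in> B" using assms by (simp_all add: D_subalgebra_def)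
qed

lemma D_subalgebra_UNIV: "D_subalgebra scL act UNIV"
proof -
  have "ring (ring_on (UNIV :: 'l set))"
    by (rule ringI) (auto intro!: abelian_group_type monoidI simp: algebra_simps)
  then show ?thesis using ring.carrier_is_subring by (fastforce simp: D_subalgebra_def)
qed

definition DA :: "'d \<Rightarrow> ('l \<times> 'l \<Rightarrow>\<^sub>0 int) \<Rightarrow> ('l \<times> 'l \<Rightarrow>\<^sub>0 int)" where
  "DA d = ext (\<lambda>(y, z). SW d (\<lambda>a b. frag_of (act a y, act b z)))"

definition scF :: "'k \<Rightarrow> ('l \<times> 'l \<Rightarrow>\<^sub>0 int) \<Rightarrow> ('l \<times> 'l \<Rightarrow>\<^sub>0 int)" where
  "scF c = mul (frag_of (scL c 1, 1))"

lemma DA_add: "DA d (x + y) = DA d x + DA d y" and DA_diff: "DA d (x - y) = DA d x - DA d y"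
  and DA_0 [simp]: "DA d 0 = 0"
  and DA_frag_of: "DA d (frag_of (u, v)) = SW d (\<lambda>a b. frag_of (act a u, act b v))"
  by (simp_all add: DA_def)

lemma scF_add: "scF c (x + y) = scF c x + scF c y" and scF_diff: "scF c (x - y) = scF c x - scF c y"
  and scF_0 [simp]: "scF c 0 = 0"
  and scF_frag_of: "scF c (frag_of (u, v)) = frag_of (scL c u, v)"
  by (simp_all add: scF_def mul_add_right mul_diff_right scL_one_mult)

lemma scF_mult: "scF c (scF c' x) = scF (c * c') x"
  by (simp add: scF_def scL_simps(3) mul_assoc[symmetric] scL_one_mult)

lemma mul_scF: "mul (scF c x) y = scF c (mul x y)" "mul x (scF c y) = scF c (mul x y)"
  by (simp_all add: scF_def mul_assoc) (metis mul_assoc mul_commute)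

lemma SW_mul_left: "mul (SW d f) x = SW d (\<lambda>a b. mul (f a b) x)"
  by (rule SW_additive) (rule mul_add_left)

lemma SW_mul_right: "mul x (SW d f) = SW d (\<lambda>a b. mul x (f a b))"
  by (rule SW_additive) (rule mul_add_right)

end

locale tensor_square = cocommutative_module_algebra scD \<Delta> \<epsilon> scL act
  for scD :: "'k::field \<Rightarrow> 'd::ring_1 \<Rightarrow> 'd" and \<Delta> and \<epsilon>
    and scL :: "'k \<Rightarrow> 'l::comm_ring_1 \<Rightarrow> 'l" and act :: "'d \<Rightarrow> 'l \<Rightarrow> 'l" +
  fixes B A :: "'l set"
  assumes B: "D_subalgebra scL act B" and A: "D_subalgebra scL act A" and BA: "B \<subseteq> A"
begin

lemmas Bs = D_subalgebraD[OF B] and As = D_subalgebraD[OF A]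

lemma scL_one_mem: "scL c 1 \<in> B"
  by (simp add: Bs)

lemma add_closed_A: "add_closed_module (ring_on B) (mod_on (*) A)"
proof -
  have "abelian_group (mod_on (*) A)"
    by (rule abelian_groupI) (auto simp: As ac_simps intro: bexI[of _ "- _"])
  then show ?thesis using BA by (auto simp: add_closed_module_def As)
qed

lemma SN_free_on: "x \<in> SN B A \<Longrightarrow> x \<in> free_on A"
  using keys_tensor_null[OF add_closed_A add_closed_A] by (simp add: free_on_def)

lemma free_on_cg: "cg (SN B A) x y \<Longrightarrow> y \<in> free_on A \<Longrightarrow> x \<in> free_on A"
  using SN_free_on[of "x - y"] subgrp_add[OF subgrp_free_on, of "x - y" A y] by (simp add: cg_def)

lemma mul_free_on: "x \<in> free_on A \<Longrightarrow> y \<in> free_on A \<Longrightarrow> mul x y \<in> free_on A"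
proof (induction x rule: free_on_induct)
  case (one a b)
  from one(3,1,2) show ?case
    by (induction y rule: free_on_induct)
      (auto simp: mul_diff_right As subgrp_0[OF subgrp_free_on] subgrp_diff[OF subgrp_free_on])
qed (simp_all add: mul_diff_left subgrp_0[OF subgrp_free_on] subgrp_diff[OF subgrp_free_on])

text \<open>Multiplication by a pure fragment is balanced in the entries of the other factor. Hence
  \<open>SN B A\<close> is an ideal of the monoid ring on \<open>A \<times> A\<close>, and the
  product descends to classes.\<close>

lemma mul_SN:
  assumes "x \<in> free_on A" "y \<in> SN B A"
  shows "mul x y \<in> SN B A"
  using assms(1)
proof (induction x rule: free_on_induct)
  case (one a b)
  have "balanced (ring_on B) (mod_on (*) A) (mod_on (*) A) (SN B A) (\<lambda>a' b'. frag_of (a * a', b * b'))"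
    using one BA SN_frag_add[of "a * _" A "a * _" "b * _" B] SN_frag_add[of "b * _" A "b * _" "a * _" B]
      SN_frag_balance[of _ B "a * _" A "b * _"]
    by (auto simp: balanced_def As distrib_left mult.left_commute)
  from ext_tensor_null[OF subgrp_SN this assms(2)] show ?case by (simp add: mul_def)
qed (simp_all add: mul_diff_left subgrp_0[OF subgrp_SN] subgrp_diff[OF subgrp_SN])

lemma mul_cg_right: "x \<in> free_on A \<Longrightarrow> cg (SN B A) y y' \<Longrightarrow> cg (SN B A) (mul x y) (mul x y')"
  using mul_SN[of x "y - y'"] by (simp add: cg_def mul_diff_right)

lemma mul_cg_left: "x \<in> free_on A \<Longrightarrow> cg (SN B A) y y' \<Longrightarrow> cg (SN B A) (mul y x) (mul y' x)"
  using mul_cg_right[of x y y'] by (simp add: mul_commute)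

lemma scF_free_on: "x \<in> free_on A \<Longrightarrow> scF c x \<in> free_on A"
  unfolding scF_def by (intro mul_free_on) (simp_all add: As)

lemma kscal_scF: "kscal (SN B A) scF"
  using mul_SN[of "frag_of (scL _ 1, 1)"] by (simp add: kscal_def subgrp_SN scF_add) (simp add: scF_def As)

lemma scF_cg: "cg (SN B A) x y \<Longrightarrow> cg (SN B A) (scF c x) (scF c y)"
  by (rule kscal_cg[OF kscal_scF])

lemma scF_add_scalar:
  assumes "x \<in> free_on A"
  shows "cg (SN B A) (scF (c + c') x) (scF c x + scF c' x)"
proof -
  have "cg (SN B A) (mul (frag_of (scL c 1 + scL c' 1, 1)) x) (mul (frag_of (scL c 1, 1) + frag_of (scL c' 1, 1)) x)"
    by (intro mul_cg_left assms SN_frag_add As)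
  then show ?thesis by (simp add: scF_def scL_simps mul_add_left)
qed

section \<open>The diagonal action of \<open>D\<close>\<close>

definition plin :: "('d \<Rightarrow> 'l) \<Rightarrow> bool" where
  "plin f \<longleftrightarrow> (\<forall>a b. f (a + b) = f a + f b) \<and> (\<forall>c a. f (scD c a) = scL c (f a)) \<and> (\<forall>a. f a \<in> A)"

lemma plin_act: "y \<in> A \<Longrightarrow> plin (\<lambda>a. act a y)"
  by (simp add: plin_def act_add_left act_scale_left As)

lemma plin_mult: "plin f \<Longrightarrow> y \<in> A \<Longrightarrow> plin (\<lambda>a. f a * y)" "plin f \<Longrightarrow> y \<in> A \<Longrightarrow> plin (\<lambda>a. y * f a)"
  by (simp_all add: plin_def scL_simps mult_scL As distrib_left distrib_right)

lemma klin_left: "plin f \<Longrightarrow> z \<in> A \<Longrightarrow> klin (SN B A) scF (\<lambda>a. frag_of (f a, z))"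
  by (simp add: klin_def plin_def scF_frag_of SN_frag_add SN_refl)

text \<open>Since \<open>scF\<close> scales the first factor, a scalar has to be moved across the
  tensor sign; this is possible because \<open>scL c 1\<close> lies in \<open>B\<close>.\<close>

lemma klin_right: "plin f \<Longrightarrow> z \<in> A \<Longrightarrow> klin (SN B A) scF (\<lambda>a. frag_of (z, f a))"
  using SN_sym[OF SN_frag_balance[OF scL_one_mem, of z A]]
  by (simp add: klin_def plin_def scF_frag_of SN_frag_add scL_one_mult)

lemma bilin_act: "y \<in> A \<Longrightarrow> z \<in> A \<Longrightarrow> bilin (SN B A) scF (\<lambda>a b. frag_of (act a y, act b z))"
  by (simp add: bilin_def klin_left klin_right plin_act As)

lemma DA_free_on: "x \<in> free_on A \<Longrightarrow> DA d x \<in> free_on A"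
  by (induction x rule: free_on_induct)
    (auto simp: DA_diff DA_frag_of As subgrp_0[OF subgrp_free_on]
      intro!: subgrp_diff[OF subgrp_free_on] SW_mem[OF subgrp_free_on])

lemma SW_frag_left:
  "z \<in> A \<Longrightarrow> (\<And>a b. f a b \<in> A) \<Longrightarrow> cg (SN B A) (frag_of (SW d f, z)) (SW d (\<lambda>a b. frag_of (f a b, z)))"
  unfolding SW_def case_prod_unfold by (intro frag_sum_list_left As) auto

lemma SW_frag_right:
  "z \<in> A \<Longrightarrow> (\<And>a b. f a b \<in> A) \<Longrightarrow> cg (SN B A) (frag_of (z, SW d f)) (SW d (\<lambda>a b. frag_of (z, f a b)))"
  unfolding SW_def case_prod_unfold by (intro frag_sum_list_right As) auto

text \<open>The Leibniz rule in both entries gives a fourfold Sweedler sum with the parts in the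
  order a1, a2, b1, b2, whereas the product of two diagonal actions has them in the order a1, b1,
  a2, b2. \<open>SW_middle\<close> mediates, so cocommutativity is what makes the diagonal action
  compatible with products.\<close>

lemma DA_mul_pure:
  assumes "y \<in> A" "z \<in> A" "y' \<in> A" "z' \<in> A"
  shows "cg (SN B A) (DA d (frag_of (y * y', z * z')))
    (SW d (\<lambda>a b. mul (DA a (frag_of (y, z))) (DA b (frag_of (y', z')))))"
proof -
  define t where "t a1 a2 b1 b2 = frag_of (act a1 y * act a2 y', act b1 z * act b2 z')" for a1 a2 b1 b2
  have "cg (SN B A) (frag_of (act a (y * y'), act b (z * z'))) (SW a (\<lambda>a1 a2. SW b (t a1 a2)))" for a b
  proof -
    have "cg (SN B A) (frag_of (act a (y * y'), act b (z * z')))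
        (SW a (\<lambda>a1 a2. frag_of (act a1 y * act a2 y', act b (z * z'))))"
      unfolding act_prod_SW[of a] using assms by (intro SW_frag_left) (simp_all add: As)
    moreover have "cg (SN B A) (SW a (\<lambda>a1 a2. frag_of (act a1 y * act a2 y', act b (z * z'))))
        (SW a (\<lambda>a1 a2. SW b (t a1 a2)))"
      unfolding act_prod_SW[of b] t_def using assms by (intro SW_cong subgrp_SN SW_frag_right) (simp_all add: As)
    ultimately show ?thesis by (rule SN_trans)
  qed
  then have "cg (SN B A) (DA d (frag_of (y * y', z * z'))) (SW d (\<lambda>a b. SW a (\<lambda>a1 a2. SW b (t a1 a2))))"
    unfolding DA_frag_of by (intro SW_cong subgrp_SN)
  moreover have "cg (SN B A) (SW d (\<lambda>a b. SW a (\<lambda>a1 a2. SW b (\<lambda>b1 b2. t a1 a2 b1 b2))))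
      (SW d (\<lambda>a b. SW a (\<lambda>a1 a2. SW b (\<lambda>b1 b2. t a1 b1 a2 b2))))"
    unfolding t_def using assms
    by (intro SW_middle[OF kscal_scF] klin_left klin_right plin_mult plin_act) (simp_all add: As)
  moreover have "mul (DA a (frag_of (y, z))) (DA b (frag_of (y', z')))
      = SW a (\<lambda>a1 a2. SW b (\<lambda>b1 b2. t a1 b1 a2 b2))" for a b
    by (simp add: DA_frag_of SW_mul_left SW_mul_right t_def) (rule SW_swap_sums)
  ultimately show ?thesis using SN_trans by simp
qed

lemma DA_mul:
  assumes "x \<in> free_on A" "y \<in> free_on A"
  shows "cg (SN B A) (DA d (mul x y)) (SW d (\<lambda>a b. mul (DA a x) (DA b y)))"
proof -
  have SW_diff: "SW d (\<lambda>a b. f a b - g a b) = SW d f - SW d g" for f g :: "'d \<Rightarrow> 'd \<Rightarrow> 'l \<times> 'l \<Rightarrow>\<^sub>0 int"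
    using SW_add[of d "\<lambda>a b. f a b - g a b" g] by simp
  have SW_0: "SW d (\<lambda>a b. 0 :: 'l \<times> 'l \<Rightarrow>\<^sub>0 int) = 0"
    using SW_diff[of "\<lambda>_ _. 0" "\<lambda>_ _. 0"] by simp
  show ?thesis
    using assms(1)
  proof (induction x rule: free_on_induct)
    case (one a b)
    from assms(2) show ?case
    proof (induction y rule: free_on_induct)
      case (one a' b')
      then show ?case using DA_mul_pure \<open>a \<in> A\<close> \<open>b \<in> A\<close> by simp
    next
      case (diff x y)
      then show ?case using SN_diff[OF diff(3,4)] by (simp add: mul_diff_right DA_diff SW_diff)
    qed (simp add: SN_refl SW_0)
  next
    case (diff x' x'')
    then show ?case using SN_diff[OF diff(3,4)] by (simp add: mul_diff_left DA_diff SW_diff)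
  qed (simp add: SN_refl SW_0)
qed

text \<open>On 1 an element of \<open>D\<close> acts through the counit, so the Sweedler sum
  collapses to a single term.\<close>

lemma DA_left: "y \<in> A \<Longrightarrow> cg (SN B A) (DA d (frag_of (y, 1))) (frag_of (act d y, 1))"
proof -
  assume y: "y \<in> A"
  have "cg (SN B A) (SW d (\<lambda>a b. frag_of (act a y, act b 1))) (SW d (\<lambda>a b. scF (\<epsilon> b) (frag_of (act a y, 1))))"
    using SN_sym[OF SN_frag_balance[OF scL_one_mem, of "act _ y" A 1]] y
    by (intro SW_cong subgrp_SN) (simp add: act_unit scF_frag_of As scL_one_mult)
  also have "cg (SN B A) (SW d (\<lambda>a b. scF (\<epsilon> b) (frag_of (act a y, 1)))) (frag_of (act d y, 1))"
    using y by (intro SW_counit_right kscal_scF klin_left plin_act) (simp_all add: As)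
  finally show ?thesis by (simp add: DA_frag_of)
qed

lemma DA_right: "y \<in> A \<Longrightarrow> cg (SN B A) (DA d (frag_of (1, y))) (frag_of (1, act d y))"
proof -
  assume y: "y \<in> A"
  have "SW d (\<lambda>a b. frag_of (act a 1, act b y)) = SW d (\<lambda>a b. scF (\<epsilon> a) (frag_of (1, act b y)))"
    by (simp add: act_unit scF_frag_of)
  also have "cg (SN B A) (SW d (\<lambda>a b. scF (\<epsilon> a) (frag_of (1, act b y)))) (frag_of (1, act d y))"
    using y by (intro SW_counit_left kscal_scF klin_right plin_act) (simp_all add: As)
  finally show ?thesis by (simp add: DA_frag_of)
qed

text \<open>Balancedness fails for the single terms of the Sweedler sum. It is reduced by
  \<open>DA_mul_pure\<close> to the factors \<open>r \<otimes> 1\<close> and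
  \<open>1 \<otimes> r\<close>, whose images \<open>act a r \<otimes> 1\<close> and
  \<open>1 \<otimes> act a r\<close> agree because \<open>B\<close> is stable under
  \<open>D\<close>.\<close>

lemma DA_SN:
  assumes "x \<in> SN B A"
  shows "DA d x \<in> SN B A"
proof -
  have bal: "cg (SN B A) (DA d (frag_of (r * y, z))) (DA d (frag_of (y, r * z)))"
    if "r \<in> B" "y \<in> A" "z \<in> A" for r y z
  proof -
    have r: "r \<in> A" using that BA by auto
    have m: "DA b (frag_of (y, z)) \<in> free_on A" for b using that by (simp add: DA_free_on)
    have "cg (SN B A) (DA a (frag_of (r, 1))) (DA a (frag_of (1, r)))" for a
    proof -
      have "cg (SN B A) (frag_of (act a r * 1, 1)) (frag_of (1, act a r * 1))"
        using that by (intro SN_frag_balance) (simp_all add: As Bs)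
      then show ?thesis using SN_trans[OF DA_left[OF r]] SN_trans[OF _ SN_sym[OF DA_right[OF r]]] by simp
    qed
    then have "cg (SN B A) (SW d (\<lambda>a b. mul (DA a (frag_of (r, 1))) (DA b (frag_of (y, z)))))
        (SW d (\<lambda>a b. mul (DA a (frag_of (1, r))) (DA b (frag_of (y, z)))))"
      by (intro SW_cong subgrp_SN mul_cg_left m)
    then show ?thesis
      using SN_trans[OF DA_mul_pure[of r 1 y z d]] SN_trans[OF _ SN_sym[OF DA_mul_pure[of 1 r y z d]]] that r
      by (simp add: As)
  qed
  have "balanced (ring_on B) (mod_on (*) A) (mod_on (*) A) (SN B A) (\<lambda>y z. DA d (frag_of (y, z)))"
    unfolding balanced_def using bal
    by (auto simp: DA_frag_of act_add_right SN_frag_add As intro!: SW_cong subgrp_SN simp flip: SW_add)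
  from ext_tensor_null[OF subgrp_SN this assms] show ?thesis by (simp add: DA_def)
qed

lemma DA_cg: "cg (SN B A) x y \<Longrightarrow> cg (SN B A) (DA d x) (DA d y)"
  using DA_SN[of "x - y"] by (simp add: cg_def DA_diff)

section \<open>Comparison of representatives with the tensor square as a ring\<close>

lemma SC_eq_iff: "SC B A x = SC B A y \<longleftrightarrow> cg (SN B A) x y"
  by (rule tensor_class_eq_iff)

lemma SC_add: "SC B A x \<oplus>\<^bsub>self_tensor B A\<^esub> SC B A y = SC B A (x + y)"
  by (rule tensor_add)

lemma SC_mult:
  assumes "x \<in> free_on A" "y \<in> free_on A"
  shows "SC B A x \<otimes>\<^bsub>self_tensor B A\<^esub> SC B A y = SC B A (mul x y)"
proof -
  have m: "u \<in> free_on A" if "u \<in> SC B A v" "v \<in> free_on A" for u v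
    using that free_on_cg by (simp add: mem_tensor_class)
  have "(\<Union>u\<in>SC B A x. \<Union>v\<in>SC B A y. SC B A (mul u v)) = (\<Union>u\<in>SC B A x. SC B A (mul u y))"
    using m assms
    by (intro SUP_cong refl UN_tensor_class) (auto simp: SC_eq_iff mem_tensor_class intro!: mul_cg_right)
  also have "\<dots> = SC B A (mul x y)"
    using assms by (intro UN_tensor_class) (auto simp: SC_eq_iff mem_tensor_class intro!: mul_cg_left)
  finally show ?thesis
    by (simp add: tensor_def mul_def frag_extend_eq_ext[abs_def])
qed

lemma SC_smult:
  assumes "r \<in> B"
  shows "r \<odot>\<^bsub>self_tensor B A\<^esub> SC B A x = SC B A (mul (frag_of (r, 1)) x)"
proof -
  have r: "r \<in> A" using assms BA by auto
  have "balanced (ring_on B) (mod_on (*) A) (mod_on (*) A) (SN B A) (\<lambda>a b. frag_of (r * a, b))"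
    using r BA SN_frag_add[of "r * _" A "r * _" _ B] SN_frag_add(2)[of _ A _ "r * _" B]
      SN_frag_balance[of _ B "r * _" A]
    by (auto simp: balanced_def As distrib_left mult.left_commute)
  then show ?thesis
    using tensor_smult[where M = "mod_on (*) A" and r = r and R = "ring_on B" and N = "mod_on (*) A"]
    by (simp add: mul_def)
qed

lemma SC_carrier: "carrier (self_tensor B A) = SC B A ` free_on A"
  by (simp add: tensor_carrier free_on_def)

lemma diagonal_act_SC:
  assumes "x \<in> free_on A"
  shows "diagonal_act \<Delta> act B A d (SC B A x) = SC B A (DA d x)"
proof -
  have 1: "tensor_lift (self_tensor B A) (\<lambda>d1 d2. self_pure B A (act d1 y) (act d2 z)) (\<Delta> d)
      = SC B A (DA d (frag_of (y, z)))" if "y \<in> A" "z \<in> A" for y z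
    unfolding sw[of d] DA_frag_of SW_def ext_fr[symmetric]
    using that by (intro tensor_lift_tensor add_closed_D bilin_balanced[OF kscal_scF bilin_act])
      (auto simp: pure_tensor_def keys_frag_of As)
  have "balanced (ring_on B) (mod_on (*) A) (mod_on (*) A) (SN B A) (\<lambda>y z. DA d (frag_of (y, z)))"
    unfolding balanced_def cg_def diff_diff_eq DA_diff[symmetric] DA_add[symmetric]
    using SN_frag_add[of _ A] SN_frag_balance[of _ B _ A]
    by (auto simp: cg_def intro!: DA_SN)
  then show ?thesis
    unfolding diagonal_act_def using assms DA_free_on[of "frag_of (_, _)" d]
    by (subst tensor_lift_tensor[where \<gamma> = "\<lambda>y z. DA d (frag_of (y, z))"])
      (auto simp: add_closed_A 1 free_on_def DA_def)
qed

section \<open>The constants of a tensor square\<close>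

definition HF :: "('l \<times> 'l \<Rightarrow>\<^sub>0 int) set" where
  "HF = {x \<in> free_on A. \<forall>d. cg (SN B A) (DA d x) (scF (\<epsilon> d) x)}"

lemma HF_free_on: "x \<in> HF \<Longrightarrow> x \<in> free_on A"
  by (simp add: HF_def)

lemma PV_hopf_carrier: "carrier (PV_hopf \<Delta> \<epsilon> scL act B A) = SC B A ` HF"
proof -
  have "SC B A x \<in> {X \<in> SC B A ` free_on A. \<forall>d. diagonal_act \<Delta> act B A d X = scL (\<epsilon> d) 1 \<odot>\<^bsub>self_tensor B A\<^esub> X}
      \<longleftrightarrow> x \<in> HF" if "x \<in> free_on A" for x
    using that by (auto simp: HF_def diagonal_act_SC SC_smult scL_one_mem SC_eq_iff scF_def)
  then show ?thesis
    unfolding PV_hopf_def Let_def SC_carrier using HF_free_on by auto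
qed

lemma PV_hopf_ops:
  "monoid.mult (PV_hopf \<Delta> \<epsilon> scL act B A) = monoid.mult (self_tensor B A)"
  "one (PV_hopf \<Delta> \<epsilon> scL act B A) = SC B A (frag_of (1, 1))"
  "zero (PV_hopf \<Delta> \<epsilon> scL act B A) = SC B A 0"
  "add (PV_hopf \<Delta> \<epsilon> scL act B A) = add (self_tensor B A)"
  "c \<odot>\<^bsub>PV_hopf \<Delta> \<epsilon> scL act B A\<^esub> SC B A x = SC B A (scF c x)"
  by (simp_all add: PV_hopf_def Let_def tensor_one tensor_zero SC_smult scL_one_mem scF_def)

lemma HF_diff: "x \<in> HF \<Longrightarrow> y \<in> HF \<Longrightarrow> x - y \<in> HF"
  by (auto simp: HF_def DA_diff scF_diff subgrp_diff[OF subgrp_free_on] intro: SN_diff)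

lemma HF_0: "0 \<in> HF"
  by (simp add: HF_def SN_refl subgrp_0[OF subgrp_free_on])

lemma HF_uminus: "x \<in> HF \<Longrightarrow> - x \<in> HF"
  using HF_diff[OF HF_0] by fastforce

lemma HF_add: "x \<in> HF \<Longrightarrow> y \<in> HF \<Longrightarrow> x + y \<in> HF"
  using HF_diff[of x "- y"] HF_uminus by fastforce

lemma HF_one: "frag_of (1, 1) \<in> HF"
  using DA_left[of 1] by (simp add: HF_def As act_unit scF_frag_of)

lemma klin_scF: "x \<in> free_on A \<Longrightarrow> klin (SN B A) scF (\<lambda>b. scF (\<epsilon> b) x)"
  using counit_add counit_smult by (simp add: klin_def scF_add_scalar scF_mult SN_refl)

lemma HF_mul:
  assumes "x \<in> HF" "y \<in> HF"
  shows "mul x y \<in> HF"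
proof -
  have m: "x \<in> free_on A" "y \<in> free_on A" "mul x y \<in> free_on A"
    using assms by (simp_all add: HF_free_on mul_free_on)
  have "cg (SN B A) (DA d (mul x y)) (scF (\<epsilon> d) (mul x y))" for d
  proof -
    have "cg (SN B A) (DA d (mul x y)) (SW d (\<lambda>a b. mul (DA a x) (DA b y)))"
      by (rule DA_mul[OF m(1,2)])
    also have "cg (SN B A) (SW d (\<lambda>a b. mul (DA a x) (DA b y))) (SW d (\<lambda>a b. mul (scF (\<epsilon> a) x) (scF (\<epsilon> b) y)))"
      using assms
      by (intro SW_cong subgrp_SN SN_trans[OF mul_cg_left mul_cg_right])
        (auto simp: HF_def DA_free_on scF_free_on)
    also have "SW d (\<lambda>a b. mul (scF (\<epsilon> a) x) (scF (\<epsilon> b) y)) = SW d (\<lambda>a b. scF (\<epsilon> a) (scF (\<epsilon> b) (mul x y)))"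
      by (simp add: mul_scF scF_mult mult.commute)
    also have "cg (SN B A) (SW d (\<lambda>a b. scF (\<epsilon> a) (scF (\<epsilon> b) (mul x y)))) (scF (\<epsilon> d) (mul x y))"
      by (intro SW_counit_left kscal_scF klin_scF m)
    finally show ?thesis .
  qed
  then show ?thesis using m by (simp add: HF_def)
qed

lemma scF_HF: "x \<in> HF \<Longrightarrow> scF c x \<in> HF"
proof -
  assume x: "x \<in> HF"
  have "cg (SN B A) (DA d (frag_of (scL c 1, 1))) (scF (\<epsilon> d) (frag_of (scL c 1, 1)))" for d
    using DA_left[of "scL c 1" d] by (simp add: As act_scale_right act_unit scF_frag_of flip: scL_simps)
      (simp add: mult.commute)
  then have "frag_of (scL c 1, 1) \<in> HF" by (simp add: HF_def As)
  from HF_mul[OF this x] show ?thesis by (simp add: scF_def)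
qed

lemma canonical_map_SC:
  assumes "B \<subseteq> B'" "A \<subseteq> A'" "x \<in> free_on A"
  shows "canonical_map B' A' (SC B A x) = SC B' A' x"
proof -
  have "balanced (ring_on B) (mod_on (*) A) (mod_on (*) A) (SN B' A') (\<lambda>a b. frag_of (a, b))"
    by (simp add: balanced_def SN_frag_add SN_frag_balance subsetD[OF assms(1)] subsetD[OF assms(2)])
  then have "canonical_map B' A' (SC B A x) = SC B' A' (ext (\<lambda>(a, b). frag_of (a, b)) x)"
    unfolding canonical_map_def using assms
    by (intro tensor_lift_tensor add_closed_A) (auto simp: pure_tensor_def free_on_def keys_frag_of)
  also have "ext (\<lambda>(a, b). frag_of (a, b)) x = x"
    by (rule additive_frag_eqI[of "ext (\<lambda>(a, b). frag_of (a, b))" "\<lambda>x. x"]) auto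
  finally show ?thesis .
qed

lemma subgrp_HF: "subgrp HF"
  by (simp add: subgrp_def HF_0 HF_diff)

section \<open>Exchange of the factors, and the action of \<open>D\<close> on multiples of
  constants\<close>

lemma swapF_SN: "x \<in> SN B A \<Longrightarrow> swapF x \<in> SN B A"
  unfolding swapF_def
  by (rule ext_tensor_null[OF subgrp_SN])
    (use SN_frag_add[of _ A _ _ B] SN_sym[OF SN_frag_balance[of _ B _ A]] in \<open>auto simp: balanced_def\<close>)

lemma swapF_cg: "cg (SN B A) x y \<Longrightarrow> cg (SN B A) (swapF x) (swapF y)"
  using swapF_SN[of "x - y"] by (simp add: cg_def swapF_diff)

lemma swapF_free_on: "x \<in> free_on A \<Longrightarrow> swapF x \<in> free_on A"
  by (induction x rule: free_on_induct)
    (auto simp: swapF_diff subgrp_0[OF subgrp_free_on] subgrp_diff[OF subgrp_free_on])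

lemma DA_swapF: "x \<in> free_on A \<Longrightarrow> cg (SN B A) (DA d (swapF x)) (swapF (DA d x))"
proof (induction x rule: free_on_induct)
  case (one y z)
  have "swapF (DA d (frag_of (y, z))) = SW d (\<lambda>a b. frag_of (act b z, act a y))"
    by (simp add: DA_frag_of SW_additive[of swapF, OF swapF_add])
  then show ?case
    using SW_comm[OF kscal_scF bilin_act, of z y d] one by (simp add: DA_frag_of)
qed (simp_all add: SN_refl swapF_diff DA_diff SN_diff)

lemma scF_swapF: "x \<in> free_on A \<Longrightarrow> cg (SN B A) (swapF (scF c x)) (scF c (swapF x))"
proof (induction x rule: free_on_induct)
  case (one y z)
  then show ?case
    using SN_sym[OF SN_frag_balance[OF scL_one_mem, of z A y c]] by (simp add: scF_frag_of scL_one_mult)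
qed (simp_all add: SN_refl swapF_diff scF_diff SN_diff)

lemma swapF_HF: "x \<in> HF \<Longrightarrow> swapF x \<in> HF"
  using SN_trans[OF DA_swapF SN_trans[OF swapF_cg scF_swapF]] swapF_free_on by (simp add: HF_def)

lemma klin_mul:
  assumes "klin (SN B A) scF \<phi>" "h \<in> free_on A"
  shows "klin (SN B A) scF (\<lambda>a. mul (\<phi> a) h)"
  unfolding klin_def mul_add_left[symmetric] mul_scF(1)[symmetric]
  using assms(1) by (auto simp: klin_def intro!: mul_cg_left assms(2))

text \<open>In the product rule the second part acts on \<open>h\<close> through the counit and is
  absorbed. Consequently the coefficient vectors of the relations between given constants form a
  \<open>D\<close>-stable set.\<close>

lemma DA_mul_HF:
  assumes y: "y \<in> A" and h: "h \<in> HF"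
  shows "cg (SN B A) (DA d (mul (frag_of (y, 1)) h)) (mul (frag_of (act d y, 1)) h)"
proof -
  have hf: "h \<in> free_on A" using h by (rule HF_free_on)
  have "cg (SN B A) (DA d (mul (frag_of (y, 1)) h)) (SW d (\<lambda>a b. mul (DA a (frag_of (y, 1))) (DA b h)))"
    using y hf by (intro DA_mul) (simp_all add: As)
  also have "cg (SN B A) (SW d (\<lambda>a b. mul (DA a (frag_of (y, 1))) (DA b h)))
      (SW d (\<lambda>a b. mul (frag_of (act a y, 1)) (scF (\<epsilon> b) h)))"
    using y h hf by (intro SW_cong subgrp_SN SN_trans[OF mul_cg_left mul_cg_right] DA_left)
      (auto simp: HF_def DA_free_on As)
  also have "SW d (\<lambda>a b. mul (frag_of (act a y, 1)) (scF (\<epsilon> b) h))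
      = SW d (\<lambda>a b. scF (\<epsilon> b) (mul (frag_of (act a y, 1)) h))"
    by (simp add: mul_scF)
  also have "cg (SN B A) (SW d (\<lambda>a b. scF (\<epsilon> b) (mul (frag_of (act a y, 1)) h))) (mul (frag_of (act d y, 1)) h)"
    using y by (intro SW_counit_right kscal_scF klin_mul klin_left plin_act hf) (simp_all add: As)
  finally show ?thesis .
qed

end

section \<open>Consequences of differential simplicity\<close>

lemma ring_ring_on:
  fixes B :: "'l::comm_ring_1 set"
  assumes "0 \<in> B" "1 \<in> B" "\<And>x y. x \<in> B \<Longrightarrow> y \<in> B \<Longrightarrow> x + y \<in> B" "\<And>x y. x \<in> B \<Longrightarrow> y \<in> B \<Longrightarrow> x * y \<in> B"
    "\<And>x. x \<in> B \<Longrightarrow> - x \<in> B"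
  shows "ring (ring_on B)"
proof (rule ringI)
  show "abelian_group (ring_on B)"
    by (rule abelian_groupI) (auto simp: assms ac_simps intro!: bexI[of _ "- _"])
qed (auto intro!: monoidI simp: assms algebra_simps)

context cocommutative_module_algebra
begin

lemma ideal_ring_onI:
  assumes B: "D_subalgebra scL act B" and "J \<subseteq> B" "0 \<in> J"
    and add: "\<And>x y. x \<in> J \<Longrightarrow> y \<in> J \<Longrightarrow> x + y \<in> J" and mult: "\<And>b x. b \<in> B \<Longrightarrow> x \<in> J \<Longrightarrow> b * x \<in> J"
  shows "ideal J (ring_on B)"
proof (rule idealI)
  show R: "ring (ring_on B)" by (rule ring_ring_on) (simp_all add: D_subalgebraD[OF B])
  have neg: "- x \<in> J" if "x \<in> J" for x
    using mult[of "- 1" x] that by (simp add: D_subalgebraD[OF B])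
  show "subgroup J (add_monoid (ring_on B))"
  proof (rule group.subgroupI)
    show "group (add_monoid (ring_on B))"
      using R by (intro abelian_group.a_group ring.is_abelian_group)
    fix x assume x: "x \<in> J"
    have "\<ominus>\<^bsub>ring_on B\<^esub> x = - x"
      using x \<open>J \<subseteq> B\<close> R by (intro abelian_group.minus_equality ring.is_abelian_group) (auto simp: D_subalgebraD[OF B])
    then show "inv\<^bsub>add_monoid (ring_on B)\<^esub> x \<in> J" using neg[OF x] by (simp add: a_inv_def)
  qed (use assms in auto)
  fix a x assume "a \<in> J" "x \<in> carrier (ring_on B)"
  then show "x \<otimes>\<^bsub>ring_on B\<^esub> a \<in> J" "a \<otimes>\<^bsub>ring_on B\<^esub> x \<in> J"
    using mult[of x a] by (simp_all add: mult.commute)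
qed

text \<open>
  A vector of minimal support among the nonzero vectors of \<open>R\<close>, normalised at one coordinate, has
  constant entries: \<open>D\<close> maps it, up to scalars, to vectors of smaller support.
\<close>

lemma constant_vector:
  fixes R :: "(nat \<Rightarrow> 'l) set"
  assumes simple: "AS_subalgebra scL act (UNIV :: 'l set)"
    and cons: "constants \<epsilon> scL act UNIV = range (\<lambda>c. scL c 1)"
    and add: "\<And>r r'. r \<in> R \<Longrightarrow> r' \<in> R \<Longrightarrow> (\<lambda>i. r i + r' i) \<in> R"
    and mult: "\<And>l r. r \<in> R \<Longrightarrow> (\<lambda>i. l * r i) \<in> R"
    and act: "\<And>d r. r \<in> R \<Longrightarrow> (\<lambda>i. act d (r i)) \<in> R"
    and r: "r \<in> R" "r i0 \<noteq> 0" "finite {i. r i \<noteq> 0}"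
  obtains c j where "(\<lambda>i. scL (c i) 1) \<in> R" "c j = 1" "\<And>i. c i \<noteq> 0 \<Longrightarrow> r i \<noteq> 0"
proof -
  define supp :: "(nat \<Rightarrow> 'l) \<Rightarrow> nat set" where "supp r = {i. r i \<noteq> 0}" for r
  have "\<exists>s. (s \<in> R \<and> supp s \<subseteq> supp r \<and> supp s \<noteq> {}) \<and>
      (\<forall>s'. s' \<in> R \<and> supp s' \<subseteq> supp r \<and> supp s' \<noteq> {} \<longrightarrow> card (supp s) \<le> card (supp s'))"
    using r by (intro ex_has_least_nat[of _ r]) (auto simp: supp_def)
  then obtain s where s: "s \<in> R" "supp s \<subseteq> supp r" "supp s \<noteq> {}"
    and min: "\<And>s'. s' \<in> R \<Longrightarrow> supp s' \<subseteq> supp r \<Longrightarrow> supp s' \<noteq> {} \<Longrightarrow> card (supp s) \<le> card (supp s')"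
    by blast
  obtain j where j: "j \<in> supp s" using s(3) by blast
  have fin: "finite (supp s)" using s(2) r(3) finite_subset by (auto simp: supp_def)
  \<comment> \<open>The possible entries at \<open>j\<close> form a \<open>D\<close>-stable ideal of
    \<open>L\<close>, nonzero because of \<open>s\<close>. By simplicity it contains 1, which yields
    the normalised vector \<open>u\<close>.\<close>
  define J where "J = {s' j |s'. s' \<in> R \<and> supp s' \<subseteq> supp s}"
  have "ideal J (ring_on UNIV)"
  proof (rule ideal_ring_onI[OF D_subalgebra_UNIV])
    show "0 \<in> J"
      unfolding J_def using mult[OF s(1), of 0] by (auto simp: supp_def intro!: exI[of _ "\<lambda>_. 0"])
    show "x + y \<in> J" if "x \<in> J" "y \<in> J" for x y
    proof -
      obtain s1 s2 where "s1 \<in> R" "supp s1 \<subseteq> supp s" "x = s1 j" "s2 \<in> R" "supp s2 \<subseteq> supp s" "y = s2 j"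
        using \<open>x \<in> J\<close> \<open>y \<in> J\<close> by (auto simp: J_def)
      then show ?thesis
        unfolding J_def using add by (auto simp: supp_def subset_iff intro!: exI[of _ "\<lambda>i. s1 i + s2 i"]) force
    qed
    show "b * x \<in> J" if "x \<in> J" for b x
    proof -
      obtain s1 where "s1 \<in> R" "supp s1 \<subseteq> supp s" "x = s1 j" using \<open>x \<in> J\<close> by (auto simp: J_def)
      then show ?thesis
        unfolding J_def using mult by (auto simp: supp_def subset_iff intro!: exI[of _ "\<lambda>i. b * s1 i"]) force
    qed
  qed simp
  moreover have "act d x \<in> J" if "x \<in> J" for d x
  proof -
    obtain s1 where "s1 \<in> R" "supp s1 \<subseteq> supp s" "x = s1 j" using \<open>x \<in> J\<close> by (auto simp: J_def)
    then show ?thesis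
      unfolding J_def using act by (auto simp: supp_def subset_iff intro!: exI[of _ "\<lambda>i. act d (s1 i)"]) force
  qed
  moreover have "s j \<in> J" "s j \<noteq> 0" using s j by (auto simp: J_def supp_def)
  ultimately have "J = UNIV" using simple by (fastforce simp: AS_subalgebra_def)
  then have "1 \<in> J" by simp
  then obtain u where u: "u \<in> R" "supp u \<subseteq> supp s" "u j = 1" by (force simp: J_def)
  have "u i \<in> constants \<epsilon> scL act UNIV" for i
  proof -
    have "act d (u i) = scL (\<epsilon> d) (u i)" for d
    proof (rule ccontr)
      assume neq: "act d (u i) \<noteq> scL (\<epsilon> d) (u i)"
      \<comment> \<open>The defect of constancy of \<open>u\<close> under \<open>d\<close>. It
        vanishes at \<open>j\<close>, where \<open>u\<close> is 1, so its support is strictly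
        smaller than that of \<open>s\<close>; minimality forces it to be zero.\<close>
      define v where "v i = act d (u i) + - scL (\<epsilon> d) 1 * u i" for i
      have "v \<in> R" unfolding v_def by (intro add act mult u)
      moreover have vs: "supp v \<subseteq> supp s - {j}"
        using u(2,3) by (force simp: v_def supp_def act_unit)
      moreover have "i \<in> supp v" using neq by (simp add: v_def supp_def scL_one_mult)
      ultimately have "card (supp s) \<le> card (supp v)" using s(2) by (intro min) auto
      moreover have "card (supp v) < card (supp s)"
        using vs j fin by (intro psubset_card_mono) auto
      ultimately show False by simp
    qed
    then show ?thesis by (simp add: constants_def)
  qed
  then have "\<forall>i. \<exists>c. u i = scL c 1" using cons by auto
  then obtain c0 where c0: "\<And>i. u i = scL (c0 i) 1" by metis
  have one_neq: "(1 :: 'l) \<noteq> 0" using r(2) by (metis mult_1 mult_zero_left)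
  \<comment> \<open>\<open>c0\<close> is an arbitrary choice of scalars; where \<open>u\<close>
    vanishes and at \<open>j\<close> the values are set directly to 0 and 1, as the conclusion
    demands.\<close>
  define c where "c i = (if u i = 0 then 0 else if i = j then 1 else c0 i)" for i
  have "u i = scL (c i) 1" for i using c0[of i] u(3) by (auto simp: c_def scL_simps(4))
  then have "(\<lambda>i. scL (c i) 1) \<in> R" using u(1) by (metis (no_types, lifting) ext)
  moreover have "c j = 1" using u(3) one_neq by (simp add: c_def)
  moreover have "r i \<noteq> 0" if "c i \<noteq> 0" for i
    using that u(2) s(2) by (auto simp: c_def supp_def split: if_splits)
  ultimately show thesis using that by blast
qed

lemma antipode_SW:
  assumes "is_antipode D \<Delta> \<epsilon> S"
  shows "SW d (\<lambda>a b. a * S b) = scD (\<epsilon> d) 1"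
proof -
  have "balanced base_field D D {0} (\<lambda>a b. a * S b)"
    using assms smult_mult_left smult_mult_right
    by (simp add: balanced_def is_antipode_def distrib_left distrib_right)
  from tensor_lift_type[of D, OF _ _ _ this, of "fr (sw d)"]
  show ?thesis using assms by (simp add: is_antipode_def SW_def flip: sw)
qed

text \<open>The Leibniz rule turns the right-hand side into a threefold sum. After reassociation the
  last two parts meet as \<open>p * S q\<close>, which the antipode axiom collapses to a
  counit.\<close>

lemma act_mult_antipode:
  assumes S: "is_antipode D \<Delta> \<epsilon> S"
  shows "act d b * x = SW d (\<lambda>u v. act u (b * act (S v) x))"
proof -
  have S_lin: "S (u + v) = S u + S v" "S (scD c u) = scD c (S u)" for u v c
    using S by (simp_all add: is_antipode_def)
  define t where "t u v w = act u b * act v (act (S w) x)" for u v w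
  have "trilin {0} scL t"
    by (simp add: trilin_def bilin_def klin_def t_def act_add_left act_add_right act_scale_left
      act_scale_right S_lin scL_simps mult_scL distrib_left distrib_right)
  from SW_assoc[OF kscal_scL this]
  have "SW d (\<lambda>u v. act u (b * act (S v) x)) = SW d (\<lambda>u v. SW v (t u))"
    by (simp add: act_prod_SW[of _ b] t_def)
  also have "\<dots> = SW d (\<lambda>u v. scL (\<epsilon> v) (act u b * x))"
  proof -
    have "SW v (t u) = scL (\<epsilon> v) (act u b * x)" for u v
    proof -
    have "SW v (t u) = SW v (\<lambda>p q. act u b * act (p * S q) x)" by (simp add: t_def[abs_def] act_mult)
    also have "\<dots> = act u b * act (SW v (\<lambda>p q. p * S q)) x"
      by (rule SW_additive[symmetric]) (simp add: act_add_left distrib_left)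
    also have "\<dots> = scL (\<epsilon> v) (act u b * x)"
      by (simp add: antipode_SW[OF S] act_scale_left act_one mult_scL)
    finally show ?thesis .
    qed
    then show ?thesis by simp
  qed
  also have "SW d (\<lambda>u v. scL (\<epsilon> v) (act u b * x)) = act d b * x"
    using SW_counit_right[OF kscal_scL, of "\<lambda>u. act u b * x" d]
    by (simp add: klin_def act_add_left act_scale_left scL_simps distrib_right)
  finally show ?thesis by simp
qed

end

text \<open>Otherwise every nonzero element of \<open>F\<close> would have a nonzero multiple of
  which it is not itself a multiple, and dependent choice would produce a strictly descending chain
  of principal ideals. The last property of \<open>a\<close> says that the ideal it generates is
  minimal.\<close>

lemma artinian_minimal_multiple:
  fixes F :: "'l::comm_ring_1 set"
  assumes art: "artinian_ring (ring_on F)" and ideal: "\<And>a. a \<in> F \<Longrightarrow> ideal ((\<lambda>f. f * a) ` F) (ring_on F)"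
    and F: "1 \<in> F" "1 \<noteq> (0 :: 'l)" "\<And>x y. x \<in> F \<Longrightarrow> y \<in> F \<Longrightarrow> x * y \<in> F"
  obtains a where "a \<in> F" "a \<noteq> 0" "\<And>f. f \<in> F \<Longrightarrow> f * a \<noteq> 0 \<Longrightarrow> \<exists>g\<in>F. g * f * a = a"
proof -
  have "\<exists>a\<in>F. a \<noteq> 0 \<and> (\<forall>f\<in>F. f * a \<noteq> 0 \<longrightarrow> (\<exists>g\<in>F. g * f * a = a))"
  proof (rule ccontr)
    assume neg: "\<not> ?thesis"
    have step: "\<exists>b. (b \<in> F \<and> b \<noteq> 0) \<and> (\<exists>f\<in>F. b = f * a) \<and> a \<notin> (\<lambda>g. g * b) ` F"
      if a: "a \<in> F \<and> a \<noteq> 0" for a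
    proof -
      obtain f where f: "f \<in> F" "f * a \<noteq> 0" "\<And>g. g \<in> F \<Longrightarrow> g * f * a \<noteq> a" using neg a by blast
      show ?thesis using f a F(3)
        by (intro exI[of _ "f * a"]) (auto simp: mult.assoc, metis)
    qed
    have "\<exists>s. \<forall>n :: nat. (s n \<in> F \<and> s n \<noteq> 0) \<and>
        ((\<exists>f\<in>F. s (Suc n) = f * s n) \<and> s n \<notin> (\<lambda>g. g * s (Suc n)) ` F)"
      by (rule dependent_nat_choice[of "\<lambda>_ a. a \<in> F \<and> a \<noteq> 0"
          "\<lambda>_ a b. (\<exists>f\<in>F. b = f * a) \<and> a \<notin> (\<lambda>g. g * b) ` F"]) (use step F in blast)+
    then obtain s :: "nat \<Rightarrow> 'l" where s: "\<And>n. s n \<in> F \<and> s n \<noteq> 0"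
      "\<And>n. (\<exists>f\<in>F. s (Suc n) = f * s n) \<and> s n \<notin> (\<lambda>g. g * s (Suc n)) ` F" by blast
    have dec: "(\<lambda>f. f * s (Suc n)) ` F \<subseteq> (\<lambda>f. f * s n) ` F" for n
    proof -
      obtain f where f: "f \<in> F" "s (Suc n) = f * s n" using s(2) by blast
      then show ?thesis by (auto simp: mult.assoc[symmetric] simp del: mult.assoc intro!: imageI F)
    qed
    have "\<exists>N. \<forall>n\<ge>N. (\<lambda>f. f * s n) ` F = (\<lambda>f. f * s N) ` F"
      by (rule art[unfolded artinian_ring_def, rule_format]) (use ideal s(1) dec in simp)
    then obtain N where N: "\<And>n. n \<ge> N \<Longrightarrow> (\<lambda>f. f * s n) ` F = (\<lambda>f. f * s N) ` F" by blast
    have "s N \<in> (\<lambda>f. f * s N) ` F" using F(1) by (metis image_eqI mult_1)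
    then have "s N \<in> (\<lambda>f. f * s (Suc N)) ` F" using N[of "Suc N"] by simp
    then show False using s(2) by blast
  qed
  then show thesis using that by blast
qed

context tensor_square
begin

text \<open>Isbell's dominion of \<open>B\<close> in \<open>L\<close>: the elements on which any two
  ring homomorphisms out of \<open>L\<close> agree as soon as they agree on \<open>B\<close>. The
  tensor square is that of all of \<open>L\<close>, whatever \<open>A\<close> is.\<close>

definition dominion :: "'l set" where
  "dominion = {x. cg (SN B UNIV) (frag_of (1, x)) (frag_of (x, 1))}"

text \<open>
  The annihilator of \<open>a\<close> is a maximal ideal of \<open>B\<close>, so \<open>a L\<close> is a vector space over the residue field.
  If \<open>a x\<close> were not in the line \<open>a B\<close>, some functional on \<open>a L\<close> would vanish on that line
  but not at \<open>a x\<close>; it would separate \<open>1 \<otimes> x\<close> from \<open>x \<otimes> 1\<close>. The functional is given by a maximal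
  submodule \<open>U\<close> of \<open>L\<close> avoiding \<open>x\<close>.
\<close>

lemma minimal_multiple_dominion:
  assumes a: "a \<in> B" "a \<noteq> 0" "\<And>f. f \<in> B \<Longrightarrow> f * a \<noteq> 0 \<Longrightarrow> \<exists>g\<in>B. g * f * a = a"
    and x: "x \<in> dominion"
  shows "a * x \<in> B"
proof (rule ccontr)
  assume nx: "a * x \<notin> B"
  define \<U> where "\<U> = {U. (\<forall>u\<in>U. \<forall>v\<in>U. u + v \<in> U) \<and> (\<forall>f\<in>B. \<forall>u\<in>U. f * u \<in> U) \<and>
    (\<forall>y. a * y \<in> (*) a ` B \<longrightarrow> y \<in> U) \<and> x \<notin> U}"
  have "\<exists>U\<in>\<U>. \<forall>V\<in>\<U>. U \<subseteq> V \<longrightarrow> V = U"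
  proof (rule subset_Zorn_nonempty)
    have "a * (u + v) \<in> (*) a ` B" if uv: "a * u \<in> (*) a ` B" "a * v \<in> (*) a ` B" for u v
    proof -
      obtain f g where "f \<in> B" "g \<in> B" "a * u = a * f" "a * v = a * g" using uv by auto
      then show ?thesis by (intro image_eqI[of _ _ "f + g"]) (simp_all add: distrib_left Bs)
    qed
    moreover have "a * (f * u) \<in> (*) a ` B" if fu: "f \<in> B" "a * u \<in> (*) a ` B" for f u
    proof -
      obtain g where "g \<in> B" "a * u = a * g" using fu by auto
      then show ?thesis using fu
        by (intro image_eqI[of _ _ "f * g"]) (simp_all add: mult.left_commute[of a] Bs)
    qed
    moreover have "a * x \<notin> (*) a ` B" using nx a(1) Bs(4) by auto
    ultimately have "{y. a * y \<in> (*) a ` B} \<in> \<U>" by (simp add: \<U>_def)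
    then show "\<U> \<noteq> {}" by blast
    fix \<C> assume "\<C> \<noteq> {}" and ch: "subset.chain \<U> \<C>"
    then have sub: "\<C> \<subseteq> \<U>" and lin: "\<And>U V. U \<in> \<C> \<Longrightarrow> V \<in> \<C> \<Longrightarrow> U \<subseteq> V \<or> V \<subseteq> U"
      by (auto simp: subset_chain_def)
    have "u + v \<in> \<Union>\<C>" if uv: "u \<in> \<Union>\<C>" "v \<in> \<Union>\<C>" for u v
    proof -
      obtain U V where "U \<in> \<C>" "u \<in> U" "V \<in> \<C>" "v \<in> V" using uv by blast
      then have "\<exists>W\<in>\<C>. u \<in> W \<and> v \<in> W" using lin[of U V] by blast
      then obtain W where W: "W \<in> \<C>" "u \<in> W" "v \<in> W" by blast
      then have "W \<in> \<U>" using sub by blast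
      then have "u + v \<in> W" using W by (simp add: \<U>_def)
      then show ?thesis using W by blast
    qed
    then show "\<Union>\<C> \<in> \<U>" using sub \<open>\<C> \<noteq> {}\<close> unfolding \<U>_def by blast
  qed
  then obtain U where U: "U \<in> \<U>" and max: "\<And>V. V \<in> \<U> \<Longrightarrow> U \<subseteq> V \<Longrightarrow> V = U" by blast
  have add: "u \<in> U \<Longrightarrow> v \<in> U \<Longrightarrow> u + v \<in> U" and mult: "f \<in> B \<Longrightarrow> u \<in> U \<Longrightarrow> f * u \<in> U"
    and base: "a * y \<in> (*) a ` B \<Longrightarrow> y \<in> U" and xU: "x \<notin> U" for u v f y
    using U by (auto simp: \<U>_def)
  have ann: "y \<in> U" if "a * y = 0" for y
  proof (rule base)
    show "a * y \<in> (*) a ` B" unfolding that using Bs(1) by (rule rev_image_eqI) simp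
  qed
  have diff: "u - v \<in> U" if "u \<in> U" "v \<in> U" for u v
    using add[OF that(1) mult[of "- 1", OF _ that(2)]] by (simp add: Bs)
  \<comment> \<open>By maximality \<open>L = U + B x\<close>: for \<open>y\<close> outside
    \<open>U\<close> the larger module \<open>U + B y\<close> must contain \<open>x\<close>, and the
    coefficient of \<open>y\<close> there is invertible modulo the annihilator of
    \<open>a\<close>.\<close>
  have ex: "\<exists>f\<in>B. y - f * x \<in> U" for y
  proof (cases "y \<in> U")
    case True
    then show ?thesis using Bs(1) by (intro bexI[of _ 0]) auto
  next
    case False
    define V where "V = {u + f * y |u f. u \<in> U \<and> f \<in> B}"
    have UV: "U \<subseteq> V" using Bs(1) by (force simp: V_def)
    have "0 \<in> U" using ann[of 0] by simp
    then have "y \<in> V" using Bs(2) by (force simp: V_def)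
    then have "V \<notin> \<U>" using max[OF _ UV] False by blast
    moreover have "p + q \<in> V" if "p \<in> V" "q \<in> V" for p q
    proof -
      obtain u f v g where "u \<in> U" "f \<in> B" "p = u + f * y" "v \<in> U" "g \<in> B" "q = v + g * y"
        using \<open>p \<in> V\<close> \<open>q \<in> V\<close> by (auto simp: V_def)
      then show ?thesis unfolding V_def
        by (intro CollectI exI[of _ "u + v"] exI[of _ "f + g"]) (auto simp: algebra_simps add Bs)
    qed
    moreover have "h * p \<in> V" if "p \<in> V" "h \<in> B" for p h
    proof -
      obtain u f where "u \<in> U" "f \<in> B" "p = u + f * y" using \<open>p \<in> V\<close> by (auto simp: V_def)
      then show ?thesis unfolding V_def using that
        by (intro CollectI exI[of _ "h * u"] exI[of _ "h * f"]) (auto simp: algebra_simps mult Bs)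
    qed
    moreover have "z \<in> V" if "a * z \<in> (*) a ` B" for z using base[OF that] UV by blast
    ultimately have "x \<in> V" unfolding \<U>_def by blast
    then obtain u f where f: "u \<in> U" "f \<in> B" "x = u + f * y" by (auto simp: V_def)
    have "f * a \<noteq> 0"
    proof
      assume "f * a = 0"
      then have "a * (f * y) = 0" by (metis mult.assoc mult.commute mult_zero_left)
      then show False using xU f add ann by blast
    qed
    then obtain g where g: "g \<in> B" "g * f * a = a" using a(3) f by blast
    have "a * (y - g * f * y) = 0" using g(2) by (simp add: algebra_simps) (metis mult.assoc mult.commute)
    then have "(y - g * f * y) - g * u \<in> U" by (intro diff ann mult g f)
    also have "(y - g * f * y) - g * u = y - g * x" by (simp add: f(3) algebra_simps)
    finally show ?thesis using g(1) by blast
  qed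
  \<comment> \<open>The coefficient of \<open>x\<close> is determined only modulo the annihilator of
    \<open>a\<close>, so its product with \<open>a\<close> is the well-defined quantity. Accordingly
    \<open>\<phi>\<close> is neither additive nor linear by itself, but \<open>\<phi> y * a\<close>
    is \<open>B\<close>-linear in \<open>y\<close>.\<close>
  have uniq: "f * a = g * a" if fg: "f \<in> B" "g \<in> B" "y - f * x \<in> U" "y - g * x \<in> U" for f g y
  proof (rule ccontr)
    assume "f * a \<noteq> g * a"
    then obtain h where h: "h \<in> B" "h * (f - g) * a = a"
      using a(3)[of "f - g"] fg by (auto simp: Bs left_diff_distrib)
    have "(y - g * x) - (y - f * x) = (f - g) * x" by (simp add: algebra_simps)
    then have "h * ((f - g) * x) \<in> U" using mult[OF h(1) diff[OF fg(4,3)]] by simp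
    moreover have "a * (x - h * (f - g) * x) = 0"
      using h(2) by (simp add: right_diff_distrib) (metis mult.assoc mult.commute)
    ultimately have "(x - h * (f - g) * x) + h * ((f - g) * x) \<in> U" using add ann by blast
    then show False using xU by (simp add: mult.assoc)
  qed
  define \<phi> where "\<phi> y = (SOME f. f \<in> B \<and> y - f * x \<in> U)" for y
  have \<phi>: "\<phi> y \<in> B" "y - \<phi> y * x \<in> U" for y
    using someI_ex[of "\<lambda>f. f \<in> B \<and> y - f * x \<in> U"] ex[of y] by (auto simp: \<phi>_def)
  have \<phi>I: "\<phi> y * a = f * a" if "f \<in> B" "y - f * x \<in> U" for f y
    using uniq[OF \<phi>(1) that(1) \<phi>(2) that(2)] .
  have \<phi>_add: "\<phi> (y + y') * a = (\<phi> y + \<phi> y') * a" for y y'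
  proof (rule \<phi>I)
    show "y + y' - (\<phi> y + \<phi> y') * x \<in> U" using add[OF \<phi>(2) \<phi>(2), of y y'] by (simp add: algebra_simps)
  qed (simp add: Bs \<phi>)
  have \<phi>_mult: "\<phi> (r * y) * a = r * \<phi> y * a" if "r \<in> B" for r y
  proof (rule \<phi>I)
    show "r * y - r * \<phi> y * x \<in> U" using mult[OF that \<phi>(2), of y] by (simp add: algebra_simps)
  qed (simp add: Bs \<phi> that)
  \<comment> \<open>This pairing takes the value 0 at \<open>1 \<otimes> x\<close>, because 1 lies
    in \<open>U\<close>, and the value \<open>a\<close> at \<open>x \<otimes> 1\<close>.\<close>
  have "balanced (ring_on B) (mod_on (*) UNIV) (mod_on (*) UNIV) {0} (\<lambda>y z. \<phi> y * a * z)"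
    using \<phi>_add \<phi>_mult by (simp add: balanced_def algebra_simps)
  from ext_tensor_null[OF subgrp_zero this] x
  have "\<phi> 1 * a * x = \<phi> x * a" by (fastforce simp: dominion_def cg_def)
  moreover have "\<phi> 1 * a = 0 * a" using base[OF imageI[OF Bs(2)]] Bs(1) by (intro \<phi>I) auto
  moreover have "\<phi> x * a = 1 * a" using ann[of 0] Bs by (intro \<phi>I) auto
  ultimately show False using a(2) by simp
qed

lemma dominion_subset:
  assumes AS: "AS_subalgebra scL act B"
  shows "dominion \<subseteq> B"
proof -
  interpret L: tensor_square scD \<Delta> \<epsilon> scL act B UNIV
    by unfold_locales (use B D_subalgebra_UNIV in auto)
  have one: "(1 :: 'l) \<noteq> 0"
  proof
    assume "(1 :: 'l) = 0"
    then have "x = 0" for x :: 'l by (metis mult_1 mult_zero_left)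
    then have "B = {0}" using Bs(1) by blast
    then show False using AS by (simp add: AS_subalgebra_def)
  qed
  have id: "ideal ((\<lambda>f. f * a) ` B) (ring_on B)" if "a \<in> B" for a
  proof (rule ideal_ring_onI[OF B])
    show "(\<lambda>f. f * a) ` B \<subseteq> B" using that by (auto simp: Bs)
    show "0 \<in> (\<lambda>f. f * a) ` B" using Bs(1) by (rule rev_image_eqI) simp
    show "u + v \<in> (\<lambda>f. f * a) ` B" if "u \<in> (\<lambda>f. f * a) ` B" "v \<in> (\<lambda>f. f * a) ` B" for u v
      using that by (auto simp: Bs distrib_right[symmetric] simp del: distrib_right)
    show "b * u \<in> (\<lambda>f. f * a) ` B" if "b \<in> B" "u \<in> (\<lambda>f. f * a) ` B" for b u
      using that by (auto simp: Bs mult.assoc[symmetric] simp del: mult.assoc)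
  qed
  have "artinian_ring (ring_on B)" using AS by (simp add: AS_subalgebra_def)
  then obtain a where a: "a \<in> B" "a \<noteq> 0" "\<And>f. f \<in> B \<Longrightarrow> f * a \<noteq> 0 \<Longrightarrow> \<exists>g\<in>B. g * f * a = a"
    using artinian_minimal_multiple[OF _ id Bs(2) one Bs(4)] by blast
  define J where "J = {b \<in> B. \<forall>x\<in>dominion. b * x \<in> B}"
  \<comment> \<open>On \<open>1 \<otimes> x\<close> and on \<open>x \<otimes> 1\<close> the diagonal
    action reduces to the action on \<open>x\<close>, so it preserves the defining
    congruence.\<close>
  have dom_act: "act d x \<in> dominion" if "x \<in> dominion" for d x
  proof -
    have "cg (SN B UNIV) (DA d (frag_of (1, x))) (DA d (frag_of (x, 1)))"
      using that by (intro L.DA_cg) (simp add: dominion_def)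
    then show ?thesis
      using SN_trans[OF SN_sym[OF L.DA_right]] SN_trans[OF _ L.DA_left] by (simp add: dominion_def)
  qed
  obtain S where S: "is_antipode D \<Delta> \<epsilon> S" using antipode by blast
  have "ideal J (ring_on B)"
    by (rule ideal_ring_onI[OF B]) (auto simp: J_def Bs distrib_right mult.assoc)
  moreover have "act d b \<in> J" if "b \<in> J" for d b
  proof -
    have "act d b * x \<in> B" if "x \<in> dominion" for x
      unfolding act_mult_antipode[OF S] using \<open>b \<in> J\<close> dom_act[OF that]
      by (intro SW_mem) (auto simp: subgrp_def J_def Bs)
    then show ?thesis using that by (auto simp: J_def Bs)
  qed
  moreover have "a \<in> J" using a minimal_multiple_dominion[OF a] by (simp add: J_def)
  ultimately have "J = B" using AS a(2) by (fastforce simp: AS_subalgebra_def)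
  then have "1 \<in> J" using Bs by simp
  then show ?thesis by (auto simp: J_def)
qed

lemma dominion_eq: "AS_subalgebra scL act B \<Longrightarrow> dominion = B"
  using dominion_subset SN_sym[OF SN_frag_balance[of _ B 1 UNIV 1]] by (fastforce simp: dominion_def)

end

section \<open>Picard-Vessiot extensions\<close>

locale picard_vessiot = cocommutative_module_algebra scD \<Delta> \<epsilon> scL act
  for scD :: "'k::field \<Rightarrow> 'd::ring_1 \<Rightarrow> 'd" and \<Delta> and \<epsilon>
    and scL :: "'k \<Rightarrow> 'l::comm_ring_1 \<Rightarrow> 'l" and act :: "'d \<Rightarrow> 'l \<Rightarrow> 'l" +
  fixes K A F :: "'l set"
  assumes PV: "PV_extension \<Delta> \<epsilon> scL act K A"
    and const_L: "constants \<epsilon> scL act UNIV = range (\<lambda>c. scL c 1)"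
    and AS_F: "AS_subalgebra scL act F" and KF: "K \<subseteq> F"

text \<open>Three tensor squares are in play: \<open>KA\<close> carries \<open>H\<close>,
  \<open>FL\<close> decides membership in \<open>F\<close>, and \<open>KL\<close> serves to unfold
  \<open>galois_ideal\<close>, whose definition passes through
  \<open>L \<otimes>\<^sub>K L\<close>.\<close>

sublocale picard_vessiot \<subseteq> KA: tensor_square scD \<Delta> \<epsilon> scL act K A
  using PV by unfold_locales (simp_all add: PV_extension_def AS_subalgebra_def)

sublocale picard_vessiot \<subseteq> FL: tensor_square scD \<Delta> \<epsilon> scL act F UNIV
  using AS_F by unfold_locales (simp_all add: AS_subalgebra_def D_subalgebra_UNIV)

sublocale picard_vessiot \<subseteq> KL: tensor_square scD \<Delta> \<epsilon> scL act K UNIV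
  by unfold_locales (simp_all add: KA.B D_subalgebra_UNIV)

context picard_vessiot
begin

abbreviation H where "H \<equiv> PV_hopf \<Delta> \<epsilon> scL act K A"
abbreviation NF where "NF \<equiv> SN F UNIV"
abbreviation NK where "NK \<equiv> SN K A"

lemma AS_L: "AS_subalgebra scL act (UNIV :: 'l set)"
  using PV by (simp add: PV_extension_def)

lemma NK_NF: "NK \<subseteq> NF"
  by (rule SN_mono) (simp_all add: KF)

lemma cg_NK_NF: "cg NK x y \<Longrightarrow> cg NF x y"
  using NK_NF by (auto simp: cg_def)

lemma HF_KA_FL: "x \<in> KA.HF \<Longrightarrow> x \<in> FL.HF"
  by (simp add: KA.HF_def FL.HF_def cg_NK_NF)

text \<open>
  The characters of \<open>H\<close> that kill the Hopf ideal of \<open>F\<close>, as functions of representatives; their values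
  outside \<open>HF\<close> are irrelevant.
\<close>

definition galois_char :: "(('l \<times> 'l \<Rightarrow>\<^sub>0 int) \<Rightarrow> 'k) \<Rightarrow> bool" where
  "galois_char G \<longleftrightarrow> (\<forall>x\<in>KA.HF. \<forall>y\<in>KA.HF. G (x + y) = G x + G y \<and> G (mul x y) = G x * G y) \<and>
    G (frag_of (1, 1)) = 1 \<and> (\<forall>c. \<forall>x\<in>KA.HF. G (scF c x) = c * G x) \<and> (\<forall>x\<in>KA.HF. x \<in> NF \<longrightarrow> G x = 0)"

lemma galois_charD:
  assumes "galois_char G"
  shows "x \<in> KA.HF \<Longrightarrow> y \<in> KA.HF \<Longrightarrow> G (x + y) = G x + G y"
    "x \<in> KA.HF \<Longrightarrow> y \<in> KA.HF \<Longrightarrow> G (mul x y) = G x * G y"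
    "G (frag_of (1, 1)) = 1" "x \<in> KA.HF \<Longrightarrow> G (scF c x) = c * G x"
    "x \<in> KA.HF \<Longrightarrow> x \<in> NF \<Longrightarrow> G x = 0"
  using assms by (simp_all add: galois_char_def)

lemma galois_char_0: "galois_char G \<Longrightarrow> G 0 = 0"
  by (rule galois_charD(5)) (simp_all add: KA.HF_0 subgrp_0[OF subgrp_SN])

lemma galois_char_uminus: "galois_char G \<Longrightarrow> x \<in> KA.HF \<Longrightarrow> G (- x) = - G x"
  using galois_charD(1)[of G x "- x"] galois_char_0[of G] KA.HF_uminus[of x] by (simp add: eq_neg_iff_add_eq_0 add.commute)

lemma galois_char_diff: "galois_char G \<Longrightarrow> x \<in> KA.HF \<Longrightarrow> y \<in> KA.HF \<Longrightarrow> G (x - y) = G x - G y"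
  using galois_charD(1)[of G x "- y"] galois_char_uminus[of G y] KA.HF_uminus[of y] by simp

lemma galois_char_cg: "galois_char G \<Longrightarrow> x \<in> KA.HF \<Longrightarrow> y \<in> KA.HF \<Longrightarrow> cg NF x y \<Longrightarrow> G x = G y"
  using galois_char_diff[of G x y] galois_charD(5)[of G "x - y"] KA.HF_diff[of x y] by (simp add: cg_def)

lemma galois_char_sum: "galois_char G \<Longrightarrow> (\<And>i. i \<in> P \<Longrightarrow> x i \<in> KA.HF) \<Longrightarrow> G (sum x P) = (\<Sum>i\<in>P. G (x i))"
  by (induction P rule: infinite_finite_induct)
    (auto simp: galois_char_0 galois_charD(1) subgrp_sum[OF KA.subgrp_HF])

lemma scL_sum: "scL c (sum f P) = (\<Sum>i\<in>P. scL c (f i))" and scL_sum_scalar: "scL (sum g P) x = (\<Sum>i\<in>P. scL (g i) x)"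
  by (induction P rule: infinite_finite_induct) (simp_all add: scL_simps)

lemma scL_diff: "scL c (x - y) = scL c x - scL c y" "scL (c - c') x = scL c x - scL c' x"
  using scL_simps(1)[of c "x - y" y] scL_simps(2)[of "c - c'" c' x] by (simp_all add: algebra_simps)

lemma FL_frag_diff: "cg NF (mul (frag_of (a - b, 1)) h) (mul (frag_of (a, 1)) h - mul (frag_of (b, 1)) h)"
proof -
  have "cg NF (frag_of (a, 1)) (frag_of (a - b, 1) + frag_of (b, 1))"
    using SN_frag_add(1)[of "a - b" UNIV b 1 F] by simp
  then have "cg NF (mul (frag_of (a, 1)) h) (mul (frag_of (a - b, 1) + frag_of (b, 1)) h)"
    by (intro FL.mul_cg_left) simp_all
  then show ?thesis using SN_sym by (fastforce simp: mul_add_left cg_def algebra_simps)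
qed

lemma mul_scF_frag: "mul (frag_of (scL c b, 1)) h = mul (frag_of (b, 1)) (scF c h)"
  by (simp add: scF_def mul_assoc[symmetric] mult_scL)

text \<open>Constants of \<open>L \<otimes>\<^sub>F L\<close> that are independent over \<open>k\<close> are independent over \<open>L\<close>.\<close>

lemma galois_char_relation:
  fixes b :: "nat \<Rightarrow> 'l" and h :: "nat \<Rightarrow> ('l \<times> 'l \<Rightarrow>\<^sub>0 int)"
  assumes G: "galois_char G" and h: "\<And>i. h i \<in> KA.HF"
    and rel: "(\<Sum>i<n. mul (frag_of (b i, 1)) (h i)) \<in> NF"
  shows "(\<Sum>i<n. scL (G (h i)) (b i)) = 0"
  using rel
proof (induction "card {i. i < n \<and> b i \<noteq> 0}" arbitrary: b rule: less_induct)
  case less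
  show ?case
  proof (cases "\<exists>i0<n. b i0 \<noteq> 0")
    case False
    then show ?thesis by (intro sum.neutral) auto
  next
    case True
    then obtain i0 where i0: "i0 < n" "b i0 \<noteq> 0" by blast
    define R where "R = {r :: nat \<Rightarrow> 'l. (\<Sum>i<n. mul (frag_of (r i, 1)) (h i)) \<in> NF}"
    \<comment> \<open>Only the first \<open>n\<close> coefficients enter the relation; setting the
      others to 0 makes the support finite.\<close>
    define r where "r i = (if i < n then b i else 0)" for i
    have rR: "r \<in> R" using less.prems by (simp add: R_def r_def)
    obtain c j where c: "(\<lambda>i. scL (c i) 1) \<in> R" "c j = 1" "\<And>i. c i \<noteq> 0 \<Longrightarrow> r i \<noteq> 0"
    proof (rule constant_vector[OF AS_L const_L, of R r i0])
      fix r r' :: "nat \<Rightarrow> 'l" assume r: "r \<in> R" "r' \<in> R"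
      have "cg NF (\<Sum>i<n. mul (frag_of (r i + r' i, 1)) (h i))
          (\<Sum>i<n. mul (frag_of (r i, 1)) (h i) + mul (frag_of (r' i, 1)) (h i))"
        unfolding mul_add_left[symmetric] by (intro cg_sum subgrp_SN FL.mul_cg_left SN_frag_add) simp_all
      then show "(\<lambda>i. r i + r' i) \<in> R"
        using r by (simp add: R_def sum.distrib cg_mem_iff[OF subgrp_SN] subgrp_add[OF subgrp_SN])
    next
      fix l and r :: "nat \<Rightarrow> 'l" assume r: "r \<in> R"
      have "(\<Sum>i<n. mul (frag_of (l * r i, 1)) (h i)) = mul (frag_of (l, 1)) (\<Sum>i<n. mul (frag_of (r i, 1)) (h i))"
        by (simp add: mul_sum_right mul_assoc[symmetric])
      then show "(\<lambda>i. l * r i) \<in> R" using r by (simp add: R_def FL.mul_SN)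
    next
      fix d and r :: "nat \<Rightarrow> 'l" assume r: "r \<in> R"
      have DA_sum: "DA d (sum f P) = (\<Sum>i\<in>P. DA d (f i))" for f and P :: "nat set"
        by (induction P rule: infinite_finite_induct) (simp_all add: DA_add)
      have "cg NF (DA d (\<Sum>i<n. mul (frag_of (r i, 1)) (h i))) (\<Sum>i<n. mul (frag_of (act d (r i), 1)) (h i))"
        unfolding DA_sum by (intro cg_sum subgrp_SN FL.DA_mul_HF HF_KA_FL h) simp
      moreover have "DA d (\<Sum>i<n. mul (frag_of (r i, 1)) (h i)) \<in> NF"
        using r by (intro FL.DA_SN) (simp add: R_def)
      ultimately show "(\<lambda>i. act d (r i)) \<in> R" using cg_mem_iff[OF subgrp_SN] by (auto simp: R_def)
    next
      show "r i0 \<noteq> 0" "finite {i. r i \<noteq> 0}"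
        using i0 finite_subset[of "{i. r i \<noteq> 0}" "{..<n}"] by (auto simp: r_def)
    qed (use rR in auto)
    have j: "j < n" "b j \<noteq> 0" using c(2) c(3)[of j] by (auto simp: r_def split: if_splits)
    \<comment> \<open>The constant vector is a relation over \<open>k\<close>: this combination of
      the \<open>h i\<close> belongs to the Hopf ideal, hence is killed by \<open>G\<close>.\<close>
    have "(\<Sum>i<n. scF (c i) (h i)) \<in> NF" using c(1) by (simp add: R_def scF_def)
    then have w: "(\<Sum>i<n. c i * G (h i)) = 0"
      using galois_charD(5)[OF G subgrp_sum[OF KA.subgrp_HF], of "{..<n}" "\<lambda>i. scF (c i) (h i)"]
      by (simp add: galois_char_sum[OF G] KA.scF_HF h galois_charD(4)[OF G])
    \<comment> \<open>Subtracting \<open>b j\<close> times the constant relation removes the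
      coefficient at \<open>j\<close> and, as \<open>c\<close> is supported where \<open>b\<close>
      is, creates no new one.\<close>
    define b' where "b' i = b i - scL (c i) (b j)" for i
    have "(\<Sum>i<n. mul (frag_of (b j, 1)) (scF (c i) (h i))) \<in> NF"
    proof -
      have "mul (frag_of (b j, 1)) (\<Sum>i<n. scF (c i) (h i)) \<in> NF"
        by (intro FL.mul_SN) (simp_all add: \<open>(\<Sum>i<n. scF (c i) (h i)) \<in> NF\<close>)
      then show ?thesis by (simp add: mul_sum_right)
    qed
    moreover have "cg NF (\<Sum>i<n. mul (frag_of (b' i, 1)) (h i))
        (\<Sum>i<n. mul (frag_of (b i, 1)) (h i) - mul (frag_of (scL (c i) (b j), 1)) (h i))"
      unfolding b'_def by (intro cg_sum subgrp_SN FL_frag_diff)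
    ultimately have "(\<Sum>i<n. mul (frag_of (b' i, 1)) (h i)) \<in> NF"
      using less.prems cg_mem_iff[OF subgrp_SN]
      by (fastforce simp: sum_subtractf mul_scF_frag intro: subgrp_diff[OF subgrp_SN])
    moreover have "card {i. i < n \<and> b' i \<noteq> 0} < card {i. i < n \<and> b i \<noteq> 0}"
    proof (rule psubset_card_mono)
      have "b i \<noteq> 0" if "i < n" "b' i \<noteq> 0" for i
        using that c(3)[of i] by (cases "c i = 0") (auto simp: b'_def r_def)
      moreover have "b' j = 0" using c(2) by (simp add: b'_def scL_simps)
      ultimately show "{i. i < n \<and> b' i \<noteq> 0} \<subset> {i. i < n \<and> b i \<noteq> 0}" using j by blast
    qed simp
    ultimately have "(\<Sum>i<n. scL (G (h i)) (b' i)) = 0" by (intro less.hyps)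
    moreover have "(\<Sum>i<n. scL (G (h i)) (scL (c i) (b j))) = scL (\<Sum>i<n. c i * G (h i)) (b j)"
      by (simp add: scL_sum_scalar scL_simps(3)[symmetric] mult.commute)
    ultimately show ?thesis using w by (simp add: b'_def scL_diff sum_subtractf)
  qed
qed

text \<open>If every \<open>G\<close> kills every \<open>h i\<close>, the separation hypothesis puts
  each term into \<open>NF\<close>. Otherwise some \<open>G\<close> with
  \<open>G (h j) \<noteq> 0\<close> gives the relation \<open>\<Sum> c i b i = 0\<close>, where
  \<open>c i = G (h i) / G (h j)\<close>. Replacing \<open>h i\<close> by
  \<open>h i - c i h j\<close> then changes neither the sum nor its values, but kills the term at
  \<open>j\<close>. This is a converse to \<open>galois_char_relation\<close>.\<close>

lemma relation_if_galois_chars_vanish: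
  assumes Z: "\<And>x. x \<in> KA.HF \<Longrightarrow> (\<And>G. G \<in> \<G> \<Longrightarrow> G x = 0) \<Longrightarrow> x \<in> NF"
    and galois_char: "\<And>G. G \<in> \<G> \<Longrightarrow> galois_char G"
    and P: "finite P" and h: "\<And>i. h i \<in> KA.HF"
    and rel: "\<And>G. G \<in> \<G> \<Longrightarrow> (\<Sum>i\<in>P. scL (G (h i)) (b i)) = 0"
  shows "(\<Sum>i\<in>P. mul (frag_of (b i, 1)) (h i)) \<in> NF"
  using P h rel
proof (induction "card P" arbitrary: P h rule: less_induct)
  case less
  show ?case
  proof (cases "\<forall>G\<in>\<G>. \<forall>i\<in>P. G (h i) = 0")
    case True
    then have "h i \<in> NF" if "i \<in> P" for i using that by (intro Z less.prems) auto
    then show ?thesis by (intro subgrp_sum subgrp_SN FL.mul_SN) simp_all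
  next
    case False
    then obtain G j where Gj: "G \<in> \<G>" "j \<in> P" "G (h j) \<noteq> 0" by blast
    define c where "c i = G (h i) / G (h j)" for i
    have cj: "c j = 1" using Gj by (simp add: c_def)
    have "(\<Sum>i\<in>P. scL (c i) (b i)) = scL (1 / G (h j)) (\<Sum>i\<in>P. scL (G (h i)) (b i))"
      by (simp add: scL_sum scL_simps(3)[symmetric] c_def)
    then have cb: "(\<Sum>i\<in>P. scL (c i) (b i)) = 0" using less.prems(3)[OF Gj(1)] by simp
    define h' where "h' i = h i - scF (c i) (h j)" for i
    have h': "h' i \<in> KA.HF" for i
      unfolding h'_def by (intro KA.HF_diff KA.scF_HF less.prems)
    have h'j: "h' j = 0" by (simp add: h'_def cj scF_def scL_simps)
    have drop: "(\<Sum>i\<in>P. f i) = (\<Sum>i\<in>P - {j}. f i)" if "f j = 0" for f :: "'a \<Rightarrow> 'g::comm_monoid_add"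
      using that Gj less.prems(1) by (simp add: sum.remove)
    have rel': "(\<Sum>i\<in>P - {j}. scL (G' (h' i)) (b i)) = 0" if "G' \<in> \<G>" for G'
    proof -
      have "(\<Sum>i\<in>P - {j}. scL (G' (h' i)) (b i)) = (\<Sum>i\<in>P. scL (G' (h' i)) (b i))"
        by (rule drop[symmetric]) (simp add: h'j galois_char_0[OF galois_char[OF that]])
      also have "\<dots> = (\<Sum>i\<in>P. scL (G' (h i)) (b i) - scL (G' (h j)) (scL (c i) (b i)))"
        using galois_char[OF that] less.prems(2) by (simp add: h'_def galois_char_diff KA.scF_HF galois_charD(4) scL_diff
            scL_simps(3)[symmetric] mult.commute)
      also have "\<dots> = 0" using less.prems(3)[OF that] cb by (simp add: sum_subtractf flip: scL_sum)
      finally show ?thesis .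
    qed
    have "card (P - {j}) < card P" using Gj less.prems(1) by (meson card_Diff1_less)
    then have "(\<Sum>i\<in>P - {j}. mul (frag_of (b i, 1)) (h' i)) \<in> NF"
      using less.prems(1) h' rel' by (intro less.hyps) auto
    moreover have "(\<Sum>i\<in>P - {j}. mul (frag_of (b i, 1)) (h' i)) = (\<Sum>i\<in>P. mul (frag_of (b i, 1)) (h' i))"
      by (rule drop[symmetric]) (simp add: h'j)
    moreover have "mul (frag_of (b i, 1)) (h' i)
        = mul (frag_of (b i, 1)) (h i) - mul (frag_of (scL (c i) (b i), 1)) (h j)" for i
      by (simp add: h'_def mul_diff_right mul_scF_frag)
    ultimately have "(\<Sum>i\<in>P. mul (frag_of (b i, 1)) (h i))
        - (\<Sum>i\<in>P. mul (frag_of (scL (c i) (b i), 1)) (h j)) \<in> NF"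
      by (simp add: sum_subtractf)
    moreover have "(\<Sum>i\<in>P. mul (frag_of (scL (c i) (b i), 1)) (h j)) \<in> NF"
    proof -
      have "cg NF (frag_of (sum f P, 1)) (\<Sum>i\<in>P. frag_of (f i, 1))" for f
        using less.prems(1)
      proof (induction P rule: finite_induct)
        case empty
        show ?case using frag_sum_list_left[of UNIV 1 "[]" "\<lambda>_. 0" F] by simp
      next
        case (insert i P)
        then show ?case
          using SN_trans[OF SN_frag_add(1)[of "f i" UNIV "sum f P" 1 F] SN_add[OF SN_refl]] by simp
      qed
      from FL.mul_cg_left[OF _ this[of "\<lambda>i. scL (c i) (b i)"], of "h j"]
      have zero: "cg NF (mul (frag_of (0, 1)) (h j)) (mul (\<Sum>i\<in>P. frag_of (scL (c i) (b i), 1)) (h j))"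
        by (simp add: cb)
      have "mul (frag_of (0, 1)) (h j) \<in> NF"
        using frag_sum_list_left[of UNIV 1 "[]" "\<lambda>_. 0" F]
        by (subst mul_commute, intro FL.mul_SN) (simp_all add: cg_def)
      then show ?thesis using cg_mem_iff[OF subgrp_SN zero] by (simp add: mul_sum_left)
    qed
    ultimately show ?thesis using subgrp_add[OF subgrp_SN] by fastforce
  qed
qed


section \<open>Expansions along \<open>H\<close> and their values under a character\<close>

definition comb :: "('l \<times> ('l \<times> 'l \<Rightarrow>\<^sub>0 int)) list \<Rightarrow> ('l \<times> 'l \<Rightarrow>\<^sub>0 int)" where
  "comb xs = sum_list (map (\<lambda>(b, x). mul (frag_of (b, 1)) x) xs)"

definition comb_eval :: "(('l \<times> 'l \<Rightarrow>\<^sub>0 int) \<Rightarrow> 'k) \<Rightarrow> ('l \<times> ('l \<times> 'l \<Rightarrow>\<^sub>0 int)) list \<Rightarrow> 'l" where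
  "comb_eval G xs = sum_list (map (\<lambda>(b, x). scL (G x) b) xs)"

lemma comb_simps [simp]: "comb [] = 0" "comb ((b, x) # xs) = mul (frag_of (b, 1)) x + comb xs"
    "comb (xs @ ys) = comb xs + comb ys"
  and comb_eval_simps [simp]: "comb_eval G [] = 0" "comb_eval G ((b, x) # xs) = scL (G x) b + comb_eval G xs"
    "comb_eval G (xs @ ys) = comb_eval G xs + comb_eval G ys"
  by (simp_all add: comb_def comb_eval_def)

text \<open>The family is padded by 0 beyond the length of the list, since the relation lemmas ask
  for a constant at every index.\<close>

lemma comb_eval_nth:
  "comb xs = (\<Sum>i<length xs. mul (frag_of (fst (xs ! i), 1)) (if i < length xs then snd (xs ! i) else 0))"
  "comb_eval G xs = (\<Sum>i<length xs. scL (G (if i < length xs then snd (xs ! i) else 0)) (fst (xs ! i)))"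
  by (simp_all add: comb_def comb_eval_def sum_list_sum_nth atLeast0LessThan case_prod_unfold)

lemma nth_HF: "set xs \<subseteq> C \<times> KA.HF \<Longrightarrow> (if i < length xs then snd (xs ! i) else 0) \<in> KA.HF"
  using subsetD[OF _ nth_mem, of xs "C \<times> KA.HF" i] KA.HF_0 by (auto simp: mem_Times_iff)

lemma comb_eval_eq_0: "galois_char G \<Longrightarrow> set xs \<subseteq> C \<times> KA.HF \<Longrightarrow> comb xs \<in> NF \<Longrightarrow> comb_eval G xs = 0"
  unfolding comb_eval_nth by (intro galois_char_relation nth_HF)

lemma comb_mem_NF:
  assumes "\<And>x. x \<in> KA.HF \<Longrightarrow> (\<And>G. G \<in> \<G> \<Longrightarrow> G x = 0) \<Longrightarrow> x \<in> NF" "\<And>G. G \<in> \<G> \<Longrightarrow> galois_char G"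
    and "set xs \<subseteq> C \<times> KA.HF" "\<And>G. G \<in> \<G> \<Longrightarrow> comb_eval G xs = 0"
  shows "comb xs \<in> NF"
  using assms(4) unfolding comb_eval_nth
  by (intro relation_if_galois_chars_vanish[of \<G>] assms(1,2) nth_HF[OF assms(3)]) auto

lemma comb_free_on: "set xs \<subseteq> A \<times> KA.HF \<Longrightarrow> comb xs \<in> free_on A"
  by (induction xs)
    (auto intro!: subgrp_add[OF subgrp_free_on] KA.mul_free_on simp: KA.HF_free_on subgrp_0[OF subgrp_free_on] KA.As)

lemma comb_mult: "comb (map (\<lambda>(b, x). (a * b, x)) xs) = mul (frag_of (a, 1)) (comb xs)"
  by (induction xs) (auto simp: mul_add_right mul_assoc[symmetric])

text \<open>The classes of all \<open>comb xs\<close> form an \<open>A\<close>-submodule of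
  \<open>A \<otimes>\<^sub>K A\<close> that contains \<open>H\<close>; by the generation property of
  a Picard-Vessiot extension it is everything.\<close>

lemma comb_spanning:
  assumes "z \<in> free_on A"
  obtains xs where "set xs \<subseteq> A \<times> KA.HF" "cg NK z (comb xs)"
proof -
  define T where "T = (self_tensor K A)\<lparr>smult := \<lambda>a X. self_pure K A a 1 \<otimes>\<^bsub>self_tensor K A\<^esub> X\<rparr>"
  define N where "N = {SC K A (comb xs) |xs. set xs \<subseteq> A \<times> KA.HF}"
  have TM: "add_monoid T = add_monoid (self_tensor K A)" by (simp add: T_def)
  have T: "carrier T = SC K A ` free_on A"
    "a \<odot>\<^bsub>T\<^esub> X = SC K A (frag_of (a, 1)) \<otimes>\<^bsub>self_tensor K A\<^esub> X" for a X
    by (simp_all add: T_def KA.SC_carrier pure_tensor_def)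
  interpret G: abelian_group "self_tensor K A" by (rule abelian_group_tensor)
  have N: "N \<subseteq> SC K A ` free_on A" by (auto simp: N_def comb_free_on)
  have N_mult: "SC K A (frag_of (a, 1)) \<otimes>\<^bsub>self_tensor K A\<^esub> X \<in> N" if a: "a \<in> A" and X: "X \<in> N" for a X
  proof -
    obtain xs where xs: "set xs \<subseteq> A \<times> KA.HF" "X = SC K A (comb xs)" using X by (auto simp: N_def)
    then have "SC K A (frag_of (a, 1)) \<otimes>\<^bsub>self_tensor K A\<^esub> X = SC K A (comb (map (\<lambda>(b, x). (a * b, x)) xs))"
      using a by (simp add: KA.SC_mult comb_free_on comb_mult KA.As)
    moreover have "set (map (\<lambda>(b, x). (a * b, x)) xs) \<subseteq> A \<times> KA.HF"
      using xs(1) a by (auto simp: KA.As)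
    ultimately show ?thesis unfolding N_def by blast
  qed
  have "submodule N (ring_on A) T"
  proof (rule submodule.intro)
    show "submodule_axioms N (ring_on A) T"
      by (rule submodule_axioms.intro) (simp add: T N_mult)
    show "subgroup N (add_monoid T)"
      unfolding TM
    proof (rule group.subgroupI[OF G.a_group])
      show "N \<subseteq> carrier (add_monoid (self_tensor K A))" using N by (simp add: KA.SC_carrier)
      have "SC K A (comb []) \<in> N" unfolding N_def by (intro CollectI exI[of _ "[]"]) simp
      then show "N \<noteq> {}" by blast
      fix X assume X: "X \<in> N"
      then obtain xs where xs: "set xs \<subseteq> A \<times> KA.HF" "X = SC K A (comb xs)" by (auto simp: N_def)
      show "X \<otimes>\<^bsub>add_monoid (self_tensor K A)\<^esub> Y \<in> N" if "Y \<in> N" for Y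
      proof -
        obtain ys where "set ys \<subseteq> A \<times> KA.HF" "Y = SC K A (comb ys)" using \<open>Y \<in> N\<close> by (auto simp: N_def)
        then show ?thesis
          unfolding N_def using xs by (intro CollectI exI[of _ "xs @ ys"]) (auto simp: KA.SC_add)
      qed
      \<comment> \<open>Negation is multiplication by \<open>-1 \<otimes> 1\<close>, so closure
        under it follows from \<open>N_mult\<close>.\<close>
      have "\<ominus>\<^bsub>self_tensor K A\<^esub> X = SC K A (frag_of (- 1, 1)) \<otimes>\<^bsub>self_tensor K A\<^esub> X"
      proof (rule G.minus_equality)
        have c: "comb xs \<in> free_on A" using xs by (simp add: comb_free_on)
        have m1: "frag_of (- 1, 1) \<in> free_on A" by (simp add: KA.As)
        show "X \<in> carrier (self_tensor K A)" using X N by (auto simp: KA.SC_carrier)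
        show "SC K A (frag_of (- 1, 1)) \<otimes>\<^bsub>self_tensor K A\<^esub> X \<in> carrier (self_tensor K A)"
          using N_mult[OF _ X, of "- 1"] N by (auto simp: KA.SC_carrier KA.As)
        have "cg NK (mul (frag_of (- 1 + 1, 1)) (comb xs)) (mul (frag_of (- 1, 1) + frag_of (1, 1)) (comb xs))"
          by (intro KA.mul_cg_left c SN_frag_add KA.As)
        moreover have "cg NK (mul (frag_of (0, 1)) (comb xs)) 0"
          using frag_sum_list_left[of A 1 "[]" "\<lambda>_. 0" K] c
          by (subst mul_commute) (simp add: cg_def KA.mul_SN KA.As)
        ultimately have "cg NK (mul (frag_of (- 1, 1)) (comb xs) + comb xs) 0"
          using SN_trans[OF SN_sym] by (fastforce simp: mul_add_left)
        then show "SC K A (frag_of (- 1, 1)) \<otimes>\<^bsub>self_tensor K A\<^esub> X \<oplus>\<^bsub>self_tensor K A\<^esub> X = \<zero>\<^bsub>self_tensor K A\<^esub>"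
          using xs c m1 by (simp add: KA.SC_mult KA.SC_add tensor_zero KA.SC_eq_iff)
      qed
      then show "inv\<^bsub>add_monoid (self_tensor K A)\<^esub> X \<in> N"
        using N_mult[OF _ X, of "- 1"] by (simp add: a_inv_def KA.As)
    qed
  qed
  moreover have "carrier H \<subseteq> N"
    unfolding KA.PV_hopf_carrier
  proof
    fix X assume "X \<in> SC K A ` KA.HF"
    then obtain x where "x \<in> KA.HF" "X = SC K A (comb [(1, x)])" by auto
    then show "X \<in> N" unfolding N_def by (intro CollectI exI[of _ "[(1, x)]"]) (auto simp: KA.As)
  qed
  ultimately have "N = SC K A ` free_on A"
    using PV unfolding PV_extension_def Let_def T_def[symmetric] by (simp add: T)
  then have "SC K A z \<in> N" using assms by blast
  then show thesis using that by (auto simp: N_def KA.SC_eq_iff)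
qed

text \<open>
  \<open>Ev G z v\<close> says that \<open>v\<close> is the value at \<open>z\<close> of the \<open>A\<close>-linear map \<open>A \<otimes>\<^sub>K A \<rightarrow> A\<close> that agrees with \<open>G\<close> on \<open>H\<close>.
\<close>

definition Ev :: "(('l \<times> 'l \<Rightarrow>\<^sub>0 int) \<Rightarrow> 'k) \<Rightarrow> ('l \<times> 'l \<Rightarrow>\<^sub>0 int) \<Rightarrow> 'l \<Rightarrow> bool" where
  "Ev G z v \<longleftrightarrow> (\<exists>xs. set xs \<subseteq> A \<times> KA.HF \<and> cg NK z (comb xs) \<and> v = comb_eval G xs)"

lemma EvI: "set xs \<subseteq> A \<times> KA.HF \<Longrightarrow> cg NK z (comb xs) \<Longrightarrow> Ev G z (comb_eval G xs)"
  by (auto simp: Ev_def)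

lemma Ev_total: "z \<in> free_on A \<Longrightarrow> \<exists>v. Ev G z v"
  using comb_spanning[of z] EvI by metis

lemma Ev_cg: "Ev G z v \<Longrightarrow> cg NK z' z \<Longrightarrow> Ev G z' v"
  unfolding Ev_def using SN_trans by blast

lemma Ev_mem: "Ev G z v \<Longrightarrow> v \<in> A"
proof -
  have "comb_eval G xs \<in> A" if "set xs \<subseteq> A \<times> KA.HF" for xs
    using that by (induction xs) (auto simp: KA.As)
  then show "Ev G z v \<Longrightarrow> v \<in> A" by (auto simp: Ev_def)
qed

text \<open>By \<open>galois_char_relation\<close> an expansion that vanishes in
  \<open>L \<otimes>\<^sub>F L\<close> has value 0. So the value depends neither on the expansion
  nor on more of \<open>z\<close> than its image in \<open>L \<otimes>\<^sub>F L\<close>.\<close>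

lemma Ev_NF: "galois_char G \<Longrightarrow> Ev G z v \<Longrightarrow> z \<in> NF \<Longrightarrow> v = 0"
  unfolding Ev_def using comb_eval_eq_0 cg_mem_iff[OF subgrp_SN cg_NK_NF] by blast

lemma Ev_add: "Ev G z v \<Longrightarrow> Ev G z' v' \<Longrightarrow> Ev G (z + z') (v + v')"
proof -
  assume "Ev G z v" "Ev G z' v'"
  then obtain xs ys where "set xs \<subseteq> A \<times> KA.HF" "cg NK z (comb xs)" "v = comb_eval G xs"
    "set ys \<subseteq> A \<times> KA.HF" "cg NK z' (comb ys)" "v' = comb_eval G ys" by (auto simp: Ev_def)
  then show ?thesis using EvI[of "xs @ ys" "z + z'" G] SN_add[of K A z "comb xs" z' "comb ys"] by simp
qed

lemma Ev_uminus:
  assumes G: "galois_char G" and "Ev G z v"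
  shows "Ev G (- z) (- v)"
proof -
  obtain xs where xs: "set xs \<subseteq> A \<times> KA.HF" "cg NK z (comb xs)" "v = comb_eval G xs"
    using assms by (auto simp: Ev_def)
  let ?ys = "map (\<lambda>(b, x). (b, - x)) xs"
  have neg: "mul x (- y) = - mul x y" for x y :: "'l \<times> 'l \<Rightarrow>\<^sub>0 int"
    using mul_diff_right[of x 0 y] by simp
  have "comb ?ys = - comb xs"
    by (induction xs) (auto simp: neg)
  moreover have "comb_eval G ?ys = - comb_eval G xs"
    using xs(1)
  proof (induction xs)
    case (Cons p xs)
    then show ?case by (cases p) (auto simp: galois_char_uminus[OF G] scL_minus)
  qed simp
  moreover have "set ?ys \<subseteq> A \<times> KA.HF" using xs(1) KA.HF_uminus by auto
  moreover have "cg NK (- z) (- comb xs)" using SN_diff[OF SN_refl xs(2), of 0] by simp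
  ultimately show ?thesis using xs(3) EvI[of ?ys "- z" G] by simp
qed

lemma Ev_diff: "galois_char G \<Longrightarrow> Ev G z v \<Longrightarrow> Ev G z' v' \<Longrightarrow> Ev G (z - z') (v - v')"
  using Ev_add[of G z v "- z'" "- v'"] Ev_uminus[of G z' v'] by simp

lemma Ev_unique: "galois_char G \<Longrightarrow> Ev G z v \<Longrightarrow> Ev G z v' \<Longrightarrow> v = v'"
  using Ev_NF[OF _ Ev_diff[of G z v z v']] subgrp_0[OF subgrp_SN[of F UNIV]] by simp

text \<open>As \<open>H\<close> is closed under products, multiplying two expansions term by term
  gives an expansion of the product; multiplicativity on \<open>H\<close> thus extends to all of
  \<open>A \<otimes>\<^sub>K A\<close>.\<close>

lemma Ev_mul:
  assumes G: "galois_char G" and "Ev G z v" "Ev G z' v'"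
  shows "Ev G (mul z z') (v * v')"
proof -
  obtain xs ys where xs: "set xs \<subseteq> A \<times> KA.HF" "cg NK z (comb xs)" "v = comb_eval G xs"
    and ys: "set ys \<subseteq> A \<times> KA.HF" "cg NK z' (comb ys)" "v' = comb_eval G ys"
    using assms by (auto simp: Ev_def)
  define row where "row p = map (\<lambda>q. (fst p * fst q, mul (snd p) (snd q))) ys"
    for p :: "'l \<times> ('l \<times> 'l \<Rightarrow>\<^sub>0 int)"
  have m: "mul (frag_of (b * b', 1)) (mul x x') = mul (mul (frag_of (b, 1)) x) (mul (frag_of (b', 1)) x')"
    for b b' :: 'l and x x'
  proof -
    have "mul (frag_of (b * b', 1)) (mul x x') = mul (mul (frag_of (b, 1)) (frag_of (b', 1))) (mul x x')" by simp
    also have "\<dots> = mul (frag_of (b, 1)) (mul (mul (frag_of (b', 1)) x) x')" by (simp only: mul_assoc)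
    also have "\<dots> = mul (frag_of (b, 1)) (mul (mul x (frag_of (b', 1))) x')" by (simp only: mul_commute[of x])
    also have "\<dots> = mul (mul (frag_of (b, 1)) x) (mul (frag_of (b', 1)) x')" by (simp only: mul_assoc)
    finally show ?thesis .
  qed
  have row: "comb (row p) = mul (mul (frag_of (fst p, 1)) (snd p)) (comb ys)" for p
    unfolding row_def by (induction ys) (auto simp: mul_add_right m)
  have prod: "comb (concat (map row xs)) = mul (comb xs) (comb ys)" for xs
    by (induction xs) (auto simp: mul_add_left row)
  have e: "scL (c * c') (b * b') = scL c b * scL c' b'" for c c' b b'
    by (simp add: scL_simps(5) mult_scL) (simp add: scL_simps(3)[symmetric] mult.commute)
  have row_e: "comb_eval G (row p) = scL (G (snd p)) (fst p) * comb_eval G ys" if "p \<in> A \<times> KA.HF" for p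
    unfolding row_def using ys(1) that
    by (induction ys) (auto simp: galois_charD(2)[OF G] e distrib_left)
  have "comb_eval G (concat (map row xs)) = comb_eval G xs * comb_eval G ys"
    using xs(1) by (induction xs) (auto simp: row_e distrib_right)
  moreover have "set (concat (map row xs)) \<subseteq> A \<times> KA.HF"
  proof -
    have "(fst p * fst q, mul (snd p) (snd q)) \<in> A \<times> KA.HF" if "p \<in> A \<times> KA.HF" "q \<in> A \<times> KA.HF" for p q
      using that KA.As(4) KA.HF_mul by (simp add: mem_Times_iff)
    then show ?thesis using subsetD[OF xs(1)] subsetD[OF ys(1)] by (simp add: row_def image_subset_iff UN_subset_iff)
  qed
  moreover have "cg NK (mul z z') (mul (comb xs) (comb ys))"
    using SN_trans[OF KA.mul_cg_left[OF _ xs(2)] KA.mul_cg_right[OF _ ys(2)]] xs ys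
      KA.free_on_cg[OF ys(2)] by (simp add: comb_free_on)
  ultimately show ?thesis using EvI[of "concat (map row xs)" "mul z z'" G] by (simp add: prod xs(3) ys(3))
qed

lemma Ev_HF: "x \<in> KA.HF \<Longrightarrow> Ev G x (scL (G x) 1)"
  using EvI[of "[(1, x)]" x G] by (simp add: SN_refl KA.As)

lemma Ev_left: "galois_char G \<Longrightarrow> b \<in> A \<Longrightarrow> Ev G (frag_of (b, 1)) b"
  using EvI[of "[(b, frag_of (1, 1))]" "frag_of (b, 1)" G]
  by (simp add: SN_refl KA.HF_one galois_charD(3) scL_simps)

text \<open>The action of the character on \<open>A\<close>: inverting \<open>\<mu>\<close> at
  \<open>1 \<otimes> a\<close> means expanding \<open>1 \<otimes> a\<close> along \<open>H\<close>.
  The identification with the given action is \<open>character_act_A_eq\<close>.\<close>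

definition \<sigma> :: "(('l \<times> 'l \<Rightarrow>\<^sub>0 int) \<Rightarrow> 'k) \<Rightarrow> 'l \<Rightarrow> 'l" where
  "\<sigma> G a = (THE v. Ev G (frag_of (1, a)) v)"

lemma \<sigma>I: "galois_char G \<Longrightarrow> Ev G (frag_of (1, a)) v \<Longrightarrow> \<sigma> G a = v"
  unfolding \<sigma>_def using Ev_unique by (intro the_equality) auto

lemma Ev_\<sigma>: "galois_char G \<Longrightarrow> a \<in> A \<Longrightarrow> Ev G (frag_of (1, a)) (\<sigma> G a)"
  using Ev_total[of "frag_of (1, a)" G] \<sigma>I[of G a] by (auto simp: KA.As)

lemma \<sigma>_mem: "galois_char G \<Longrightarrow> a \<in> A \<Longrightarrow> \<sigma> G a \<in> A"
  by (rule Ev_mem[OF Ev_\<sigma>])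

lemma \<sigma>_add: "galois_char G \<Longrightarrow> a \<in> A \<Longrightarrow> b \<in> A \<Longrightarrow> \<sigma> G (a + b) = \<sigma> G a + \<sigma> G b"
  by (intro \<sigma>I Ev_cg[OF Ev_add[OF Ev_\<sigma> Ev_\<sigma>]] SN_frag_add KA.As) auto

lemma \<sigma>_mult: "galois_char G \<Longrightarrow> a \<in> A \<Longrightarrow> b \<in> A \<Longrightarrow> \<sigma> G (a * b) = \<sigma> G a * \<sigma> G b"
  using Ev_mul[OF _ Ev_\<sigma> Ev_\<sigma>, of G a b] by (intro \<sigma>I) simp_all

lemma \<sigma>_one: "galois_char G \<Longrightarrow> \<sigma> G 1 = 1"
  by (intro \<sigma>I Ev_left) (simp_all add: KA.As)

lemma \<sigma>_0: "galois_char G \<Longrightarrow> \<sigma> G 0 = 0"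
  using \<sigma>_add[of G 0 0] by (simp add: KA.As)

lemma \<sigma>_scL: "galois_char G \<Longrightarrow> a \<in> A \<Longrightarrow> \<sigma> G (scL c a) = scL c (\<sigma> G a)"
proof -
  assume G: "galois_char G" and a: "a \<in> A"
  have "Ev G (frag_of (scL c 1, a)) (scL c 1 * \<sigma> G a)"
    using Ev_mul[OF G Ev_left[OF G] Ev_\<sigma>[OF G a], of "scL c 1"] by (simp add: KA.As)
  moreover have "cg NK (frag_of (1, scL c a)) (frag_of (scL c 1, a))"
    using SN_sym[OF SN_frag_balance[OF KA.scL_one_mem, of 1 A a]] a by (simp add: scL_one_mult KA.As)
  ultimately show ?thesis using \<sigma>I[OF G Ev_cg] by (simp add: scL_one_mult)
qed

lemma Ev_pure: "galois_char G \<Longrightarrow> a \<in> A \<Longrightarrow> b \<in> A \<Longrightarrow> Ev G (frag_of (b, a)) (b * \<sigma> G a)"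
  using Ev_mul[OF _ Ev_left Ev_\<sigma>, of G b a] by simp

text \<open>The exchange of tensor factors restricts to the antipode of \<open>H\<close>.\<close>

lemma galois_char_swapF: "galois_char G \<Longrightarrow> galois_char (\<lambda>x. G (swapF x))"
proof -
  assume G: "galois_char G"
  have "G (swapF (scF c x)) = c * G (swapF x)" if "x \<in> KA.HF" for c x
  proof -
    have "G (swapF (scF c x)) = G (scF c (swapF x))"
      using that by (intro galois_char_cg[OF G] KA.swapF_HF KA.scF_HF cg_NK_NF KA.scF_swapF KA.HF_free_on)
    then show ?thesis using galois_charD(4)[OF G KA.swapF_HF[OF that]] by simp
  qed
  then show ?thesis
    using galois_charD[OF G] FL.swapF_SN by (simp add: galois_char_def swapF_add swapF_mul KA.swapF_HF)
qed

text \<open>Let \<open>1 \<otimes> a = \<Sum> b\<^sub>i h\<^sub>i\<close>, so that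
  \<open>\<sigma> G a = \<Sum> G(h\<^sub>i) b\<^sub>i\<close>. Exchanging factors gives \<open>a
  \<otimes> 1 = \<Sum> (1 \<otimes> b\<^sub>i) swap(h\<^sub>i)\<close>. The map attached to
  \<open>G' = G \<circ> swap\<close> sends the left side to \<open>a\<close> and the right side to
  \<open>\<Sum> G(h\<^sub>i) \<sigma> G' b\<^sub>i\<close>, which is
  \<open>\<sigma> G' (\<sigma> G a)\<close>.\<close>

lemma \<sigma>_inverse:
  assumes G: "galois_char G" and a: "a \<in> A"
  shows "\<sigma> (\<lambda>x. G (swapF x)) (\<sigma> G a) = a"
proof -
  define G' where "G' = (\<lambda>x. G (swapF x))"
  have G': "galois_char G'" unfolding G'_def by (rule galois_char_swapF[OF G])
  obtain xs where xs: "set xs \<subseteq> A \<times> KA.HF" "cg NK (frag_of (1, a)) (comb xs)"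
    using comb_spanning[of "frag_of (1, a)"] a by (auto simp: KA.As)
  have comb_eval_mem: "comb_eval G xs \<in> A" if "set xs \<subseteq> A \<times> KA.HF" for xs
    using that by (induction xs) (auto simp: KA.As)
  have "Ev G' (swapF (comb xs)) (\<sigma> G' (comb_eval G xs))"
    using xs(1)
  proof (induction xs)
    case Nil
    show ?case using EvI[of "[]" 0 G'] by (simp add: SN_refl \<sigma>_0[OF G'])
  next
    case (Cons p xs)
    obtain b x where p: "p = (b, x)" by force
    have b: "b \<in> A" and x: "x \<in> KA.HF" using Cons.prems p by auto
    have "Ev G' (mul (frag_of (1, b)) (swapF x)) (\<sigma> G' b * scL (G' (swapF x)) 1)"
      by (intro Ev_mul G' Ev_\<sigma> Ev_HF KA.swapF_HF b x)
    then have "Ev G' (swapF (mul (frag_of (b, 1)) x)) (\<sigma> G' (scL (G x) b))"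
      by (simp add: swapF_mul G'_def[symmetric] \<sigma>_scL[OF G' b] mult_scL) (simp add: G'_def)
    from Ev_add[OF this Cons.IH] show ?case
      using Cons.prems b by (simp add: p swapF_add \<sigma>_add[OF G'] KA.As comb_eval_mem)
  qed
  moreover have "cg NK (frag_of (a, 1)) (swapF (comb xs))"
    using KA.swapF_cg[OF xs(2)] by simp
  ultimately have "Ev G' (frag_of (a, 1)) (\<sigma> G' (comb_eval G xs))" by (rule Ev_cg)
  then have "\<sigma> G' (comb_eval G xs) = a" using Ev_left[OF G' a] by (rule Ev_unique[OF G'])
  moreover have "\<sigma> G a = comb_eval G xs" using \<sigma>I[OF G EvI[OF xs]] .
  ultimately show ?thesis by (simp add: G'_def)
qed

lemma \<sigma>_inverse': "galois_char G \<Longrightarrow> a \<in> A \<Longrightarrow> \<sigma> G (\<sigma> (\<lambda>x. G (swapF x)) a) = a"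
  using \<sigma>_inverse[OF galois_char_swapF, of G a] by simp


subsection \<open>Extension to the total quotient ring\<close>

definition nzd :: "'l set" where
  "nzd = {s \<in> A. \<forall>b\<in>A. s * b = 0 \<longrightarrow> b = 0}"

lemma nzd_A: "s \<in> nzd \<Longrightarrow> s \<in> A"
  by (simp add: nzd_def)

lemma nzd_unit: "s \<in> nzd \<Longrightarrow> \<exists>t. s * t = 1" and nzd_fraction: "\<exists>a\<in>A. \<exists>s\<in>nzd. x * s = a"
proof -
  have "total_quotient_ring_is_UNIV A" using PV by (simp add: PV_extension_def)
  then have *: "\<forall>s\<in>nzd. \<exists>t. s * t = 1" "\<forall>x. \<exists>a\<in>A. \<exists>s\<in>nzd. x * s = a"
    unfolding total_quotient_ring_is_UNIV_def Let_def nzd_def[symmetric] by blast+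
  show "s \<in> nzd \<Longrightarrow> \<exists>t. s * t = 1" "\<exists>a\<in>A. \<exists>s\<in>nzd. x * s = a" using * by blast+
qed

lemma nzd_cancel: "s \<in> nzd \<Longrightarrow> x * s = y * s \<Longrightarrow> x = y"
  using nzd_unit[of s] by (metis mult.assoc mult_1_right)

text \<open>The inverse map carries an annihilator of \<open>\<sigma> G s\<close> back to an
  annihilator of \<open>s\<close>. Hence images of denominators are again invertible in
  \<open>L\<close>.\<close>

lemma \<sigma>_nzd:
  assumes G: "galois_char G" and s: "s \<in> nzd"
  shows "\<sigma> G s \<in> nzd"
proof -
  let ?G = "\<lambda>x. G (swapF x)"
  have G': "galois_char ?G" by (rule galois_char_swapF[OF G])
  have sA: "s \<in> A" using s by (rule nzd_A)
  have "b = 0" if b: "b \<in> A" "\<sigma> G s * b = 0" for b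
  proof -
    have "\<sigma> ?G (\<sigma> G s * b) = s * \<sigma> ?G b"
      using \<sigma>_mult[OF G' \<sigma>_mem[OF G sA] b(1)] \<sigma>_inverse[OF G sA] by simp
    then have "s * \<sigma> ?G b = 0" using b(2) \<sigma>_0[OF G'] by simp
    then have "\<sigma> ?G b = 0" using s \<sigma>_mem[OF G' b(1)] by (simp add: nzd_def)
    then show "b = 0" using \<sigma>_inverse'[OF G b(1)] \<sigma>_0[OF G] by simp
  qed
  then show ?thesis using \<sigma>_mem[OF G sA] by (simp add: nzd_def)
qed

text \<open>The value is prescribed by all denominators of \<open>x\<close> at once, so no fraction
  has to be chosen; by \<open>\<Sigma>I\<close> a single denominator already determines it.\<close>

definition \<Sigma> :: "(('l \<times> 'l \<Rightarrow>\<^sub>0 int) \<Rightarrow> 'k) \<Rightarrow> 'l \<Rightarrow> 'l" where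
  "\<Sigma> G x = (THE y. \<forall>s\<in>nzd. x * s \<in> A \<longrightarrow> y * \<sigma> G s = \<sigma> G (x * s))"

lemma \<Sigma>I:
  assumes G: "galois_char G" and s: "s \<in> nzd" "x * s \<in> A" and y: "y * \<sigma> G s = \<sigma> G (x * s)"
  shows "\<Sigma> G x = y"
  unfolding \<Sigma>_def
proof (rule the_equality)
  show "\<forall>s'\<in>nzd. x * s' \<in> A \<longrightarrow> y * \<sigma> G s' = \<sigma> G (x * s')"
  proof (intro ballI impI)
    fix s' assume s': "s' \<in> nzd" "x * s' \<in> A"
    note A = nzd_A[OF s(1)] nzd_A[OF s'(1)]
    have "y * \<sigma> G s' * \<sigma> G s = \<sigma> G (x * s) * \<sigma> G s'" using y by (metis mult.assoc mult.commute)
    also have "\<dots> = \<sigma> G (x * s') * \<sigma> G s"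
      using \<sigma>_mult[OF G s(2) A(2)] \<sigma>_mult[OF G s'(2) A(1)] by (metis mult.assoc mult.commute)
    finally show "y * \<sigma> G s' = \<sigma> G (x * s')" by (rule nzd_cancel[OF \<sigma>_nzd[OF G s(1)]])
  qed
  fix z assume "\<forall>s\<in>nzd. x * s \<in> A \<longrightarrow> z * \<sigma> G s = \<sigma> G (x * s)"
  then show "z = y" using s y nzd_cancel[OF \<sigma>_nzd[OF G s(1)]] by metis
qed

lemma \<Sigma>_spec:
  assumes G: "galois_char G" and s: "s \<in> nzd" "x * s \<in> A"
  shows "\<Sigma> G x * \<sigma> G s = \<sigma> G (x * s)"
proof -
  obtain t where t: "\<sigma> G s * t = 1" using nzd_unit[OF \<sigma>_nzd[OF G s(1)]] by blast
  have "\<sigma> G (x * s) * t * \<sigma> G s = \<sigma> G (x * s)" using t by (metis mult.assoc mult.commute mult_1_right)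
  with \<Sigma>I[OF G s this] show ?thesis by simp
qed

lemma one_nzd: "1 \<in> nzd"
  by (simp add: nzd_def KA.As)

lemma \<Sigma>_A: "galois_char G \<Longrightarrow> a \<in> A \<Longrightarrow> \<Sigma> G a = \<sigma> G a"
  by (rule \<Sigma>I[OF _ one_nzd]) (simp_all add: \<sigma>_one)

lemma nzd_mult: "s \<in> nzd \<Longrightarrow> t \<in> nzd \<Longrightarrow> s * t \<in> nzd"
  unfolding nzd_def mem_Collect_eq mult.assoc by (meson KA.As(4))

lemma \<Sigma>_hom:
  assumes G: "galois_char G"
  shows "\<Sigma> G \<in> ring_hom (ring_on UNIV) (ring_on UNIV)"
proof -
  have "\<Sigma> G (x + y) = \<Sigma> G x + \<Sigma> G y \<and> \<Sigma> G (x * y) = \<Sigma> G x * \<Sigma> G y" for x y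
  proof -
    obtain s t where s: "s \<in> nzd" "x * s \<in> A" and t: "t \<in> nzd" "y * t \<in> A"
      using nzd_fraction[of x] nzd_fraction[of y] by auto
    note A = nzd_A[OF s(1)] nzd_A[OF t(1)]
    have st: "\<sigma> G (s * t) = \<sigma> G s * \<sigma> G t" by (rule \<sigma>_mult[OF G A])
    note X = \<Sigma>_spec[OF G s] and Y = \<Sigma>_spec[OF G t]
    have "\<Sigma> G (x + y) = \<Sigma> G x + \<Sigma> G y"
    proof (rule \<Sigma>I[OF G nzd_mult[OF s(1) t(1)]])
      have e: "(x + y) * (s * t) = (x * s) * t + (y * t) * s" by (simp add: algebra_simps)
      show "(x + y) * (s * t) \<in> A" unfolding e by (intro KA.As s t A)
      have "\<sigma> G ((x + y) * (s * t)) = \<sigma> G (x * s) * \<sigma> G t + \<sigma> G (y * t) * \<sigma> G s"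
        unfolding e using s t A by (simp add: \<sigma>_add[OF G] \<sigma>_mult[OF G] KA.As)
      also have "\<dots> = (\<Sigma> G x + \<Sigma> G y) * (\<sigma> G s * \<sigma> G t)"
        unfolding X[symmetric] Y[symmetric] by (simp add: algebra_simps)
      finally show "(\<Sigma> G x + \<Sigma> G y) * \<sigma> G (s * t) = \<sigma> G ((x + y) * (s * t))" by (simp add: st)
    qed
    moreover have "\<Sigma> G (x * y) = \<Sigma> G x * \<Sigma> G y"
    proof (rule \<Sigma>I[OF G nzd_mult[OF s(1) t(1)]])
      have e: "(x * y) * (s * t) = (x * s) * (y * t)" by (simp add: algebra_simps)
      show "(x * y) * (s * t) \<in> A" unfolding e by (intro KA.As s t A)
      have "\<sigma> G ((x * y) * (s * t)) = \<sigma> G (x * s) * \<sigma> G (y * t)"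
        unfolding e using s t by (simp add: \<sigma>_mult[OF G])
      also have "\<dots> = (\<Sigma> G x * \<Sigma> G y) * (\<sigma> G s * \<sigma> G t)"
        unfolding X[symmetric] Y[symmetric] by (simp add: algebra_simps)
      finally show "(\<Sigma> G x * \<Sigma> G y) * \<sigma> G (s * t) = \<sigma> G ((x * y) * (s * t))" by (simp add: st)
    qed
    ultimately show ?thesis ..
  qed
  moreover have "\<Sigma> G 1 = 1" using \<Sigma>_A[OF G, of 1] \<sigma>_one[OF G] by (simp add: KA.As)
  ultimately show ?thesis by (simp add: ring_hom_def)
qed

text \<open>A homomorphism on \<open>L\<close> is determined by its values at numerators and
  denominators. This is the uniqueness that the description operator in \<open>character_act\<close>
  asks for.\<close>

lemma \<Sigma>_unique:
  assumes G: "galois_char G" and \<tau>: "\<tau> \<in> ring_hom (ring_on UNIV) (ring_on UNIV)" "\<And>a. a \<in> A \<Longrightarrow> \<tau> a = \<sigma> G a"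
  shows "\<tau> = \<Sigma> G"
proof
  fix x
  obtain s where s: "s \<in> nzd" "x * s \<in> A" using nzd_fraction[of x] by auto
  have "\<tau> (x * s) = \<tau> x * \<tau> s" using \<tau>(1) by (simp add: ring_hom_def)
  then have "\<tau> x * \<sigma> G s = \<sigma> G (x * s)" using \<tau>(2)[OF s(2)] \<tau>(2)[OF nzd_A[OF s(1)]] by simp
  then show "\<tau> x = \<Sigma> G x" using \<Sigma>I[OF G s] by simp
qed

text \<open>
  Writing \<open>x = a / s\<close>, the element \<open>s \<otimes> a - a \<otimes> s\<close> of \<open>A \<otimes>\<^sub>K A\<close> decides both whether \<open>x\<close> is fixed
  and whether \<open>1 \<otimes> x = x \<otimes> 1\<close> in \<open>L \<otimes>\<^sub>F L\<close>.
\<close>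

lemma fixed_iff:
  assumes Z: "\<And>x. x \<in> KA.HF \<Longrightarrow> (\<And>G. G \<in> \<G> \<Longrightarrow> G x = 0) \<Longrightarrow> x \<in> NF"
    and galois_char: "\<And>G. G \<in> \<G> \<Longrightarrow> galois_char G"
  shows "(\<forall>G\<in>\<G>. \<Sigma> G x = x) \<longleftrightarrow> x \<in> F"
proof -
  obtain s where s: "s \<in> nzd" "x * s \<in> A" using nzd_fraction[of x] by auto
  obtain t where t: "s * t = 1" using nzd_unit[OF s(1)] by blast
  define a where "a = x * s"
  have A: "s \<in> A" "a \<in> A" using s nzd_A by (simp_all add: a_def)
  define z where "z = frag_of (s, a) - frag_of (a, s)"
  have zA: "z \<in> free_on A" using A by (simp add: z_def subgrp_diff[OF subgrp_free_on])
  obtain xs where xs: "set xs \<subseteq> A \<times> KA.HF" "cg NK z (comb xs)" using comb_spanning[OF zA] .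
  have z: "z \<in> NF \<longleftrightarrow> comb xs \<in> NF" by (rule cg_mem_iff[OF subgrp_SN cg_NK_NF[OF xs(2)]])
  have comb_eval: "comb_eval G xs = s * \<sigma> G a - a * \<sigma> G s" if "G \<in> \<G>" for G
    using Ev_diff[OF galois_char[OF that] Ev_pure[OF galois_char[OF that] A(2,1)] Ev_pure[OF galois_char[OF that] A]]
    by (intro Ev_unique[OF galois_char[OF that] EvI[OF xs]]) (simp add: z_def)
  \<comment> \<open>Cancelling the image of \<open>s\<close> turns fixedness of \<open>x\<close>
    into \<open>x \<sigma>(s) = \<sigma>(a)\<close>; one more factor \<open>s\<close> turns this
    into the vanishing of the value at \<open>z\<close>.\<close>
  have fix_iff: "\<Sigma> G x = x \<longleftrightarrow> comb_eval G xs = 0" if "G \<in> \<G>" for G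
  proof -
    note G = galois_char[OF that]
    have "\<Sigma> G x = x \<longleftrightarrow> x * \<sigma> G s = \<sigma> G a"
      unfolding a_def using \<Sigma>I[OF G s, of x] \<Sigma>_spec[OF G s] by metis
    also have "\<dots> \<longleftrightarrow> x * \<sigma> G s * s = \<sigma> G a * s" using nzd_cancel[OF s(1)] by auto
    also have "\<dots> \<longleftrightarrow> comb_eval G xs = 0" by (auto simp: comb_eval[OF that] a_def algebra_simps)
    finally show ?thesis .
  qed
  have "(\<forall>G\<in>\<G>. \<Sigma> G x = x) \<longleftrightarrow> z \<in> NF"
  proof
    assume "\<forall>G\<in>\<G>. \<Sigma> G x = x"
    then have "comb xs \<in> NF" using fix_iff by (intro comb_mem_NF[OF Z galois_char xs(1)]) auto
    then show "z \<in> NF" by (simp add: z)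
  next
    assume "z \<in> NF"
    then show "\<forall>G\<in>\<G>. \<Sigma> G x = x" using fix_iff comb_eval_eq_0[OF galois_char xs(1)] z by auto
  qed
  also have "\<dots> \<longleftrightarrow> x \<in> FL.dominion"
  proof -
    \<comment> \<open>In \<open>L \<otimes>\<^sub>F L\<close> the element
      \<open>s \<otimes> s\<close> is a unit with inverse \<open>t \<otimes> t\<close>, so
      \<open>z\<close> and \<open>1 \<otimes> x - x \<otimes> 1\<close> vanish together.\<close>
    have "z = mul (frag_of (s, s)) (frag_of (1, x) - frag_of (x, 1))"
      by (simp add: z_def a_def mul_diff_right mult.commute)
    moreover have "frag_of (1, x) - frag_of (x, 1) = mul (frag_of (t, t)) z"
    proof -
      have "t * s = 1" "t * (x * s) = x" using t by (simp_all add: ac_simps) (metis mult.assoc mult.commute mult_1_right)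
      then show ?thesis by (simp add: z_def a_def mul_diff_right)
    qed
    ultimately show ?thesis
      using FL.mul_SN[of "frag_of (s, s)" "frag_of (1, x) - frag_of (x, 1)"] FL.mul_SN[of "frag_of (t, t)" z]
      by (auto simp: FL.dominion_def cg_def)
  qed
  finally show ?thesis by (simp add: FL.dominion_eq[OF AS_F])
qed


section \<open>The Hopf ideal and its quotient algebra on representatives\<close>

abbreviation I where "I \<equiv> galois_ideal \<Delta> \<epsilon> scL act K A F"

text \<open>Both canonical maps in the definition are the identity on representatives, so the kernel
  condition becomes membership in \<open>NF\<close>.\<close>

lemma galois_ideal_eq: "I = SC K A ` (KA.HF \<inter> NF)"
proof -
  have "canonical_map K UNIV (SC K A x) \<in> a_kernel (self_tensor K UNIV) (self_tensor F UNIV) (canonical_map F UNIV)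
      \<longleftrightarrow> x \<in> NF" if "x \<in> KA.HF" for x
    using KA.canonical_map_SC[of K UNIV x] KL.canonical_map_SC[of F UNIV x] KF that
    by (simp add: KA.HF_free_on a_kernel_def' KL.SC_carrier tensor_zero FL.SC_eq_iff cg_def)
  then show ?thesis unfolding galois_ideal_def KA.PV_hopf_carrier by auto
qed

lemma H_ops:
  "\<zero>\<^bsub>H\<^esub> = SC K A 0" "\<one>\<^bsub>H\<^esub> = SC K A (frag_of (1, 1))"
  "SC K A x \<oplus>\<^bsub>H\<^esub> SC K A y = SC K A (x + y)"
  "x \<in> KA.HF \<Longrightarrow> y \<in> KA.HF \<Longrightarrow> SC K A x \<otimes>\<^bsub>H\<^esub> SC K A y = SC K A (mul x y)"
  "c \<odot>\<^bsub>H\<^esub> SC K A x = SC K A (scF c x)"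
  by (simp_all add: KA.PV_hopf_ops KA.SC_add KA.SC_mult KA.HF_free_on)

lemma ring_H: "ring H"
proof (rule ringI)
  show "abelian_group H"
  proof (rule abelian_groupI)
    fix X assume "X \<in> carrier H"
    then obtain x where "x \<in> KA.HF" "X = SC K A x" by (auto simp: KA.PV_hopf_carrier)
    then show "\<exists>Y\<in>carrier H. Y \<oplus>\<^bsub>H\<^esub> X = \<zero>\<^bsub>H\<^esub>"
      by (intro bexI[of _ "SC K A (- x)"]) (simp_all add: H_ops KA.PV_hopf_carrier KA.HF_uminus)
  qed (auto simp: KA.PV_hopf_carrier H_ops KA.HF_0 KA.HF_add ac_simps)
  show "Group.monoid H"
    by (rule monoidI) (auto simp: KA.PV_hopf_carrier H_ops KA.HF_mul KA.HF_one mul_assoc)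
qed (auto simp: KA.PV_hopf_carrier H_ops KA.HF_mul KA.HF_add mul_add_left mul_add_right)

lemma ideal_I: "ideal I H"
proof (rule idealI[OF ring_H])
  interpret H: ring H by (rule ring_H)
  have NF: "mul x y \<in> NF" "mul y x \<in> NF" if "y \<in> NF" for x y
    using FL.mul_SN[of x y] that by (simp_all add: mul_commute)
  show "subgroup I (add_monoid H)"
  proof (rule group.subgroupI[OF H.a_group])
    show "I \<subseteq> carrier (add_monoid H)" by (auto simp: galois_ideal_eq KA.PV_hopf_carrier)
    show "I \<noteq> {}" using KA.HF_0 subgrp_0[OF subgrp_SN] by (auto simp: galois_ideal_eq)
    show "X \<otimes>\<^bsub>add_monoid H\<^esub> Y \<in> I" if "X \<in> I" "Y \<in> I" for X Y
      using that by (auto simp: galois_ideal_eq H_ops KA.HF_add subgrp_add[OF subgrp_SN])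
    fix X assume "X \<in> I"
    then obtain x where x: "x \<in> KA.HF" "x \<in> NF" "X = SC K A x" by (auto simp: galois_ideal_eq)
    have "\<ominus>\<^bsub>H\<^esub> X = SC K A (- x)"
      using x by (intro H.minus_equality) (simp_all add: H_ops KA.PV_hopf_carrier KA.HF_uminus)
    then show "inv\<^bsub>add_monoid H\<^esub> X \<in> I"
      using x by (simp add: a_inv_def galois_ideal_eq KA.HF_uminus subgrp_uminus[OF subgrp_SN])
  qed
  show "X \<otimes>\<^bsub>H\<^esub> Y \<in> I" "Y \<otimes>\<^bsub>H\<^esub> X \<in> I" if "Y \<in> I" "X \<in> carrier H" for X Y
    using that by (auto simp: galois_ideal_eq KA.PV_hopf_carrier H_ops KA.HF_mul NF)
qed

lemma coset_eq:
  assumes "x \<in> KA.HF" "y \<in> KA.HF" "cg NF x y"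
  shows "I +>\<^bsub>H\<^esub> SC K A x = I +>\<^bsub>H\<^esub> SC K A y"
proof -
  interpret I: ideal I H by (rule ideal_I)
  have "SC K A x = SC K A (x - y) \<oplus>\<^bsub>H\<^esub> SC K A y" by (simp add: H_ops)
  moreover have "SC K A (x - y) \<in> I"
    using assms by (auto simp: galois_ideal_eq KA.HF_diff cg_def)
  ultimately have "SC K A x \<in> I +>\<^bsub>H\<^esub> SC K A y" by (auto simp: a_r_coset_def' )
  then show ?thesis
    using I.a_repr_independence'[of "SC K A x" "SC K A y"] assms by (simp add: KA.PV_hopf_carrier)
qed

lemma quot_ops:
  "carrier (quot_algebra H I) = a_rcosets\<^bsub>H\<^esub> I"
  "monoid.mult (quot_algebra H I) = rcoset_mult H I" "\<one>\<^bsub>quot_algebra H I\<^esub> = I +>\<^bsub>H\<^esub> \<one>\<^bsub>H\<^esub>"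
  "\<zero>\<^bsub>quot_algebra H I\<^esub> = I" "add (quot_algebra H I) = set_add H"
  "c \<odot>\<^bsub>quot_algebra H I\<^esub> Z = (\<Union>h\<in>Z. I +>\<^bsub>H\<^esub> (c \<odot>\<^bsub>H\<^esub> h))"
  by (simp_all add: quot_algebra_def ring.defs module.defs FactRing_def)

definition proj :: "('l \<times> 'l \<Rightarrow>\<^sub>0 int) \<Rightarrow> ('l, 'l) tens set" where
  "proj x = I +>\<^bsub>H\<^esub> SC K A x"

lemma proj_carrier: "x \<in> KA.HF \<Longrightarrow> proj x \<in> carrier (quot_algebra H I)"
  using ideal.axioms(1)[OF ideal_I] ring_H additive_subgroup.a_subset[of I H]
  by (auto simp: quot_ops proj_def A_RCOSETS_def' KA.PV_hopf_carrier)

lemma proj_ops: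
  assumes "x \<in> KA.HF" "y \<in> KA.HF"
  shows "proj x \<otimes>\<^bsub>quot_algebra H I\<^esub> proj y = proj (mul x y)"
    "proj x \<oplus>\<^bsub>quot_algebra H I\<^esub> proj y = proj (x + y)"
    "c \<odot>\<^bsub>quot_algebra H I\<^esub> proj x = proj (scF c x)"
proof -
  interpret I: ideal I H by (rule ideal_I)
  have c: "SC K A x \<in> carrier H" "SC K A y \<in> carrier H" using assms by (simp_all add: KA.PV_hopf_carrier)
  show "proj x \<otimes>\<^bsub>quot_algebra H I\<^esub> proj y = proj (mul x y)"
    using I.rcoset_mult_add[OF c] assms by (simp add: proj_def quot_ops H_ops)
  show "proj x \<oplus>\<^bsub>quot_algebra H I\<^esub> proj y = proj (x + y)"
    using I.a_rcos_sum[OF c] by (simp add: proj_def quot_ops H_ops)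
  \<comment> \<open>A scalar acts on a coset by a union over its members; all members yield the same
    coset because \<open>NF\<close> is stable under \<open>scF\<close>.\<close>
  have "I +>\<^bsub>H\<^esub> (c \<odot>\<^bsub>H\<^esub> h) = proj (scF c x)" if h: "h \<in> proj x" for h
  proof -
    obtain i where i: "i \<in> KA.HF" "i \<in> NF" "h = SC K A (i + x)"
      using h by (auto simp: proj_def a_r_coset_def' galois_ideal_eq H_ops)
    have "cg NF (scF c (i + x)) (scF c x)"
      using FL.scF_cg[of "i + x" x c] i(2) by (simp add: cg_def)
    then show ?thesis
      unfolding i(3) H_ops proj_def using i assms by (intro coset_eq KA.scF_HF KA.HF_add)
  qed
  moreover have "SC K A x \<in> proj x" unfolding proj_def by (rule I.a_rcos_self[OF c(1)])
  ultimately show "c \<odot>\<^bsub>quot_algebra H I\<^esub> proj x = proj (scF c x)"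
    unfolding quot_ops by blast
qed

section \<open>Characters of the quotient and the automorphisms they define\<close>

lemma galois_char_character:
  assumes g: "g \<in> characters (quot_algebra H I)"
  shows "galois_char (\<lambda>x. g (proj x))"
proof -
  have gh: "g (X \<otimes>\<^bsub>quot_algebra H I\<^esub> Y) = g X * g Y" "g (X \<oplus>\<^bsub>quot_algebra H I\<^esub> Y) = g X + g Y"
    "g (c \<odot>\<^bsub>quot_algebra H I\<^esub> X) = c * g X"
    if "X \<in> carrier (quot_algebra H I)" "Y \<in> carrier (quot_algebra H I)" for X Y c
    using g that by (auto simp: characters_def ring_hom_def)
  have 1: "g (proj (frag_of (1, 1))) = 1"
    using g by (auto simp: characters_def ring_hom_def quot_ops proj_def H_ops)
  have 2: "g (proj (x + y)) = g (proj x) + g (proj y)" "g (proj (mul x y)) = g (proj x) * g (proj y)"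
    "g (proj (scF c x)) = c * g (proj x)"
    if "x \<in> KA.HF" "y \<in> KA.HF" for x y c
    using gh[OF proj_carrier[OF that(1)] proj_carrier[OF that(2)]] by (simp_all add: proj_ops[OF that])
  have "g (proj x) = 0" if "x \<in> KA.HF" "x \<in> NF" for x
  proof -
    have "proj x = proj 0" unfolding proj_def using that by (intro coset_eq KA.HF_0) (simp_all add: cg_def)
    moreover have "g (proj 0) = 0"
      using 2(1)[OF KA.HF_0 KA.HF_0, unfolded add_0_left] by (metis add_cancel_right_right)
    ultimately show ?thesis by simp
  qed
  then show ?thesis using 1 2 by (auto simp: galois_char_def)
qed

text \<open>\<open>inv_into\<close> selects some preimage \<open>t\<close> of
  \<open>1 \<otimes> a\<close>, which exists by \<open>comb_spanning\<close>. As a list of pure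
  tensors \<open>b \<otimes> h\<close>, with a fragment chosen for each \<open>h\<close>, it becomes
  an expansion of \<open>1 \<otimes> a\<close>, and every expansion has the same value under
  \<open>G\<close>.\<close>

lemma character_act_A_eq:
  assumes g: "galois_char (\<lambda>x. g (SC K A x))" and a: "a \<in> A"
  shows "character_act_A \<Delta> \<epsilon> scL act K A g a = \<sigma> (\<lambda>x. g (SC K A x)) a"
proof -
  define G where "G = (\<lambda>x. g (SC K A x))"
  have G: "galois_char G" using g by (simp add: G_def)
  define TC where "TC = tensor_class base_field (mod_on scL A) H"
  define rep where "rep h = (SOME x. x \<in> KA.HF \<and> SC K A x = h)" for h
  have rep: "rep h \<in> KA.HF" "SC K A (rep h) = h" if "h \<in> carrier H" for h
    using someI_ex[of "\<lambda>x. x \<in> KA.HF \<and> SC K A x = h"] that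
    by (auto simp: KA.PV_hopf_carrier rep_def)
  have repI: "cg NK (rep h) x" if "x \<in> KA.HF" "h = SC K A x" for h x
    using rep[of h] that(2) imageI[OF that(1), of "SC K A"] by (simp add: KA.PV_hopf_carrier KA.SC_eq_iff)
  interpret H: ring H by (rule ring_H)
  have mod: "add_closed_module base_field (mod_on scL A)" "add_closed_module base_field H"
  proof -
    have "abelian_group (mod_on scL A)"
      by (rule abelian_groupI) (auto simp: KA.As ac_simps intro: bexI[of _ "- _"])
    then show "add_closed_module base_field (mod_on scL A)" "add_closed_module base_field H"
      using H.is_abelian_group by (auto simp: add_closed_module_def KA.As KA.PV_hopf_carrier H_ops KA.scF_HF)
  qed
  \<comment> \<open>The map behind \<open>PV_mu\<close>, lifted to fragments. It is balanced only
    modulo \<open>NK\<close>, since the choice \<open>rep\<close> respects sums and scalars only up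
    to relations.\<close>
  define \<gamma> where "\<gamma> b h = mul (frag_of (b, 1)) (rep h)" for b h
  have bal: "balanced base_field (mod_on scL A) H NK \<gamma>"
    unfolding balanced_def
  proof (intro conjI ballI)
    fix b b' h assume "b \<in> carrier (mod_on scL A)" "b' \<in> carrier (mod_on scL A)" "h \<in> carrier H"
    then show "cg NK (\<gamma> (b \<oplus>\<^bsub>mod_on scL A\<^esub> b') h) (\<gamma> b h + \<gamma> b' h)"
      unfolding \<gamma>_def mul_add_left[symmetric] using rep(1)
      by (intro KA.mul_cg_left) (simp_all add: SN_frag_add KA.As KA.HF_free_on)
  next
    fix b h h' assume b: "b \<in> carrier (mod_on scL A)" and h: "h \<in> carrier H" "h' \<in> carrier H"
    have "cg NK (rep (h \<oplus>\<^bsub>H\<^esub> h')) (rep h + rep h')"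
      using rep(2) h by (intro repI KA.HF_add rep) (simp_all flip: H_ops(3))
    then show "cg NK (\<gamma> b (h \<oplus>\<^bsub>H\<^esub> h')) (\<gamma> b h + \<gamma> b h')"
      unfolding \<gamma>_def mul_add_right[symmetric] using b by (intro KA.mul_cg_right) (simp_all add: KA.As)
  next
    fix c b h assume b: "b \<in> carrier (mod_on scL A)" and h: "h \<in> carrier H"
    have "cg NK (rep (c \<odot>\<^bsub>H\<^esub> h)) (scF c (rep h))"
      using rep(2)[OF h] by (intro repI KA.scF_HF rep h) (simp flip: H_ops(5))
    then have "cg NK (\<gamma> b (c \<odot>\<^bsub>H\<^esub> h)) (mul (frag_of (b, 1)) (scF c (rep h)))"
      unfolding \<gamma>_def using b by (intro KA.mul_cg_right) (simp_all add: KA.As)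
    then show "cg NK (\<gamma> (c \<odot>\<^bsub>mod_on scL A\<^esub> b) h) (\<gamma> b (c \<odot>\<^bsub>H\<^esub> h))"
      using SN_sym by (simp add: \<gamma>_def mul_scF_frag)
  qed
  have mu: "PV_mu K A (TC (fr ys)) = SC K A (comb (map (\<lambda>(b, h). (b, rep h)) ys))"
    if ys: "set ys \<subseteq> A \<times> carrier H" for ys
  proof -
    have "PV_mu K A (TC (fr ys)) = SC K A (ext (\<lambda>(b, h). \<gamma> b h) (fr ys))"
      unfolding PV_mu_def TC_def
    proof (rule tensor_lift_tensor[OF mod _ _ _ bal])
      show "Poly_Mapping.keys (fr ys) \<subseteq> carrier (mod_on scL A) \<times> carrier H"
        using ys keys_fr[of ys] by auto
      fix b h assume bh: "b \<in> carrier (mod_on scL A)" "h \<in> carrier H"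
      have m: "frag_of (b, 1) \<in> free_on A" "rep h \<in> free_on A"
        using bh rep by (simp_all add: KA.As KA.HF_free_on)
      show "Poly_Mapping.keys (\<gamma> b h) \<subseteq> carrier (mod_on (*) A) \<times> carrier (mod_on (*) A)"
        using KA.mul_free_on[OF m] by (simp add: \<gamma>_def free_on_def)
      show "self_pure K A b 1 \<otimes>\<^bsub>self_tensor K A\<^esub> h = SC K A (\<gamma> b h)"
        using KA.SC_mult[OF m] rep(2)[OF bh(2)] by (simp add: pure_tensor_def \<gamma>_def)
    qed
    then show ?thesis by (simp add: comb_def \<gamma>_def case_prod_unfold comp_def)
  qed
  define t where "t = inv_into (carrier (tensor base_field (mod_on scL A) H)) (PV_mu K A) (self_pure K A 1 a)"
  have "self_pure K A 1 a \<in> PV_mu K A ` carrier (tensor base_field (mod_on scL A) H)"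
  proof -
    obtain xs where xs: "set xs \<subseteq> A \<times> KA.HF" "cg NK (frag_of (1, a)) (comb xs)"
      using comb_spanning[of "frag_of (1, a)"] a by (auto simp: KA.As)
    let ?ys = "map (\<lambda>(b, x). (b, SC K A x)) xs"
    have ys: "set ?ys \<subseteq> A \<times> carrier H" using xs(1) by (auto simp: KA.PV_hopf_carrier)
    have "cg NK (comb (map (\<lambda>(b, h). (b, rep h)) ?ys)) (comb xs)"
      using xs(1)
    proof (induction xs)
      case (Cons p xs)
      then show ?case
        by (cases p) (auto intro!: SN_add KA.mul_cg_right repI simp: KA.As)
    qed (simp add: SN_refl)
    then have "PV_mu K A (TC (fr ?ys)) = self_pure K A 1 a"
      unfolding mu[OF ys] using SN_trans[OF _ SN_sym[OF xs(2)]] by (simp add: pure_tensor_def KA.SC_eq_iff)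
    moreover have "TC (fr ?ys) \<in> carrier (tensor base_field (mod_on scL A) H)"
      using ys keys_fr[of ?ys] unfolding tensor_carrier TC_def by (intro imageI) auto
    ultimately show ?thesis by (intro image_eqI) (rule sym)
  qed
  then have t: "t \<in> carrier (tensor base_field (mod_on scL A) H)" "PV_mu K A t = self_pure K A 1 a"
    unfolding t_def by (rule inv_into_into, rule f_inv_into_f)
  obtain ys where ys: "set ys \<subseteq> A \<times> carrier H" "t = TC (fr ys)"
    using tensor_carrier_list[OF _ _ t(1)] mod by (auto simp: add_closed_module_def TC_def)
  let ?xs = "map (\<lambda>(b, h). (b, rep h)) ys"
  have xs: "set ?xs \<subseteq> A \<times> KA.HF" using ys(1) rep(1) by auto
  have "cg NK (frag_of (1, a)) (comb ?xs)"
    using t(2) mu[OF ys(1)] SN_sym by (simp add: ys(2) pure_tensor_def KA.SC_eq_iff)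
  then have "\<sigma> G a = comb_eval G ?xs" by (intro \<sigma>I G EvI xs)
  moreover have "tensor_lift (ring_on UNIV) (\<lambda>b h. scL (g h) b) t = comb_eval G ?xs"
  proof -
    have "balanced base_field (mod_on scL A) H {0} (\<lambda>b h. scL (g h) b)"
      unfolding balanced_def
    proof (intro conjI ballI)
      fix b h h' assume "h \<in> carrier H" "h' \<in> carrier H"
      then obtain x y where x: "x \<in> KA.HF" "h = SC K A x" and y: "y \<in> KA.HF" "h' = SC K A y"
        by (auto simp: KA.PV_hopf_carrier)
      show "cg {0} (scL (g (h \<oplus>\<^bsub>H\<^esub> h')) b) (scL (g h) b + scL (g h') b)"
        using galois_charD(1)[OF G x(1) y(1)] unfolding x(2) y(2) H_ops(3) by (simp add: G_def scL_simps(2))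
    next
      fix c b h assume "h \<in> carrier H"
      then obtain x where x: "x \<in> KA.HF" "h = SC K A x" by (auto simp: KA.PV_hopf_carrier)
      have "g (c \<odot>\<^bsub>H\<^esub> h) = g h * c"
        using galois_charD(4)[OF G x(1), of c] unfolding x(2) H_ops(5) by (simp add: G_def mult.commute)
      then show "cg {0} (scL (g h) (c \<odot>\<^bsub>mod_on scL A\<^esub> b)) (scL (g (c \<odot>\<^bsub>H\<^esub> h)) b)"
        by (simp add: scL_simps(3))
    qed (simp add: scL_simps(1))
    then have "tensor_lift (ring_on UNIV) (\<lambda>b h. scL (g h) b) t = sum_list (map (\<lambda>(b, h). scL (g h) b) ys)"
      unfolding ys(2) TC_def by (subst tensor_lift_type) simp_all
    also have "map (\<lambda>(b, h). scL (g h) b) ys = map (\<lambda>(b, x). scL (G x) b) ?xs"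
      using ys(1) rep(2) by (auto simp: G_def)
    finally show ?thesis by (simp add: comb_eval_def)
  qed
  ultimately show ?thesis unfolding character_act_A_def t_def[symmetric] G_def[symmetric] by simp
qed

lemma character_act_eq:
  assumes "galois_char (\<lambda>x. g (SC K A x))"
  shows "character_act \<Delta> \<epsilon> scL act K A g = \<Sigma> (\<lambda>x. g (SC K A x))"
  unfolding character_act_def
proof (rule the_equality)
  fix \<tau> assume "\<tau> \<in> ring_hom (ring_on UNIV) (ring_on UNIV) \<and>
    (\<forall>a\<in>A. \<tau> a = character_act_A \<Delta> \<epsilon> scL act K A g a)"
  then show "\<tau> = \<Sigma> (\<lambda>x. g (SC K A x))"
    by (intro \<Sigma>_unique[OF assms]) (simp_all add: character_act_A_eq[where g = g, OF assms])
qed (simp add: \<Sigma>_hom[OF assms] \<Sigma>_A[OF assms] character_act_A_eq[where g = g, OF assms])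

text \<open>Pulled back to representatives, the characters of the quotient form the set
  \<open>\<G>\<close>. By the hypothesis a constant on which all of them vanish has trivial coset,
  hence is represented in \<open>NF\<close>; this is the separation condition of
  \<open>fixed_iff\<close>.\<close>

lemma fixed_algebra_eq:
  assumes "carrier (quot_algebra H I) \<inter>
      (\<Inter>g\<in>characters (quot_algebra H I). a_kernel (quot_algebra H I) base_field g)
      = {\<zero>\<^bsub>quot_algebra H I\<^esub>}"
  shows "fixed_algebra \<Delta> \<epsilon> scL act K A I = F"
proof -
  define \<G> where "\<G> = (\<lambda>g x. g (proj x)) ` characters (quot_algebra H I)"
  have galois_char: "galois_char G" if "G \<in> \<G>" for G using that galois_char_character by (auto simp: \<G>_def)
  have Z: "x \<in> NF" if x: "x \<in> KA.HF" and 0: "\<And>G. G \<in> \<G> \<Longrightarrow> G x = 0" for x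
  proof -
    interpret I: ideal I H by (rule ideal_I)
    have "proj x \<in> a_kernel (quot_algebra H I) base_field g" if "g \<in> characters (quot_algebra H I)" for g
      using 0 that proj_carrier[OF x] by (auto simp: a_kernel_def' \<G>_def)
    then have "proj x = I" using assms proj_carrier[OF x] by (auto simp: quot_ops)
    moreover have "SC K A x \<in> proj x"
      unfolding proj_def using x by (intro I.a_rcos_self) (simp add: KA.PV_hopf_carrier)
    ultimately obtain y where "y \<in> NF" "SC K A x = SC K A y" by (auto simp: galois_ideal_eq)
    then show "x \<in> NF" using cg_mem_iff[OF subgrp_SN cg_NK_NF] by (auto simp: KA.SC_eq_iff)
  qed
  have "character_act \<Delta> \<epsilon> scL act K A (\<lambda>h. g (I +>\<^bsub>H\<^esub> h)) = \<Sigma> (\<lambda>x. g (proj x))"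
    if "g \<in> characters (quot_algebra H I)" for g
    using character_act_eq[of "\<lambda>h. g (I +>\<^bsub>H\<^esub> h)"] galois_char_character[OF that] by (simp add: proj_def)
  then have "fixed_algebra \<Delta> \<epsilon> scL act K A I = {x. \<forall>G\<in>\<G>. \<Sigma> G x = x}"
    by (auto simp: fixed_algebra_def Let_def \<G>_def)
  then show ?thesis using fixed_iff[OF Z galois_char] by auto
qed

end

theorem theorem2p2:
  fixes scD :: "'k::field \<Rightarrow> 'd::ring_1 \<Rightarrow> 'd"
    and \<Delta> :: "'d \<Rightarrow> ('d, 'd) tens"
    and \<epsilon> :: "'d \<Rightarrow> 'k"
    and D1 :: "'d set"
    and scL :: "'k \<Rightarrow> 'l::comm_ring_1 \<Rightarrow> 'l"
    and act :: "'d \<Rightarrow> 'l \<Rightarrow> 'l"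
    and K A F :: "'l set"
    and H :: "('k, ('l, 'l) tens) module"
    and I :: "('l, 'l) tens set"
  assumes "hopf_algebra (mod_on scD UNIV) \<Delta> \<epsilon>"
    and "cocommutative (mod_on scD UNIV) \<Delta>"
    and "pointed (mod_on scD UNIV) \<Delta>"
    and "irreducible_component (mod_on scD UNIV) \<Delta> D1"
    and "1 \<in> D1"
    and "birkhoff_witt_bialgebra scD D1 (sub_comult (mod_on scD UNIV) \<Delta> D1) \<epsilon>"
    and "module_algebra scD \<Delta> \<epsilon> scL act"
    and "PV_extension \<Delta> \<epsilon> scL act K A"
    and "H = PV_hopf \<Delta> \<epsilon> scL act K A"
    and "constants \<epsilon> scL act UNIV = range (\<lambda>c. scL c 1)"
    and "constants \<epsilon> scL act K = range (\<lambda>c. scL c 1)"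
    and "finitely_generated_over scL act K"
    and "AS_subalgebra scL act F" and "K \<subseteq> F"
    and "I = galois_ideal \<Delta> \<epsilon> scL act K A F"
    and "carrier (quot_algebra H I) \<inter>
         (\<Inter>g\<in>characters (quot_algebra H I). a_kernel (quot_algebra H I) base_field g)
         = {\<zero>\<^bsub>quot_algebra H I\<^esub>}"
  shows "fixed_algebra \<Delta> \<epsilon> scL act K A I = F"
proof -
  interpret cocommutative_module_algebra scD \<Delta> \<epsilon> scL act
    using assms(2,7) by (simp add: cocommutative_module_algebra_def cocommutative_module_algebra_axioms_def)
  interpret picard_vessiot scD \<Delta> \<epsilon> scL act K A F
    by unfold_locales (use assms in auto)
  show ?thesis
    unfolding assms(15) by (rule fixed_algebra_eq) (use assms(16) in \<open>simp only: assms(9,15)\<close>)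
qed

end
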